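(* Let $(G,V,E)$ be a graph. For each $i\ge 0$ there is a polynomial $p_i$ of degree $i$ (independent of $n$) such that for every $n\ge 0$ there exists a discrete gradient vector field $X$ on the CW complex $\mathrm{DConf}_n^{\mathrm{sink}}(G,V)$ (which is homotopy equivalent to $\mathrm{Conf}_n^{\mathrm{sink}}(G,V)$) for which, for every $i \geq 0$, the number of critical $i$-cells of $X$ is bounded above by $p_i(n)(i+1)^n$.
   Context: A graph $(G,V,E)$ is a compact connected CW complex $G$ of dimension one together with its set $V$ of 0-cells (vertices) and its set $E$ of 1-cells (edges); loops and multiple edges are allowed. $\mathrm{Conf}_n^{\mathrm{sink}}(G,V)=\{(x_1,\dots,x_n)\in G^n \mid \text{for all } i\neq j:\ x_i\neq x_j \text{ or } x_i=x_j\in V\}$. Its cellular model $\mathrm{DConf}_n^{\mathrm{sink}}(G,V)$ is the subcomplex of $G^n$ that is the union of all product cells $\sigma_1\times\cdots\times\sigma_n$ (each $\sigma_j$ a vertex or an open edge of $G$) such that $\sigma_i\neq\sigma_j$ whenever $i\ne j$ and $\sigma_i,\sigma_j$ are both 1-cells. Discrete Morse theory. Let $Y$ be a CW complex with set $\mathcal{K}_i$ of (open) $i$-cells. A cell $\tau^{(i)}\subseteq\overline{\sigma^{(i+1)}}$ is a regular face of $\sigma^{(i+1)}$ if, for a characteristic map $\Phi_\sigma:D^{i+1}\to Y$, $\Phi_\sigma$ restricted to $\Phi_\sigma^{-1}(\tau)$ is a homeomorphism and $\Phi_\sigma^{-1}(\tau)$ is a ball. A discrete vector field $X$ on $Y$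 is a collection of partially defined functions $X_i:\mathcal{K}_i\to\mathcal{K}_{i+1}$ such that for each $i$: $X_i$ is injective; the image of $X_i$ is disjoint from the domain of $X_{i+1}$; and each $\sigma$ in the domain of $X_i$ is a regular face of $X_i(\sigma)$. A cellular path is a finite sequence of $i$-cells $\alpha_0,\dots,\alpha_l$ such that $\alpha_{j+1}$ is a face of $X_i(\alpha_j)$ for each $0\le j<l$; it is closed if $\alpha_0=\alpha_l$ and trivial if all $\alpha_j$ are equal. A discrete gradient vector field is a discrete vector field with no non-trivial closed cellular paths. A cell is redundant if it is in the domain of some $X_i$, collapsible if it is in the image of some $X_i$, and critical otherwise. *)

theory Defs
  imports "HOL-Analysis.Analysis" "HOL-Computational_Algebra.Polynomial"
begin

section \<open>CW complexes\<close>

definition closed_disc :: "nat \<Rightarrow> (nat \<Rightarrow> real) topology" where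
  "closed_disc k = subtopology (Euclidean_space k) {x. (\<Sum>i<k. (x i)\<^sup>2) \<le> 1}"

definition open_disc :: "nat \<Rightarrow> (nat \<Rightarrow> real) topology" where
  "open_disc k = subtopology (Euclidean_space k) {x. (\<Sum>i<k. (x i)\<^sup>2) < 1}"

text \<open>
  A cell structure on a space \<open>Y\<close> is a family \<open>K\<close>, where \<open>K k\<close> is the set of open \<open>k\<close>-cells,
  each cell being a subset of \<open>Y\<close>. Characteristic maps are required to exist but are not
  part of the data.
\<close>

definition characteristic_map ::
  "'c topology \<Rightarrow> (nat \<Rightarrow> 'c set set) \<Rightarrow> nat \<Rightarrow> 'c set \<Rightarrow> ((nat \<Rightarrow> real) \<Rightarrow> 'c) \<Rightarrow> bool" where
  "characteristic_map Y K k \<sigma> \<Phi> \<longleftrightarrow>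
     continuous_map (closed_disc k) Y \<Phi> \<and>
     homeomorphic_map (open_disc k) (subtopology Y \<sigma>) \<Phi> \<and>
     \<Phi> ` (topspace (closed_disc k) - topspace (open_disc k)) \<subseteq> (\<Union>j<k. \<Union>(K j))"

definition cw_complex :: "'c topology \<Rightarrow> (nat \<Rightarrow> 'c set set) \<Rightarrow> bool" where
  "cw_complex Y K \<longleftrightarrow>
     Hausdorff_space Y \<and>
     (\<Union>k. \<Union>(K k)) = topspace Y \<and>
     (\<forall>k l. \<forall>\<sigma>\<in>K k. \<forall>\<tau>\<in>K l. (k, \<sigma>) \<noteq> (l, \<tau>) \<longrightarrow> \<sigma> \<inter> \<tau> = {}) \<and>
     (\<forall>k. \<forall>\<sigma>\<in>K k. \<exists>\<Phi>. characteristic_map Y K k \<sigma> \<Phi>) \<and>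
     (\<forall>k. \<forall>\<sigma>\<in>K k. finite {\<tau> \<in> (\<Union>l. K l). \<tau> \<inter> Y closure_of \<sigma> \<noteq> {}}) \<and>
     (\<forall>A. A \<subseteq> topspace Y \<longrightarrow>
        (closedin Y A \<longleftrightarrow> (\<forall>k. \<forall>\<sigma>\<in>K k. closedin Y (A \<inter> Y closure_of \<sigma>))))"

section \<open>Discrete Morse theory\<close>

definition face :: "'c topology \<Rightarrow> (nat \<Rightarrow> 'c set set) \<Rightarrow> nat \<Rightarrow> 'c set \<Rightarrow> 'c set \<Rightarrow> bool" where
  "face Y K i \<tau> \<sigma> \<longleftrightarrow> \<tau> \<in> K i \<and> \<sigma> \<in> K (Suc i) \<and> \<tau> \<subseteq> Y closure_of \<sigma>"

text \<open>
  Cells are open cells, so the preimage of an \<open>i\<close>-cell under the characteristic map is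
  asked to be an open \<open>i\<close>-ball.
\<close>

definition regular_face ::
  "'c topology \<Rightarrow> (nat \<Rightarrow> 'c set set) \<Rightarrow> nat \<Rightarrow> 'c set \<Rightarrow> 'c set \<Rightarrow> bool" where
  "regular_face Y K i \<tau> \<sigma> \<longleftrightarrow>
     face Y K i \<tau> \<sigma> \<and>
     (\<exists>\<Phi>. characteristic_map Y K (Suc i) \<sigma> \<Phi> \<and>
       (let P = subtopology (closed_disc (Suc i)) (\<Phi> -` \<tau>) in
          homeomorphic_map P (subtopology Y \<tau>) \<Phi> \<and> P homeomorphic_space open_disc i))"

definition discrete_vector_field ::
  "'c topology \<Rightarrow> (nat \<Rightarrow> 'c set set) \<Rightarrow> (nat \<Rightarrow> 'c set \<rightharpoonup> 'c set) \<Rightarrow> bool" where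
  "discrete_vector_field Y K X \<longleftrightarrow>
     (\<forall>i. dom (X i) \<subseteq> K i \<and> ran (X i) \<subseteq> K (Suc i) \<and>
          inj_on (X i) (dom (X i)) \<and>
          ran (X i) \<inter> dom (X (Suc i)) = {} \<and>
          (\<forall>\<sigma> \<tau>. X i \<sigma> = Some \<tau> \<longrightarrow> regular_face Y K i \<sigma> \<tau>))"

definition cellular_path ::
  "'c topology \<Rightarrow> (nat \<Rightarrow> 'c set set) \<Rightarrow> (nat \<Rightarrow> 'c set \<rightharpoonup> 'c set) \<Rightarrow> nat \<Rightarrow> 'c set list \<Rightarrow> bool" where
  "cellular_path Y K X i \<alpha> \<longleftrightarrow>
     \<alpha> \<noteq> [] \<and> set \<alpha> \<subseteq> K i \<and>
     (\<forall>j. Suc j < length \<alpha> \<longrightarrow> (\<exists>\<sigma>. X i (\<alpha> ! j) = Some \<sigma> \<and> face Y K i (\<alpha> ! Suc j) \<sigma>))"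

definition discrete_gradient_vector_field ::
  "'c topology \<Rightarrow> (nat \<Rightarrow> 'c set set) \<Rightarrow> (nat \<Rightarrow> 'c set \<rightharpoonup> 'c set) \<Rightarrow> bool" where
  "discrete_gradient_vector_field Y K X \<longleftrightarrow>
     discrete_vector_field Y K X \<and>
     (\<forall>i \<alpha>. cellular_path Y K X i \<alpha> \<and> hd \<alpha> = last \<alpha> \<longrightarrow> (\<forall>\<beta>\<in>set \<alpha>. \<beta> = hd \<alpha>))"

definition critical_cells ::
  "(nat \<Rightarrow> 'c set set) \<Rightarrow> (nat \<Rightarrow> 'c set \<rightharpoonup> 'c set) \<Rightarrow> nat \<Rightarrow> 'c set set" where
  "critical_cells K X i = {\<sigma> \<in> K i. \<forall>j. \<sigma> \<notin> dom (X j) \<and> \<sigma> \<notin> ran (X j)}"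

section \<open>Graphs and configuration spaces with sinks\<close>

text \<open>Vertices are points of \<open>G\<close>; edges are open 1-cells, i.e. subsets of \<open>G\<close>.\<close>

definition graph_cells :: "'a set \<Rightarrow> 'a set set \<Rightarrow> nat \<Rightarrow> 'a set set" where
  "graph_cells V E k = (if k = 0 then (\<lambda>v. {v}) ` V else if k = 1 then E else {})"

definition cw_graph :: "'a topology \<Rightarrow> 'a set \<Rightarrow> 'a set set \<Rightarrow> bool" where
  "cw_graph G V E \<longleftrightarrow>
     cw_complex G (graph_cells V E) \<and> E \<noteq> {} \<and> compact_space G \<and> connected_space G"

definition conf_sink :: "'a topology \<Rightarrow> 'a set \<Rightarrow> nat \<Rightarrow> (nat \<Rightarrow> 'a) topology" where
  "conf_sink G V n =
     subtopology (product_topology (\<lambda>_. G) {..<n})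
       {x. \<forall>i<n. \<forall>j<n. i \<noteq> j \<longrightarrow> x i \<noteq> x j \<or> (x i = x j \<and> x i \<in> V)}"

definition dconf_sink_cells :: "'a set \<Rightarrow> 'a set set \<Rightarrow> nat \<Rightarrow> nat \<Rightarrow> (nat \<Rightarrow> 'a) set set" where
  "dconf_sink_cells V E n i =
     {PiE {..<n} \<sigma> | \<sigma>.
        (\<forall>j<n. \<sigma> j \<in> graph_cells V E 0 \<union> graph_cells V E 1) \<and>
        (\<forall>j<n. \<forall>k<n. j \<noteq> k \<and> \<sigma> j \<in> E \<and> \<sigma> k \<in> E \<longrightarrow> \<sigma> j \<noteq> \<sigma> k) \<and>
        card {j. j < n \<and> \<sigma> j \<in> E} = i}"

definition dconf_sink :: "'a topology \<Rightarrow> 'a set \<Rightarrow> 'a set set \<Rightarrow> nat \<Rightarrow> (nat \<Rightarrow> 'a) topology" where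
  "dconf_sink G V E n =
     subtopology (product_topology (\<lambda>_. G) {..<n}) (\<Union>i. \<Union>(dconf_sink_cells V E n i))"

end

theory Submission
  imports Defs
begin

text \<open>
  A cell of the cellular model is a word of length \<open>n\<close> whose letters are vertices and edges and in
  which no edge occurs twice; its dimension is the number of edge letters. By compactness the
  graph is finite, and by connectedness it has a spanning tree rooted at some vertex \<open>r\<close>. Every
  other vertex \<open>v\<close> owns the tree edge \<open>up v\<close> that leads from \<open>v\<close> towards the root.

  \<^emph>\<open>Matching.\<close> The letters \<open>v\<close> and \<open>up v\<close> form a class, and different classes are disjoint. If a
  word uses the class of \<open>v\<close>, its first letter in that class can be switched between \<open>v\<close> and
  \<open>up v\<close>, unless that letter is \<open>v\<close> and \<open>up v\<close> occurs later: the switch would then repeat an edge.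
  Call the class active if the switch is possible. Switching a letter of one class does not change
  which classes are active, so always switching in the first active class (in a fixed order of the
  vertices) is an involution, and it pairs each word whose switched letter is \<open>v\<close> with the word of
  one dimension more (\<open>lift_word\<close>, \<open>lift_inverse\<close>, \<open>redundant_or_lift\<close>). The edge \<open>up v\<close> is not a
  loop, so this is a regular face (\<open>regular_face_word\<close>).

  \<^emph>\<open>Counting.\<close> A critical word has no active class. So whenever it contains a vertex \<open>v\<close> other
  than the root, it also contains \<open>up v\<close>. A critical word with \<open>i\<close> edge letters therefore takes
  its vertex letters from the root and at most \<open>i\<close> further vertices. There are at most \<open>n^i\<close> sets of
  positions for the edges, \<open>card E ^ i\<close> ways to fill them and \<open>(i + 1)^n\<close> ways to fill the rest,
  so \<open>p i = card E ^ i * x^i\<close> works (\<open>card_spread_words\<close>).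

  \<^emph>\<open>Acyclicity.\<close> Give a vertex its depth in the tree, \<open>up v\<close> the depth of \<open>v\<close>, and every other edge
  a depth larger than that of all vertices. Along a cellular path the sum of the depths never
  increases, and when it stays the same and the word changes, the first active class moves strictly
  down in the fixed order (\<open>path_step_decreases\<close>).

  \<^emph>\<open>Cells.\<close> The closure of a product cell is parametrised by a cube, one coordinate for each edge
  letter, and a radial map turns the disc into the cube. A continuous map from a compact space to
  a Hausdorff space is a homeomorphism over every set over which it is bijective; this one
  principle gives the characteristic maps as well as the regularity of faces
  (\<open>homeomorphic_map_char_map_subcell\<close>).

  \<^emph>\<open>Homotopy equivalence.\<close> A configuration in which several particles share an edge is pushed into
  the cellular model by sending all of them to the ends of that edge, except possibly a weighted
  median particle. The weights vanish at the ends of the edge, so particles may enter and leave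
  the edge continuously (\<open>target_dichotomy\<close>, \<open>continuous_map_push\<close>).
\<close>

section \<open>Continuity and homeomorphisms from compact spaces\<close>

text \<open>
  Where \<open>g\<close> vanishes, \<open>f\<close> is squeezed to \<open>0\<close>. The lemma covers functions \<open>g * h\<close> with \<open>h\<close> bounded but
  discontinuous at the zeros of \<open>g\<close>: the radial map at the origin, and signs of differences of
  coordinates weighted by a factor that vanishes where the sign jumps.
\<close>

lemma continuous_map_vanishing_product:
  fixes f g :: "'b \<Rightarrow> real"
  assumes g: "continuous_map X euclideanreal g"
    and f: "continuous_map (subtopology X {x. g x \<noteq> 0}) euclideanreal f"
    and le: "\<And>x. x \<in> topspace X \<Longrightarrow> \<bar>f x\<bar> \<le> C * \<bar>g x\<bar>"
  shows "continuous_map X euclideanreal f"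
  unfolding continuous_map_def
proof (intro conjI allI impI)
  show "f \<in> topspace X \<rightarrow> topspace euclideanreal" by simp
  fix U :: "real set" assume U: "openin euclideanreal U"
  have "openin X {x \<in> topspace X. g x \<in> - {0}}"
    by (rule openin_continuous_map_preimage[OF g]) auto
  then have op: "openin X (topspace X \<inter> {x. g x \<noteq> 0})" by (simp add: Int_def)
  have "openin (subtopology X {x. g x \<noteq> 0})
      {x \<in> topspace (subtopology X {x. g x \<noteq> 0}). f x \<in> U}"
    by (rule openin_continuous_map_preimage[OF f U])
  then have "openin (subtopology X (topspace X \<inter> {x. g x \<noteq> 0}))
      {x \<in> topspace X. g x \<noteq> 0 \<and> f x \<in> U}"
    by (simp add: subtopology_restrict)
  then have 1: "openin X {x \<in> topspace X. g x \<noteq> 0 \<and> f x \<in> U}"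
    by (rule openin_trans_full[OF _ op])
  show "openin X {x \<in> topspace X. f x \<in> U}"
  proof (cases "0 \<in> U")
    case False
    then have "f x \<notin> U" if "g x = 0" "x \<in> topspace X" for x using le[OF that(2)] that by auto
    then have "{x \<in> topspace X. f x \<in> U} = {x \<in> topspace X. g x \<noteq> 0 \<and> f x \<in> U}" by auto
    then show ?thesis using 1 by simp
  next
    case True
    then obtain e where e: "e > 0" "\<And>y. \<bar>y\<bar> < e \<Longrightarrow> y \<in> U"
      using U by (metis dist_real_def open_dist open_openin diff_zero)
    \<comment> \<open>Adding \<open>1\<close> keeps the denominator positive, whatever \<open>C\<close> is.\<close>
    define d where "d = e / (\<bar>C\<bar> + 1)"
    have "d > 0" using e by (simp add: d_def)
    have sub: "f x \<in> U" if "\<bar>g x\<bar> < d" "x \<in> topspace X" for x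
    proof -
      have "\<bar>f x\<bar> \<le> (\<bar>C\<bar> + 1) * \<bar>g x\<bar>"
        using le[OF that(2)] by (smt (verit) abs_ge_self mult_right_mono abs_ge_zero)
      also have "\<dots> < (\<bar>C\<bar> + 1) * d" using that by (intro mult_strict_left_mono) auto
      also have "\<dots> = e" by (simp add: d_def field_simps)
      finally show ?thesis using e by auto
    qed
    have 2: "openin X {x \<in> topspace X. g x \<in> {-d<..<d}}"
      by (rule openin_continuous_map_preimage[OF g]) auto
    have "{x \<in> topspace X. f x \<in> U} =
        {x \<in> topspace X. g x \<noteq> 0 \<and> f x \<in> U} \<union> {x \<in> topspace X. g x \<in> {-d<..<d}}"
      using sub \<open>d > 0\<close> by (auto simp: abs_less_iff)
    then show ?thesis using openin_Un[OF 1 2] by simp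
  qed
qed

text \<open>
  A continuous map from a compact space to a Hausdorff space is closed, and closedness survives
  restriction to a full preimage. Only injectivity and surjectivity over \<open>S\<close> remain to be checked.
\<close>

lemma homeomorphic_map_full_preimage:
  assumes "compact_space X" "Hausdorff_space Y" "continuous_map X Y f"
    and inj: "inj_on f {x \<in> topspace X. f x \<in> S}" and sur: "S \<subseteq> f ` topspace X"
  shows "homeomorphic_map (subtopology X (f -` S)) (subtopology Y S) f"
proof (rule bijective_closed_imp_homeomorphic_map)
  have Y: "f ` topspace X \<subseteq> topspace Y" using assms(3) by (auto simp: continuous_map_def)
  show "continuous_map (subtopology X (f -` S)) (subtopology Y S) f"
    unfolding continuous_map_in_subtopology
    using continuous_map_from_subtopology[OF assms(3)] by (simp add: image_subset_iff)
  have e: "subtopology X (f -` S) = subtopology X {x \<in> topspace X. f x \<in> S}"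
  proof -
    have "topspace X \<inter> f -` S = {x \<in> topspace X. f x \<in> S}" by auto
    then show ?thesis by (metis subtopology_restrict)
  qed
  show "closed_map (subtopology X (f -` S)) (subtopology Y S) f"
    unfolding e using continuous_imp_closed_map[OF assms(3) assms(1,2)]
    by (rule closed_map_restriction) auto
  have "f ` (topspace X \<inter> f -` S) = f ` topspace X \<inter> S" by blast
  then show "f ` topspace (subtopology X (f -` S)) = topspace (subtopology Y S)"
    using Y sur by (metis Int_absorb1 order_trans topspace_subtopology)
  show "inj_on f (topspace (subtopology X (f -` S)))"
    using inj by (auto simp: inj_on_def)
qed

section \<open>The closed disc as a cube\<close>

lemma topspace_closed_disc:
  "topspace (closed_disc k) = {x. (\<forall>i\<ge>k. x i = 0) \<and> (\<Sum>i<k. (x i)\<^sup>2) \<le> 1}"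
  by (auto simp: closed_disc_def topspace_Euclidean_space)

lemma topspace_open_disc:
  "topspace (open_disc k) = {x. (\<forall>i\<ge>k. x i = 0) \<and> (\<Sum>i<k. (x i)\<^sup>2) < 1}"
  by (auto simp: open_disc_def topspace_Euclidean_space)

lemma open_disc_eq_subtopology:
  "open_disc k = subtopology (closed_disc k) (topspace (open_disc k))"
proof -
  have "{x. (\<Sum>i<k. (x i)\<^sup>2) \<le> 1} \<inter> topspace (open_disc k) = topspace (open_disc k)"
    by (auto simp: topspace_open_disc)
  moreover have "subtopology (Euclidean_space k) (topspace (open_disc k)) = open_disc k"
    unfolding open_disc_def topspace_subtopology by (rule subtopology_restrict)
  ultimately show ?thesis by (simp add: closed_disc_def subtopology_subtopology)
qed

lemma continuous_map_closed_disc_coordinate [continuous_intros]: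
  "continuous_map (closed_disc k) euclideanreal (\<lambda>x. x i)"
  unfolding closed_disc_def Euclidean_space_def
  by (intro continuous_map_from_subtopology continuous_map_product_projection) auto

lemma compact_space_closed_disc: "compact_space (closed_disc k)"
proof -
  let ?B = "PiE UNIV (\<lambda>i. if i < k then {-1..1::real} else {0})"
  let ?S = "{x. (\<Sum>i<k. (x i)\<^sup>2) \<le> (1::real)}"
  have B: "compactin (powertop_real UNIV) ?B"
    by (subst compactin_PiE) auto
  have "closedin (powertop_real UNIV) {x \<in> topspace (powertop_real UNIV). (\<Sum>i<k. (x i)\<^sup>2) \<in> {..1}}"
    by (rule closedin_continuous_map_preimage[of _ euclideanreal])
       (auto intro!: continuous_intros continuous_map_product_projection)
  then have C: "closedin (powertop_real UNIV) ?S" by simp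
  have sq: "\<bar>x i\<bar> \<le> 1" if "(\<Sum>i<k. (x i)\<^sup>2) \<le> (1::real)" "i < k" for x :: "nat \<Rightarrow> real" and i
  proof -
    have "(x i)\<^sup>2 \<le> (\<Sum>i<k. (x i)\<^sup>2)" using that by (intro member_le_sum) auto
    then show ?thesis using that by (simp add: abs_square_le_1[symmetric])
  qed
  have "?S \<inter> ?B = {x. \<forall>i\<ge>k. x i = 0} \<inter> ?S"
  proof (intro equalityI subsetI)
    fix x assume "x \<in> ?S \<inter> ?B"
    then have "x i \<in> (if i < k then {-1..1} else {0})" for i by (auto simp: PiE_iff)
    from this have "x i = 0" if "i \<ge> k" for i using that by (metis leD singletonD)
    then show "x \<in> {x. \<forall>i\<ge>k. x i = 0} \<inter> ?S" using \<open>x \<in> ?S \<inter> ?B\<close> by simp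
  next
    fix x assume x: "x \<in> {x. \<forall>i\<ge>k. x i = 0} \<inter> ?S"
    have "x i \<in> (if i < k then {-1..1} else {0})" for i
      using x sq[of x i] by (cases "i < k") (simp_all add: abs_le_iff)
    then show "x \<in> ?S \<inter> ?B" using x by (simp add: PiE_iff)
  qed
  moreover have "compactin (powertop_real UNIV) (?S \<inter> ?B)"
    by (rule closed_Int_compactin[OF C B])
  ultimately show ?thesis
    by (simp add: closed_disc_def Euclidean_space_def subtopology_subtopology compact_space_subtopology)
qed

text \<open>
  The ball of this norm is the cube. The recursion starts at \<open>0\<close>, so that the norm is also defined in
  dimension \<open>0\<close>, where a maximum over the coordinates would not be.
\<close>

primrec max_norm :: "nat \<Rightarrow> (nat \<Rightarrow> real) \<Rightarrow> real" where
  "max_norm 0 x = 0"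
| "max_norm (Suc k) x = max (max_norm k x) \<bar>x k\<bar>"

lemma max_norm_nonneg: "max_norm k x \<ge> 0"
  by (induction k) auto

lemma max_norm_le_iff: "0 \<le> c \<Longrightarrow> max_norm k x \<le> c \<longleftrightarrow> (\<forall>i<k. \<bar>x i\<bar> \<le> c)"
  by (induction k) (auto simp: less_Suc_eq)

lemma max_norm_less_iff: "0 < c \<Longrightarrow> max_norm k x < c \<longleftrightarrow> (\<forall>i<k. \<bar>x i\<bar> < c)"
  by (induction k) (auto simp: less_Suc_eq)

lemma coordinate_le_max_norm: "i < k \<Longrightarrow> \<bar>x i\<bar> \<le> max_norm k x"
  using max_norm_le_iff[of "max_norm k x" k x] max_norm_nonneg by blast

lemma max_norm_scale: "max_norm k (\<lambda>i. c * x i) = \<bar>c\<bar> * max_norm k x"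
  by (induction k) (auto simp: max_def abs_mult mult_le_cancel_left not_le)

lemma continuous_map_max_norm: "continuous_map (closed_disc k) euclideanreal (max_norm l)"
proof (induction l)
  case (Suc l)
  then show ?case
    by (auto intro!: continuous_intros)
qed simp

definition euclidean_norm :: "nat \<Rightarrow> (nat \<Rightarrow> real) \<Rightarrow> real" where
  "euclidean_norm k x = sqrt (\<Sum>i<k. (x i)\<^sup>2)"

lemma euclidean_norm_nonneg: "euclidean_norm k x \<ge> 0"
  by (simp add: euclidean_norm_def sum_nonneg)

lemma euclidean_norm_scale: "euclidean_norm k (\<lambda>i. c * x i) = \<bar>c\<bar> * euclidean_norm k x"
  by (simp add: euclidean_norm_def power_mult_distrib sum_distrib_left[symmetric] real_sqrt_mult)

lemma coordinate_le_euclidean_norm: "i < k \<Longrightarrow> \<bar>x i\<bar> \<le> euclidean_norm k x"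
  unfolding euclidean_norm_def by (rule real_le_rsqrt) (auto intro!: member_le_sum)

lemma max_norm_le_euclidean_norm: "max_norm k x \<le> euclidean_norm k x"
  by (simp add: max_norm_le_iff euclidean_norm_nonneg coordinate_le_euclidean_norm)

lemma euclidean_norm_eq_0_iff: "euclidean_norm k x = 0 \<longleftrightarrow> max_norm k x = 0"
proof
  assume "euclidean_norm k x = 0"
  then show "max_norm k x = 0"
    using max_norm_le_euclidean_norm[of k x] max_norm_nonneg[of k x] by simp
next
  assume "max_norm k x = 0"
  then have "x i = 0" if "i < k" for i using coordinate_le_max_norm[OF that, of x] by simp
  then show "euclidean_norm k x = 0" by (simp add: euclidean_norm_def)
qed

lemma continuous_map_euclidean_norm:
  "continuous_map (closed_disc k) euclideanreal (euclidean_norm l)"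
  unfolding euclidean_norm_def by (intro continuous_intros) auto

text \<open>
  The radial homeomorphism: each ray is rescaled so that the Euclidean norm of the argument becomes
  the maximum norm of the value. At the origin the factor is \<open>0 / 0 = 0\<close>, which gives the right value.
\<close>

definition disc_to_cube :: "nat \<Rightarrow> (nat \<Rightarrow> real) \<Rightarrow> nat \<Rightarrow> real" where
  "disc_to_cube k x = (\<lambda>i. euclidean_norm k x / max_norm k x * x i)"

definition cube_to_disc :: "nat \<Rightarrow> (nat \<Rightarrow> real) \<Rightarrow> nat \<Rightarrow> real" where
  "cube_to_disc k y = (\<lambda>i. max_norm k y / euclidean_norm k y * y i)"

lemma max_norm_disc_to_cube: "max_norm k (disc_to_cube k x) = euclidean_norm k x"
  unfolding disc_to_cube_def max_norm_scale
  using euclidean_norm_nonneg[of k x] max_norm_nonneg[of k x] euclidean_norm_eq_0_iff[of k x]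
  by auto

lemma euclidean_norm_cube_to_disc: "euclidean_norm k (cube_to_disc k y) = max_norm k y"
  unfolding cube_to_disc_def euclidean_norm_scale
  using euclidean_norm_nonneg[of k y] max_norm_nonneg[of k y] euclidean_norm_eq_0_iff[of k y]
  by auto

lemma disc_to_cube_inverse:
  assumes "\<forall>i\<ge>k. x i = 0" shows "cube_to_disc k (disc_to_cube k x) = x"
proof
  fix i
  show "cube_to_disc k (disc_to_cube k x) i = x i"
  proof (cases "max_norm k x = 0")
    case True
    then have "x i = 0" using coordinate_le_max_norm[of i k x] assms by (cases "i < k") auto
    then show ?thesis by (simp add: cube_to_disc_def disc_to_cube_def)
  next
    case False
    have "cube_to_disc k (disc_to_cube k x) i =
      euclidean_norm k x / euclidean_norm k (disc_to_cube k x) * disc_to_cube k x i"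
      unfolding cube_to_disc_def max_norm_disc_to_cube ..
    also have "euclidean_norm k (disc_to_cube k x) = euclidean_norm k x / max_norm k x * euclidean_norm k x"
      unfolding disc_to_cube_def euclidean_norm_scale
      using euclidean_norm_nonneg[of k x] max_norm_nonneg[of k x] by simp
    finally show ?thesis
      using False euclidean_norm_eq_0_iff[of k x] by (simp add: disc_to_cube_def field_simps)
  qed
qed

lemma cube_to_disc_inverse:
  assumes "\<forall>i\<ge>k. y i = 0" shows "disc_to_cube k (cube_to_disc k y) = y"
proof
  fix i
  show "disc_to_cube k (cube_to_disc k y) i = y i"
  proof (cases "max_norm k y = 0")
    case True
    then have "y i = 0" using coordinate_le_max_norm[of i k y] assms by (cases "i < k") auto
    then show ?thesis by (simp add: cube_to_disc_def disc_to_cube_def)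
  next
    case False
    have "disc_to_cube k (cube_to_disc k y) i =
      max_norm k y / max_norm k (cube_to_disc k y) * cube_to_disc k y i"
      unfolding disc_to_cube_def euclidean_norm_cube_to_disc ..
    also have "max_norm k (cube_to_disc k y) = max_norm k y / euclidean_norm k y * max_norm k y"
      unfolding cube_to_disc_def max_norm_scale
      using euclidean_norm_nonneg[of k y] max_norm_nonneg[of k y] by simp
    finally show ?thesis
      using False euclidean_norm_eq_0_iff[of k y] by (simp add: cube_to_disc_def field_simps)
  qed
qed

text \<open>
  The scaling factor has no limit at the origin, but each coordinate of the image is bounded by the
  Euclidean norm of the argument.
\<close>

lemma continuous_map_disc_to_cube:
  assumes "i < k"
  shows "continuous_map (closed_disc k) euclideanreal (\<lambda>x. disc_to_cube k x i)"
proof (rule continuous_map_vanishing_product[where g = "euclidean_norm k" and C = 1])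
  show "continuous_map (closed_disc k) euclideanreal (euclidean_norm k)"
    by (rule continuous_map_euclidean_norm)
  show "continuous_map (subtopology (closed_disc k) {x. euclidean_norm k x \<noteq> 0}) euclideanreal
     (\<lambda>x. disc_to_cube k x i)"
    unfolding disc_to_cube_def
    by (intro continuous_intros continuous_map_from_subtopology continuous_map_euclidean_norm
        continuous_map_max_norm) (auto simp: euclidean_norm_eq_0_iff)
  show "\<bar>disc_to_cube k x i\<bar> \<le> 1 * \<bar>euclidean_norm k x\<bar>" for x
    using coordinate_le_max_norm[OF assms, of "disc_to_cube k x"]
    by (simp add: max_norm_disc_to_cube euclidean_norm_nonneg)
qed

lemma disc_to_cube_eq_0: "\<lbrakk>x \<in> topspace (closed_disc k); i \<ge> k\<rbrakk> \<Longrightarrow> disc_to_cube k x i = 0"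
  by (simp add: disc_to_cube_def topspace_closed_disc)

lemma disc_to_cube_le_1:
  assumes "x \<in> topspace (closed_disc k)" "i < k" shows "\<bar>disc_to_cube k x i\<bar> \<le> 1"
proof -
  have "euclidean_norm k x \<le> 1" using assms by (simp add: euclidean_norm_def topspace_closed_disc)
  then show ?thesis
    using coordinate_le_max_norm[OF assms(2), of "disc_to_cube k x"] by (simp add: max_norm_disc_to_cube)
qed

lemma inj_on_disc_to_cube: "inj_on (disc_to_cube k) (topspace (closed_disc k))"
  by (rule inj_on_inverseI[where g = "cube_to_disc k"])
     (simp add: disc_to_cube_inverse topspace_closed_disc)

lemma disc_to_cube_surj:
  assumes "\<forall>i<k. \<bar>y i\<bar> \<le> 1" "\<forall>i\<ge>k. y i = 0"
  obtains x where "x \<in> topspace (closed_disc k)" "disc_to_cube k x = y"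
proof
  show "disc_to_cube k (cube_to_disc k y) = y" by (rule cube_to_disc_inverse[OF assms(2)])
  have "euclidean_norm k (cube_to_disc k y) \<le> 1"
    using assms(1) by (simp add: euclidean_norm_cube_to_disc max_norm_le_iff)
  then show "cube_to_disc k y \<in> topspace (closed_disc k)"
    using assms(2) by (simp add: topspace_closed_disc euclidean_norm_def cube_to_disc_def)
qed

lemma open_disc_iff_disc_to_cube:
  assumes "x \<in> topspace (closed_disc k)"
  shows "x \<in> topspace (open_disc k) \<longleftrightarrow> (\<forall>i<k. \<bar>disc_to_cube k x i\<bar> < 1)"
proof -
  have "x \<in> topspace (open_disc k) \<longleftrightarrow> euclidean_norm k x < 1"
    using assms by (simp add: topspace_open_disc topspace_closed_disc euclidean_norm_def)
  then show ?thesis by (simp add: max_norm_less_iff flip: max_norm_disc_to_cube)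
qed

section \<open>Finite graphs with parametrised edges\<close>

text \<open>
  A finite graph together with a parametrisation of each closed edge by \<open>[-1, 1]\<close>. This is what the
  characteristic maps of the edges provide after the identification of the one-dimensional disc with
  an interval. The parametrisation is injective on the open interval only, since an edge may be a
  loop.
\<close>

locale parametrized_graph =
  fixes G :: "'a topology" and V :: "'a set" and E :: "'a set set" and \<psi> :: "'a set \<Rightarrow> real \<Rightarrow> 'a"
  assumes Hausdorff: "Hausdorff_space G"
    and topspace_eq: "topspace G = V \<union> \<Union>E"
    and finite_V: "finite V" and finite_E: "finite E"
    and continuous_param: "e \<in> E \<Longrightarrow> continuous_map (top_of_set {-1..1}) G (\<psi> e)"
    and inj_param: "e \<in> E \<Longrightarrow> inj_on (\<psi> e) {-1<..<1}"
    and param_image: "e \<in> E \<Longrightarrow> \<psi> e ` {-1<..<1} = e"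
    and ends_in_V: "e \<in> E \<Longrightarrow> \<psi> e (-1) \<in> V" "e \<in> E \<Longrightarrow> \<psi> e 1 \<in> V"
    and edge_disjoint_V: "e \<in> E \<Longrightarrow> e \<inter> V = {}"
    and edges_disjoint: "\<lbrakk>e \<in> E; e' \<in> E; e \<noteq> e'\<rbrakk> \<Longrightarrow> e \<inter> e' = {}"
begin

lemma edge_nonempty: "e \<in> E \<Longrightarrow> e \<noteq> {}"
  using param_image[of e] by auto

lemma edge_unique: "\<lbrakk>e \<in> E; e' \<in> E; y \<in> e; y \<in> e'\<rbrakk> \<Longrightarrow> e = e'"
  using edges_disjoint by blast

lemma vertex_not_in_edge: "\<lbrakk>v \<in> V; e \<in> E\<rbrakk> \<Longrightarrow> v \<notin> e"
  using edge_disjoint_V by blast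

lemma vertex_letter_not_edge: "v \<in> V \<Longrightarrow> {v} \<notin> E"
  using vertex_not_in_edge by blast

lemma param_image_closed: "e \<in> E \<Longrightarrow> \<psi> e ` {-1..1} = e \<union> {\<psi> e (-1), \<psi> e 1}"
proof -
  assume "e \<in> E"
  have "{-1..1::real} = {-1<..<1} \<union> {-1, 1}" by auto
  then have "\<psi> e ` {-1..1} = \<psi> e ` {-1<..<1} \<union> \<psi> e ` {-1, 1}" by (metis image_Un)
  then show ?thesis by (simp only: param_image[OF \<open>e \<in> E\<close>] image_insert image_empty)
qed

lemma param_in_edge_iff:
  assumes "e \<in> E" "s \<in> {-1..1}" shows "\<psi> e s \<in> e \<longleftrightarrow> s \<in> {-1<..<1}"
proof
  assume "\<psi> e s \<in> e"
  then have "s \<noteq> -1" "s \<noteq> 1"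
    using vertex_not_in_edge[OF ends_in_V(1)[OF assms(1)] assms(1)]
      vertex_not_in_edge[OF ends_in_V(2)[OF assms(1)] assms(1)] by blast+
  then show "s \<in> {-1<..<1}" using assms(2) by auto
next
  assume "s \<in> {-1<..<1}"
  then have "\<psi> e s \<in> \<psi> e ` {-1<..<1}" by (rule imageI)
  then show "\<psi> e s \<in> e" by (simp only: param_image[OF assms(1)])
qed

lemma param_in_V_iff:
  assumes "e \<in> E" "s \<in> {-1..1}" shows "\<psi> e s \<in> V \<longleftrightarrow> s = -1 \<or> s = 1"
proof
  assume "\<psi> e s \<in> V"
  then have "s \<notin> {-1<..<1}"
    using param_in_edge_iff[OF assms] vertex_not_in_edge[OF _ assms(1)] by blast
  then show "s = -1 \<or> s = 1" using assms(2) by auto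
qed (use ends_in_V[OF assms(1)] in auto)

text \<open>
  Closed subsets of an edge are compact, and this is how all closed sets of the graph used below
  arise: as finite unions of such images.
\<close>

lemma closedin_param_image:
  assumes "e \<in> E" "closed C" "C \<subseteq> {-1..1}" shows "closedin G (\<psi> e ` C)"
proof -
  have "compact_space (top_of_set {-1..1::real})"
    by (simp add: compact_space_subtopology)
  then have "closed_map (top_of_set {-1..1}) G (\<psi> e)"
    by (rule continuous_imp_closed_map[OF continuous_param[OF assms(1)] _ Hausdorff])
  moreover have "closedin (top_of_set {-1..1}) C"
    using assms by (simp add: closed_subset)
  ultimately show ?thesis by (simp add: closed_map_def)
qed

lemma closedin_finite: "finite S \<Longrightarrow> S \<subseteq> topspace G \<Longrightarrow> closedin G S"
  using Hausdorff_imp_t1_space[OF Hausdorff] t1_space_closedin_finite by blast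

lemma param_in_topspace: "\<lbrakk>e \<in> E; s \<in> {-1..1}\<rbrakk> \<Longrightarrow> \<psi> e s \<in> topspace G"
  using continuous_param[of e] by (auto simp: continuous_map_def)

lemma closure_of_edge:
  assumes "e \<in> E" shows "G closure_of e = \<psi> e ` {-1..1}"
proof
  have "e \<subseteq> \<psi> e ` {-1..1}" using param_image_closed[OF assms] by auto
  then show "G closure_of e \<subseteq> \<psi> e ` {-1..1}"
    using closedin_param_image[OF assms, of "{-1..1}"] by (simp add: closure_of_minimal)
  have "\<psi> e ` (top_of_set {-1..1} closure_of {-1<..<1}) \<subseteq> G closure_of (\<psi> e ` {-1<..<1})"
    by (rule continuous_map_image_closure_subset[OF continuous_param[OF assms]])
  moreover have "top_of_set {-1..1} closure_of {-1<..<1::real} = {-1..1}"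
  proof -
    have "{-1..1} \<inter> {-1<..<1::real} = {-1<..<1}" by auto
    then show ?thesis by (simp add: closure_of_subtopology)
  qed
  ultimately show "\<psi> e ` {-1..1} \<subseteq> G closure_of e" using param_image[OF assms] by simp
qed

text \<open>
  The complement of an edge is the finite union of the vertices and of the other closed edges.
\<close>

lemma openin_edge:
  assumes "e \<in> E" shows "openin G e"
proof -
  let ?C = "V \<union> (\<Union>e'\<in>E - {e}. \<psi> e' ` {-1..1})"
  have "closedin G ?C"
  proof (rule closedin_Un)
    show "closedin G V" using finite_V topspace_eq by (intro closedin_finite) auto
    show "closedin G (\<Union>e'\<in>E - {e}. \<psi> e' ` {-1..1})"
      using finite_E by (intro closedin_Union) (auto intro!: closedin_param_image)
  qed
  moreover have "e = topspace G - ?C"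
  proof (intro equalityI subsetI)
    fix y assume y: "y \<in> e"
    have "y \<notin> \<psi> e' ` {-1..1}" if "e' \<in> E" "e' \<noteq> e" for e'
      using that y assms edge_unique ends_in_V vertex_not_in_edge
      unfolding param_image_closed[OF that(1)] by blast
    then show "y \<in> topspace G - ?C"
      using y assms vertex_not_in_edge topspace_eq by auto
  next
    fix y assume "y \<in> topspace G - ?C"
    then show "y \<in> e" using topspace_eq param_image_closed by auto
  qed
  ultimately show ?thesis by (metis closedin_def openin_diff openin_topspace)
qed

section \<open>Words and product cells\<close>

definition letters :: "'a set set" where "letters = (\<lambda>v. {v}) ` V \<union> E"

text \<open>
  Words are kept extensional outside \<open>{..<n}\<close>, so that distinct words name distinct cells.
\<close>

definition words :: "nat \<Rightarrow> nat \<Rightarrow> (nat \<Rightarrow> 'a set) set" where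
  "words n i = {\<sigma> \<in> extensional {..<n}.
     (\<forall>j<n. \<sigma> j \<in> letters) \<and>
     (\<forall>j<n. \<forall>k<n. j \<noteq> k \<and> \<sigma> j \<in> E \<and> \<sigma> k \<in> E \<longrightarrow> \<sigma> j \<noteq> \<sigma> k) \<and>
     card {j. j < n \<and> \<sigma> j \<in> E} = i}"

definition cell :: "nat \<Rightarrow> (nat \<Rightarrow> 'a set) \<Rightarrow> (nat \<Rightarrow> 'a) set" where
  "cell n \<sigma> = PiE {..<n} \<sigma>"

lemma in_cell_iff: "x \<in> cell n \<sigma> \<longleftrightarrow> x \<in> extensional {..<n} \<and> (\<forall>j<n. x j \<in> \<sigma> j)"
  by (auto simp: cell_def PiE_iff)

lemma letter_cases:
  assumes "a \<in> letters"
  obtains v where "v \<in> V" "a = {v}" | "a \<in> E"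
  using assms by (auto simp: letters_def)

lemma letter_nonempty: "a \<in> letters \<Longrightarrow> a \<noteq> {}"
  using edge_nonempty by (auto simp: letters_def)

lemma letters_disjoint:
  assumes "a \<in> letters" "b \<in> letters" "y \<in> a" "y \<in> b" shows "a = b"
  using assms edge_unique[of a b y] vertex_not_in_edge by (auto elim!: letter_cases)

lemma letter_subset: "a \<in> letters \<Longrightarrow> a \<subseteq> topspace G"
  by (auto simp: letters_def topspace_eq)

lemma dconf_sink_cells_eq: "dconf_sink_cells V E n i = cell n ` words n i"
proof -
  have *: "graph_cells V E 0 \<union> graph_cells V E 1 = letters"
    by (simp add: graph_cells_def letters_def)
  show ?thesis
  proof (intro equalityI subsetI)
    fix c assume "c \<in> dconf_sink_cells V E n i"
    then have "\<exists>\<sigma>. c = cell n \<sigma> \<and> (\<forall>j<n. \<sigma> j \<in> letters) \<and>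
      (\<forall>j<n. \<forall>k<n. j \<noteq> k \<and> \<sigma> j \<in> E \<and> \<sigma> k \<in> E \<longrightarrow> \<sigma> j \<noteq> \<sigma> k) \<and>
      card {j. j < n \<and> \<sigma> j \<in> E} = i"
      unfolding dconf_sink_cells_def * mem_Collect_eq cell_def .
    then obtain \<sigma> where \<sigma>: "c = cell n \<sigma>" "\<forall>j<n. \<sigma> j \<in> letters"
      "\<forall>j<n. \<forall>k<n. j \<noteq> k \<and> \<sigma> j \<in> E \<and> \<sigma> k \<in> E \<longrightarrow> \<sigma> j \<noteq> \<sigma> k"
      "card {j. j < n \<and> \<sigma> j \<in> E} = i"
      by metis
    have "{j. j < n \<and> restrict \<sigma> {..<n} j \<in> E} = {j. j < n \<and> \<sigma> j \<in> E}" by auto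
    then have "restrict \<sigma> {..<n} \<in> words n i" using \<sigma> by (simp add: words_def)
    moreover have "c = cell n (restrict \<sigma> {..<n})" unfolding \<sigma>(1) cell_def by (rule PiE_cong) simp
    ultimately show "c \<in> cell n ` words n i" by blast
  next
    fix c assume "c \<in> cell n ` words n i"
    then obtain \<sigma> where "\<sigma> \<in> words n i" "c = cell n \<sigma>" by blast
    then show "c \<in> dconf_sink_cells V E n i"
      unfolding dconf_sink_cells_def * words_def mem_Collect_eq cell_def by (intro exI[of _ \<sigma>]) simp
  qed
qed

lemma word_letter: "\<sigma> \<in> words n i \<Longrightarrow> j < n \<Longrightarrow> \<sigma> j \<in> letters"
  by (simp add: words_def)

lemma wordsI:
  assumes "\<sigma> \<in> extensional {..<n}" "\<And>j. j < n \<Longrightarrow> \<sigma> j \<in> letters"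
    "\<And>j k. \<lbrakk>j < n; k < n; j \<noteq> k; \<sigma> j \<in> E\<rbrakk> \<Longrightarrow> \<sigma> j \<noteq> \<sigma> k"
    "card {j. j < n \<and> \<sigma> j \<in> E} = i"
  shows "\<sigma> \<in> words n i"
proof -
  have "\<forall>j<n. \<forall>k<n. j \<noteq> k \<and> \<sigma> j \<in> E \<and> \<sigma> k \<in> E \<longrightarrow> \<sigma> j \<noteq> \<sigma> k"
    by (intro allI impI assms(3)) simp_all
  then show ?thesis unfolding words_def mem_Collect_eq using assms(1,2,4) by blast
qed

lemma word_edges_distinct:
  assumes "\<sigma> \<in> words n i" "j < n" "k < n" "\<sigma> j \<in> E" "\<sigma> k = \<sigma> j" shows "j = k"
proof -
  have "\<forall>j<n. \<forall>k<n. j \<noteq> k \<and> \<sigma> j \<in> E \<and> \<sigma> k \<in> E \<longrightarrow> \<sigma> j \<noteq> \<sigma> k"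
    using assms(1) unfolding words_def by blast
  then show ?thesis using assms(2-5) by metis
qed

lemma cell_nonempty: "\<sigma> \<in> words n i \<Longrightarrow> cell n \<sigma> \<noteq> {}"
  using letter_nonempty word_letter by (fastforce simp: cell_def PiE_eq_empty_iff)

lemma cells_disjoint:
  assumes "\<sigma> \<in> words n i" "\<tau> \<in> words n l" "x \<in> cell n \<sigma>" "x \<in> cell n \<tau>"
  shows "\<sigma> = \<tau>"
proof (rule extensionalityI[of _ "{..<n}"])
  fix j assume "j \<in> {..<n}"
  then show "\<sigma> j = \<tau> j"
    using letters_disjoint[of "\<sigma> j" "\<tau> j" "x j"] assms
    by (simp add: in_cell_iff word_letter)
qed (use assms in \<open>auto simp: words_def\<close>)

lemma cell_inject: "\<lbrakk>\<sigma> \<in> words n i; \<tau> \<in> words n l; cell n \<sigma> = cell n \<tau>\<rbrakk> \<Longrightarrow> \<sigma> = \<tau>"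
  using cell_nonempty[of \<sigma> n i] cells_disjoint[of \<sigma> n i \<tau> l] by (metis ex_in_conv)

lemma words_dimension: "\<lbrakk>\<sigma> \<in> words n i; \<sigma> \<in> words n l\<rbrakk> \<Longrightarrow> i = l"
  by (simp add: words_def)

text \<open>
  The open cell of the graph that contains a given point.
\<close>

definition letter :: "'a \<Rightarrow> 'a set" where
  "letter y = (THE a. a \<in> letters \<and> y \<in> a)"

lemma letter_eq: "\<lbrakk>a \<in> letters; y \<in> a\<rbrakk> \<Longrightarrow> letter y = a"
  unfolding letter_def by (rule the_equality) (simp, metis letters_disjoint)

lemma letter:
  assumes "y \<in> topspace G" shows "letter y \<in> letters" "y \<in> letter y"
proof -
  obtain a where "a \<in> letters" "y \<in> a" using assms by (auto simp: topspace_eq letters_def)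
  then show "letter y \<in> letters" "y \<in> letter y" using letter_eq by auto
qed

lemma letter_in_E_iff: "y \<in> topspace G \<Longrightarrow> letter y \<in> E \<longleftrightarrow> y \<in> \<Union>E"
proof
  assume "y \<in> topspace G" "letter y \<in> E"
  then show "y \<in> \<Union>E" using letter(2) by blast
next
  assume "y \<in> \<Union>E"
  then obtain e where e: "e \<in> E" "y \<in> e" by blast
  then have "letter y = e" by (intro letter_eq) (simp_all add: letters_def)
  then show "letter y \<in> E" using e by simp
qed

text \<open>
  The points of the cellular model, described without cells: no two particles lie on the same open
  edge.
\<close>

definition separated :: "nat \<Rightarrow> (nat \<Rightarrow> 'a) set" where
  "separated n = {x \<in> extensional {..<n}. (\<forall>j<n. x j \<in> topspace G) \<and>
     (\<forall>j<n. \<forall>k<n. \<forall>e\<in>E. x j \<in> e \<and> x k \<in> e \<longrightarrow> j = k)}"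

lemma separatedD:
  "\<lbrakk>x \<in> separated n; j < n; k < n; e \<in> E; x j \<in> e; x k \<in> e\<rbrakk> \<Longrightarrow> j = k"
  unfolding separated_def mem_Collect_eq by blast

text \<open>
  The word of a point records the open cell of each of its particles. Its dimension is written as the
  number of particles on open edges, which lets the boundary of a cell be located by counting.
\<close>

lemma point_in_cell:
  assumes "x \<in> separated n"
  obtains \<sigma> where "\<sigma> \<in> words n (card {j. j < n \<and> x j \<in> \<Union>E})" "x \<in> cell n \<sigma>"
proof
  let ?\<sigma> = "restrict (\<lambda>j. letter (x j)) {..<n}"
  have x: "x j \<in> topspace G" if "j < n" for j using assms that by (simp add: separated_def)
  show "x \<in> cell n ?\<sigma>" using assms letter by (simp add: in_cell_iff separated_def)
  have "?\<sigma> j \<in> E \<longleftrightarrow> x j \<in> \<Union>E" if "j < n" for j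
    using that letter_in_E_iff[OF x[OF that]] by simp
  then have J: "{j. j < n \<and> ?\<sigma> j \<in> E} = {j. j < n \<and> x j \<in> \<Union>E}" by blast
  have L: "?\<sigma> j \<in> letters" if "j < n" for j using that letter(1)[OF x[OF that]] by simp
  have D: "?\<sigma> j \<noteq> ?\<sigma> k" if "j < n" "k < n" "j \<noteq> k" "?\<sigma> j \<in> E" for j k
  proof
    assume "?\<sigma> j = ?\<sigma> k"
    then have eq: "letter (x j) = letter (x k)" using that by simp
    have 1: "letter (x j) \<in> E" using that by simp
    have 2: "x j \<in> letter (x j)" by (rule letter(2)[OF x[OF that(1)]])
    have 3: "x k \<in> letter (x j)" unfolding eq by (rule letter(2)[OF x[OF that(2)]])
    show False using separatedD[OF assms that(1,2) 1 2 3] that(3) by contradiction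
  qed
  show "?\<sigma> \<in> words n (card {j. j < n \<and> x j \<in> \<Union>E})"
  proof (rule wordsI)
    show "?\<sigma> \<in> extensional {..<n}" by (rule restrict_extensional)
    show "?\<sigma> j \<in> letters" if "j < n" for j by (rule L[OF that])
    show "?\<sigma> j \<noteq> ?\<sigma> k" if "j < n" "k < n" "j \<noteq> k" "?\<sigma> j \<in> E" for j k
      by (rule D[OF that])
    show "card {j. j < n \<and> ?\<sigma> j \<in> E} = card {j. j < n \<and> x j \<in> \<Union>E}" unfolding J ..
  qed
qed

lemma cell_subset:
  assumes "\<sigma> \<in> words n i"
  shows "cell n \<sigma> \<subseteq> separated n"
proof
  fix x assume x: "x \<in> cell n \<sigma>"
  have L: "\<sigma> j \<in> letters" if "j < n" for j using assms that by (rule word_letter)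
  have eq: "j = k" if "j < n" "k < n" "e \<in> E" "x j \<in> e" "x k \<in> e" for j k e
  proof -
    have "e \<in> letters" using that by (simp add: letters_def)
    then have "\<sigma> j = e" "\<sigma> k = e"
      using letters_disjoint[of "\<sigma> j" e "x j"] letters_disjoint[of "\<sigma> k" e "x k"] x that L
      by (simp_all add: in_cell_iff)
    then show ?thesis using word_edges_distinct[OF assms that(1,2)] that(3) by simp
  qed
  have "x j \<in> topspace G" if "j < n" for j
    using x that letter_subset[OF L[OF that]] by (auto simp: in_cell_iff)
  then show "x \<in> separated n"
    using x eq unfolding separated_def in_cell_iff by blast
qed

lemma Union_cells: "(\<Union>i. \<Union>(cell n ` words n i)) = separated n"
proof
  show "(\<Union>i. \<Union>(cell n ` words n i)) \<subseteq> separated n"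
  proof
    fix x assume "x \<in> (\<Union>i. \<Union>(cell n ` words n i))"
    then obtain i \<sigma> where "\<sigma> \<in> words n i" "x \<in> cell n \<sigma>" by (elim UN_E UnionE imageE) simp
    then show "x \<in> separated n" by (rule subsetD[OF cell_subset])
  qed
  show "separated n \<subseteq> (\<Union>i. \<Union>(cell n ` words n i))"
  proof
    fix x assume "x \<in> separated n"
    then obtain \<sigma> where \<sigma>: "\<sigma> \<in> words n (card {j. j < n \<and> x j \<in> \<Union>E})" "x \<in> cell n \<sigma>"
      by (rule point_in_cell)
    show "x \<in> (\<Union>i. \<Union>(cell n ` words n i))"
      by (rule UN_I[OF UNIV_I], rule UnionI[OF imageI[where f = "cell n", OF \<sigma>(1)] \<sigma>(2)])
  qed
qed

lemma dconf_sink_eq: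
  "dconf_sink G V E n = subtopology (product_topology (\<lambda>_. G) {..<n}) (separated n)"
  unfolding dconf_sink_def dconf_sink_cells_eq Union_cells ..

lemma topspace_dconf_sink:
  "topspace (dconf_sink G V E n) = separated n"
proof -
  have "separated n \<subseteq> topspace (product_topology (\<lambda>_. G) {..<n})"
    unfolding separated_def by (simp add: PiE_iff subset_iff)
  then show ?thesis by (simp only: dconf_sink_eq topspace_subtopology inf.absorb2)
qed

lemma Hausdorff_dconf_sink: "Hausdorff_space (dconf_sink G V E n)"
  unfolding dconf_sink_eq
  by (intro Hausdorff_space_subtopology) (simp add: Hausdorff_space_product_topology Hausdorff)

lemma finite_words: "finite (words n i)"
proof (rule finite_subset)
  show "words n i \<subseteq> PiE {..<n} (\<lambda>_. letters)"
  proof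
    fix \<sigma> assume "\<sigma> \<in> words n i"
    then show "\<sigma> \<in> PiE {..<n} (\<lambda>_. letters)" by (simp add: words_def PiE_iff)
  qed
  show "finite (PiE {..<n} (\<lambda>_. letters))"
    using finite_V finite_E by (intro finite_PiE) (auto simp: letters_def)
qed

section \<open>Characteristic maps of product cells\<close>

text \<open>
  The bijection \<open>b\<close> numbers the edge letters of \<open>\<beta>\<close> by the coordinates of the disc. A disc point
  is first sent to the cube, and its coordinate \<open>b j\<close> then moves the \<open>j\<close>-th particle along the closed
  edge \<open>\<beta> j\<close>.
\<close>

definition char_map ::
  "nat \<Rightarrow> nat \<Rightarrow> (nat \<Rightarrow> nat) \<Rightarrow> (nat \<Rightarrow> 'a set) \<Rightarrow> (nat \<Rightarrow> real) \<Rightarrow> nat \<Rightarrow> 'a" where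
  "char_map n i b \<beta> x = (\<lambda>j\<in>{..<n}.
     if \<beta> j \<in> E then \<psi> (\<beta> j) (disc_to_cube i x (b j)) else the_elem (\<beta> j))"

context
  fixes n i \<beta> b
  assumes \<beta>: "\<beta> \<in> words n i" and b: "bij_betw b {j. j < n \<and> \<beta> j \<in> E} {..<i}"
begin

lemma char_map_param:
  assumes "x \<in> topspace (closed_disc i)" "j < n" "\<beta> j \<in> E"
  shows "b j < i" "disc_to_cube i x (b j) \<in> {-1..1}"
proof -
  show "b j < i" using assms(2,3) bij_betwE[OF b] by simp
  then show "disc_to_cube i x (b j) \<in> {-1..1}"
    using disc_to_cube_le_1[OF assms(1)] by (simp add: abs_le_iff minus_le_iff)
qed

lemma position_of_coordinate:
  assumes "l < i" obtains j where "j < n" "\<beta> j \<in> E" "b j = l"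
proof -
  have "l \<in> b ` {j. j < n \<and> \<beta> j \<in> E}" using assms b by (simp add: bij_betw_def)
  then show ?thesis using that by blast
qed

lemma char_map_vertex:
  assumes "j < n" "\<beta> j \<notin> E" shows "the_elem (\<beta> j) \<in> V" "\<beta> j = {the_elem (\<beta> j)}"
proof -
  obtain v where "v \<in> V" "\<beta> j = {v}"
    using word_letter[OF \<beta> assms(1)] assms(2) letter_cases by metis
  then show "the_elem (\<beta> j) \<in> V" "\<beta> j = {the_elem (\<beta> j)}" by simp_all
qed

lemma char_map_in_edge_iff:
  assumes "x \<in> topspace (closed_disc i)" "j < n" "e \<in> E"
  shows "char_map n i b \<beta> x j \<in> e \<longleftrightarrow> \<beta> j = e \<and> \<bar>disc_to_cube i x (b j)\<bar> < 1"
proof (cases "\<beta> j \<in> E")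
  case True
  let ?s = "disc_to_cube i x (b j)"
  have s: "?s \<in> {-1..1}" by (rule char_map_param[OF assms(1,2) True])
  then have "\<psi> (\<beta> j) ?s \<in> \<psi> (\<beta> j) ` {-1..1}" by (rule imageI)
  then have "\<psi> (\<beta> j) ?s \<in> \<beta> j \<or> \<psi> (\<beta> j) ?s \<in> V"
    using ends_in_V[OF True] unfolding param_image_closed[OF True] by (metis Un_iff insert_iff singletonD)
  then have "\<psi> (\<beta> j) ?s \<in> e \<longrightarrow> \<beta> j = e"
    using edge_unique[OF True assms(3)] vertex_not_in_edge[OF _ assms(3)] by metis
  moreover have "\<psi> (\<beta> j) ?s \<in> \<beta> j \<longleftrightarrow> \<bar>?s\<bar> < 1"
    using param_in_edge_iff[OF True s] by (auto simp: abs_less_iff)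
  ultimately show ?thesis using True assms(2) by (auto simp: char_map_def)
next
  case False
  then show ?thesis using char_map_vertex[OF assms(2) False] assms vertex_not_in_edge
    by (auto simp: char_map_def)
qed

lemma continuous_char_map: "continuous_map (closed_disc i) (dconf_sink G V E n) (char_map n i b \<beta>)"
proof -
  have "continuous_map (closed_disc i) G (\<lambda>x. char_map n i b \<beta> x j)" if j: "j < n" for j
  proof (cases "\<beta> j \<in> E")
    case True
    have bj: "b j < i" using j True bij_betwE[OF b] by simp
    have "continuous_map (closed_disc i) (top_of_set {-1..1}) (\<lambda>x. disc_to_cube i x (b j))"
      using continuous_map_disc_to_cube[OF bj] char_map_param(2)[OF _ j True]
      by (auto simp: continuous_map_in_subtopology)
    from continuous_map_compose[OF this continuous_param[OF True]]
    show ?thesis using j True by (simp add: char_map_def o_def)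
  next
    case False
    then show ?thesis using j char_map_vertex[OF j False] by (simp add: char_map_def topspace_eq)
  qed
  then have c: "continuous_map (closed_disc i) (product_topology (\<lambda>_. G) {..<n}) (char_map n i b \<beta>)"
    by (auto simp: continuous_map_componentwise char_map_def)
  moreover have "char_map n i b \<beta> x \<in> separated n" if x: "x \<in> topspace (closed_disc i)" for x
  proof -
    have "char_map n i b \<beta> x \<in> PiE {..<n} (\<lambda>_. topspace G)"
      using c x by (auto simp: continuous_map_def)
    moreover have "j = k" if "j < n" "k < n" "e \<in> E" "char_map n i b \<beta> x j \<in> e" "char_map n i b \<beta> x k \<in> e" for j k e
      using that char_map_in_edge_iff[OF x _ \<open>e \<in> E\<close>] word_edges_distinct[OF \<beta>, of j k] by simp
    ultimately show ?thesis unfolding separated_def by (simp add: PiE_iff) metis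
  qed
  ultimately show ?thesis unfolding dconf_sink_eq by (auto simp: continuous_map_in_subtopology)
qed

text \<open>
  For \<open>\<gamma> = \<beta>\<close> this says that the map is a homeomorphism over the open cell. For a word \<open>\<gamma>\<close> obtained
  by replacing one edge that is not a loop by one of its ends, it is the regularity of the face. In
  both cases injectivity can be checked one edge at a time, because the disc coordinates of a point
  over \<open>\<gamma>\<close> are determined separately by its particles.
\<close>

lemma homeomorphic_map_char_map_subcell:
  assumes edge: "\<And>j. \<lbrakk>j < n; \<beta> j \<in> E\<rbrakk> \<Longrightarrow> \<gamma> j \<subseteq> \<psi> (\<beta> j) ` {-1..1} \<and>
      inj_on (\<psi> (\<beta> j)) {s \<in> {-1..1}. \<psi> (\<beta> j) s \<in> \<gamma> j}"
    and vertex: "\<And>j. \<lbrakk>j < n; \<beta> j \<notin> E\<rbrakk> \<Longrightarrow> \<gamma> j = \<beta> j"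
  shows "homeomorphic_map (subtopology (closed_disc i) (char_map n i b \<beta> -` cell n \<gamma>))
    (subtopology (dconf_sink G V E n) (cell n \<gamma>)) (char_map n i b \<beta>)"
proof (rule homeomorphic_map_full_preimage[OF compact_space_closed_disc Hausdorff_dconf_sink
      continuous_char_map])
  let ?\<Phi> = "char_map n i b \<beta>"
  show "inj_on ?\<Phi> {x \<in> topspace (closed_disc i). ?\<Phi> x \<in> cell n \<gamma>}"
  proof (rule inj_onI, safe)
    fix x x' assume x: "x \<in> topspace (closed_disc i)" "?\<Phi> x \<in> cell n \<gamma>"
      and x': "x' \<in> topspace (closed_disc i)" "?\<Phi> x' \<in> cell n \<gamma>" and eq: "?\<Phi> x = ?\<Phi> x'"
    have "disc_to_cube i x = disc_to_cube i x'"
    proof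
      fix l
      show "disc_to_cube i x l = disc_to_cube i x' l"
      proof (cases "l < i")
        case True
        then obtain j where j: "j < n" "\<beta> j \<in> E" "b j = l" by (rule position_of_coordinate)
        have \<Phi>: "?\<Phi> z j = \<psi> (\<beta> j) (disc_to_cube i z l)" for z using j by (simp add: char_map_def)
        have "?\<Phi> x j \<in> \<gamma> j" "?\<Phi> x' j \<in> \<gamma> j" using x x' j by (simp_all add: in_cell_iff)
        then have "disc_to_cube i x l \<in> {s \<in> {-1..1}. \<psi> (\<beta> j) s \<in> \<gamma> j}"
          "disc_to_cube i x' l \<in> {s \<in> {-1..1}. \<psi> (\<beta> j) s \<in> \<gamma> j}"
          using char_map_param(2)[OF x(1) j(1,2)] char_map_param(2)[OF x'(1) j(1,2)] j(3)
          by (simp_all add: \<Phi>)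
        moreover have "\<psi> (\<beta> j) (disc_to_cube i x l) = \<psi> (\<beta> j) (disc_to_cube i x' l)"
          using eq by (simp flip: \<Phi>)
        ultimately show ?thesis using inj_onD[OF conjunct2[OF edge[OF j(1,2)]]] by simp
      qed (use x x' disc_to_cube_eq_0 in auto)
    qed
    then show "x = x'" using inj_on_disc_to_cube x x' by (auto dest: inj_onD)
  qed
  show "cell n \<gamma> \<subseteq> ?\<Phi> ` topspace (closed_disc i)"
  proof
    fix y assume y: "y \<in> cell n \<gamma>"
    have "\<exists>s. s \<in> {-1..1} \<and> \<psi> (\<beta> j) s = y j" if "j < n" "\<beta> j \<in> E" for j
    proof -
      have "y j \<in> \<gamma> j" using y that by (simp add: in_cell_iff)
      then have "y j \<in> \<psi> (\<beta> j) ` {-1..1}" by (rule subsetD[OF conjunct1[OF edge[OF that]]])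
      then show ?thesis by (elim imageE) (auto intro: exI)
    qed
    from someI_ex[OF this]
    obtain s where s: "\<And>j. \<lbrakk>j < n; \<beta> j \<in> E\<rbrakk> \<Longrightarrow> s j \<in> {-1..1} \<and> \<psi> (\<beta> j) (s j) = y j"
      by (rule that)
    let ?J = "{j. j < n \<and> \<beta> j \<in> E}"
    \<comment> \<open>The cube point whose coordinates are the edge parameters of \<open>y\<close>; its preimage in the disc
      is the point sought.\<close>
    define z where "z l = (if l < i then s (the_inv_into ?J b l) else 0)" for l
    have inv: "the_inv_into ?J b l \<in> ?J" if "l < i" for l
      using bij_betwE[OF bij_betw_the_inv_into[OF b]] that by blast
    have "z l \<in> {-1..1}" if "l < i" for l using s inv[OF that] that by (simp add: z_def)
    then have "\<forall>l<i. \<bar>z l\<bar> \<le> 1" by (simp add: abs_le_iff minus_le_iff)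
    moreover have "\<forall>l\<ge>i. z l = 0" by (simp add: z_def)
    ultimately obtain x where x: "x \<in> topspace (closed_disc i)" "disc_to_cube i x = z"
      by (rule disc_to_cube_surj)
    have "?\<Phi> x j = y j" for j
    proof (cases "j < n")
      case True
      show ?thesis
      proof (cases "\<beta> j \<in> E")
        case bj: True
        then have "z (b j) = s j"
          using b True by (auto simp: z_def bij_betw_def the_inv_into_f_f)
        then show ?thesis using s True bj x by (simp add: char_map_def)
      next
        case False
        then have "y j \<in> {the_elem (\<beta> j)}" using y vertex char_map_vertex(2) True by (metis in_cell_iff)
        then show ?thesis using True False by (simp add: char_map_def)
      qed
    next
      case False
      then have "y j = undefined" using y by (intro extensional_arb[of y "{..<n}"]) (simp_all add: in_cell_iff)
      then show ?thesis using False by (simp add: char_map_def)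
    qed
    then have "y = ?\<Phi> x" by auto
    then show "y \<in> ?\<Phi> ` topspace (closed_disc i)" using x(1) by (rule image_eqI)
  qed
qed

text \<open>
  The map sends a disc point into the open cell exactly when all cube coordinates are inside the open
  interval, that is, on the open disc. On the sphere some coordinate is an end of its interval, so a
  particle has left its edge for a vertex and the image lies in a cell of smaller dimension.
\<close>

lemma characteristic_map_char_map:
  "characteristic_map (dconf_sink G V E n) (dconf_sink_cells V E n) i (cell n \<beta>) (char_map n i b \<beta>)"
proof -
  let ?\<Phi> = "char_map n i b \<beta>"
  have in_cell: "?\<Phi> x \<in> cell n \<beta> \<longleftrightarrow> x \<in> topspace (open_disc i)" if x: "x \<in> topspace (closed_disc i)" for x
  proof -
    have "?\<Phi> x \<in> cell n \<beta> \<longleftrightarrow> (\<forall>j<n. ?\<Phi> x j \<in> \<beta> j)" by (simp add: in_cell_iff char_map_def)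
    also have "\<dots> \<longleftrightarrow> (\<forall>j. j < n \<and> \<beta> j \<in> E \<longrightarrow> ?\<Phi> x j \<in> \<beta> j)"
    proof -
      have "?\<Phi> x j \<in> \<beta> j" if "j < n" "\<beta> j \<notin> E" for j
        using char_map_vertex(2)[OF that] that by (simp add: char_map_def) blast
      then show ?thesis by blast
    qed
    also have "\<dots> \<longleftrightarrow> (\<forall>j\<in>{j. j < n \<and> \<beta> j \<in> E}. \<bar>disc_to_cube i x (b j)\<bar> < 1)"
      using char_map_in_edge_iff[OF x] by blast
    also have "\<dots> \<longleftrightarrow> (\<forall>l\<in>b ` {j. j < n \<and> \<beta> j \<in> E}. \<bar>disc_to_cube i x l\<bar> < 1)" by blast
    also have "\<dots> \<longleftrightarrow> x \<in> topspace (open_disc i)"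
      using b open_disc_iff_disc_to_cube[OF x] by (simp add: bij_betw_def Ball_def)
    finally show ?thesis .
  qed
  have "topspace (closed_disc i) \<inter> ?\<Phi> -` cell n \<beta> = topspace (open_disc i)"
    using in_cell by (auto simp: topspace_open_disc topspace_closed_disc)
  then have "subtopology (closed_disc i) (?\<Phi> -` cell n \<beta>) = open_disc i"
    by (metis subtopology_restrict open_disc_eq_subtopology)
  moreover have "homeomorphic_map (subtopology (closed_disc i) (?\<Phi> -` cell n \<beta>))
    (subtopology (dconf_sink G V E n) (cell n \<beta>)) ?\<Phi>"
  proof (rule homeomorphic_map_char_map_subcell)
    fix j assume j: "j < n" "\<beta> j \<in> E"
    have "{s \<in> {-1..1}. \<psi> (\<beta> j) s \<in> \<beta> j} \<subseteq> {-1<..<1}" using param_in_edge_iff[OF j(2)] by blast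
    then show "\<beta> j \<subseteq> \<psi> (\<beta> j) ` {-1..1} \<and> inj_on (\<psi> (\<beta> j)) {s \<in> {-1..1}. \<psi> (\<beta> j) s \<in> \<beta> j}"
      using param_image_closed[OF j(2)] inj_on_subset[OF inj_param[OF j(2)]] by blast
  qed simp
  moreover have "?\<Phi> ` (topspace (closed_disc i) - topspace (open_disc i))
      \<subseteq> (\<Union>l<i. \<Union>(dconf_sink_cells V E n l))"
  proof clarify
    fix x assume x: "x \<in> topspace (closed_disc i)" "x \<notin> topspace (open_disc i)"
    have "?\<Phi> x \<in> topspace (dconf_sink G V E n)"
      using continuous_char_map x(1) unfolding continuous_map_def by blast
    then obtain \<sigma> where \<sigma>: "\<sigma> \<in> words n (card {j. j < n \<and> ?\<Phi> x j \<in> \<Union>E})" "?\<Phi> x \<in> cell n \<sigma>"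
      unfolding topspace_dconf_sink by (metis point_in_cell)
    obtain l where l: "l < i" "\<not> \<bar>disc_to_cube i x l\<bar> < 1"
      using x open_disc_iff_disc_to_cube by blast
    then obtain k where k: "k < n" "\<beta> k \<in> E" "b k = l" by (metis position_of_coordinate)
    have "{j. j < n \<and> ?\<Phi> x j \<in> \<Union>E} \<subseteq> {j. j < n \<and> \<beta> j \<in> E}"
      using char_map_in_edge_iff[OF x(1)] by auto
    moreover have "?\<Phi> x k \<notin> \<Union>E" using char_map_in_edge_iff[OF x(1) k(1)] k l by auto
    then have "{j. j < n \<and> ?\<Phi> x j \<in> \<Union>E} \<noteq> {j. j < n \<and> \<beta> j \<in> E}" using k by blast
    ultimately have "{j. j < n \<and> ?\<Phi> x j \<in> \<Union>E} \<subset> {j. j < n \<and> \<beta> j \<in> E}" by blast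
    then have "card {j. j < n \<and> ?\<Phi> x j \<in> \<Union>E} < card {j. j < n \<and> \<beta> j \<in> E}"
      by (intro psubset_card_mono) auto
    then have "card {j. j < n \<and> ?\<Phi> x j \<in> \<Union>E} < i" using \<beta> by (simp add: words_def)
    then have "card {j. j < n \<and> ?\<Phi> x j \<in> \<Union>E} \<in> {..<i}" by simp
    then show "?\<Phi> x \<in> (\<Union>l<i. \<Union>(dconf_sink_cells V E n l))"
      unfolding dconf_sink_cells_eq
      by (rule UN_I) (rule UnionI[OF imageI[where f = "cell n", OF \<sigma>(1)] \<sigma>(2)])
  qed
  ultimately show ?thesis
    unfolding characteristic_map_def using continuous_char_map by simp
qed

end

lemma edge_numbering:
  assumes "\<beta> \<in> words n i"
  obtains b where "bij_betw b {j. j < n \<and> \<beta> j \<in> E} {..<i}"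
  using ex_bij_betw_finite_nat[of "{j. j < n \<and> \<beta> j \<in> E}"] assms
  by (auto simp: words_def atLeast0LessThan)

text \<open>
  There are only finitely many cells, so closure finiteness is trivial, and a set that meets every
  closed cell in a closed set is a finite union of closed sets.
\<close>

theorem cw_complex_dconf_sink: "cw_complex (dconf_sink G V E n) (dconf_sink_cells V E n)"
proof -
  let ?Y = "dconf_sink G V E n" and ?K = "dconf_sink_cells V E n"
  have bound: "i \<le> n" if "\<sigma> \<in> words n i" for \<sigma> i
    using that card_mono[of "{..<n}" "{j. j < n \<and> \<sigma> j \<in> E}"] by (auto simp: words_def)
  have "(\<Union>l. ?K l) \<subseteq> (\<Union>l\<le>n. cell n ` words n l)"
    unfolding dconf_sink_cells_eq using bound by blast
  then have fin: "finite (\<Union>l. ?K l)" by (rule finite_subset) (simp add: finite_words)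
  have top: "(\<Union>k. \<Union>(?K k)) = topspace ?Y"
    unfolding topspace_dconf_sink dconf_sink_cells_eq by (rule Union_cells)
  have weak: "closedin ?Y A" if A: "A \<subseteq> topspace ?Y" "\<forall>k. \<forall>\<sigma>\<in>?K k. closedin ?Y (A \<inter> ?Y closure_of \<sigma>)" for A
  proof -
    have "A = (\<Union>\<sigma>\<in>(\<Union>l. ?K l). A \<inter> ?Y closure_of \<sigma>)"
    proof
      show "A \<subseteq> (\<Union>\<sigma>\<in>(\<Union>l. ?K l). A \<inter> ?Y closure_of \<sigma>)"
      proof
        fix x assume "x \<in> A"
        then obtain k \<sigma> where "\<sigma> \<in> ?K k" "x \<in> \<sigma>" using A(1) top by blast
        moreover have "\<sigma> \<subseteq> ?Y closure_of \<sigma>" using \<open>\<sigma> \<in> ?K k\<close> top by (intro closure_of_subset) blast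
        ultimately show "x \<in> (\<Union>\<sigma>\<in>(\<Union>l. ?K l). A \<inter> ?Y closure_of \<sigma>)" using \<open>x \<in> A\<close> by blast
      qed
    qed blast
    moreover have "closedin ?Y (\<Union>\<sigma>\<in>(\<Union>l. ?K l). A \<inter> ?Y closure_of \<sigma>)"
    proof (rule closedin_Union)
      show "finite ((\<lambda>\<sigma>. A \<inter> ?Y closure_of \<sigma>) ` (\<Union>l. ?K l))" using fin by (rule finite_imageI)
      show "closedin ?Y T" if "T \<in> (\<lambda>\<sigma>. A \<inter> ?Y closure_of \<sigma>) ` (\<Union>l. ?K l)" for T
        using that A(2) by blast
    qed
    ultimately show ?thesis by simp
  qed
  have disj: "\<sigma> \<inter> \<tau> = {}" if mem: "\<sigma> \<in> ?K k" "\<tau> \<in> ?K l" and ne: "(k, \<sigma>) \<noteq> (l, \<tau>)" for k l \<sigma> \<tau>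
  proof (rule ccontr)
    assume "\<sigma> \<inter> \<tau> \<noteq> {}"
    then obtain x where "x \<in> \<sigma>" "x \<in> \<tau>" by blast
    moreover obtain \<beta> \<gamma> where "\<beta> \<in> words n k" "\<sigma> = cell n \<beta>" "\<gamma> \<in> words n l" "\<tau> = cell n \<gamma>"
      using mem unfolding dconf_sink_cells_eq by blast
    ultimately show False using ne cells_disjoint words_dimension by metis
  qed
  have "\<exists>\<Phi>. characteristic_map ?Y ?K k \<sigma> \<Phi>" if mem: "\<sigma> \<in> ?K k" for k \<sigma>
  proof -
    obtain \<beta> where \<beta>: "\<beta> \<in> words n k" "\<sigma> = cell n \<beta>"
      using mem unfolding dconf_sink_cells_eq by blast
    obtain b where "bij_betw b {j. j < n \<and> \<beta> j \<in> E} {..<k}" using edge_numbering[OF \<beta>(1)] .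
    then show ?thesis using characteristic_map_char_map[OF \<beta>(1)] \<beta>(2) by blast
  qed
  then show ?thesis
    unfolding cw_complex_def
    using Hausdorff_dconf_sink top disj weak fin by (auto intro: finite_subset[OF _ fin])
qed

lemma cell_subset_closure_iff:
  assumes "\<beta> \<in> words n i" "\<gamma> \<in> words n l"
  shows "cell n \<gamma> \<subseteq> dconf_sink G V E n closure_of cell n \<beta> \<longleftrightarrow> (\<forall>j<n. \<gamma> j \<subseteq> G closure_of \<beta> j)"
proof -
  let ?P = "product_topology (\<lambda>_. G) {..<n}"
  have "dconf_sink G V E n closure_of cell n \<beta> = separated n \<inter> PiE {..<n} (\<lambda>j. G closure_of \<beta> j)"
    using cell_subset[OF assms(1)]
    by (simp add: dconf_sink_eq closure_of_subtopology inf.absorb2)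
       (simp add: cell_def closure_of_product_topology)
  moreover have "cell n \<gamma> \<subseteq> separated n" by (rule cell_subset[OF assms(2)])
  moreover have "cell n \<gamma> \<subseteq> PiE {..<n} (\<lambda>j. G closure_of \<beta> j) \<longleftrightarrow> (\<forall>j<n. \<gamma> j \<subseteq> G closure_of \<beta> j)"
    using cell_nonempty[OF assms(2)] unfolding cell_def by (subst subset_PiE) (simp add: Ball_def)
  ultimately show ?thesis by simp
qed

text \<open>
  A codimension one face of a product cell replaces a single edge letter by one of its ends: each letter
  of the face lies in the closure of the corresponding letter, and the dimensions differ by one.
\<close>

lemma face_word:
  assumes "face (dconf_sink G V E n) (dconf_sink_cells V E n) i \<tau> \<sigma>"
  obtains \<beta> k v where "\<beta> \<in> words n (Suc i)" "\<sigma> = cell n \<beta>" "k < n" "\<beta> k \<in> E"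
    "v = \<psi> (\<beta> k) (-1) \<or> v = \<psi> (\<beta> k) 1" "\<beta>(k := {v}) \<in> words n i" "\<tau> = cell n (\<beta>(k := {v}))"
proof -
  obtain \<beta> \<gamma> where \<beta>: "\<beta> \<in> words n (Suc i)" "\<sigma> = cell n \<beta>" and \<gamma>: "\<gamma> \<in> words n i" "\<tau> = cell n \<gamma>"
    and "\<tau> \<subseteq> dconf_sink G V E n closure_of \<sigma>"
    using assms by (auto simp: face_def dconf_sink_cells_eq)
  then have cl: "\<gamma> j \<subseteq> G closure_of \<beta> j" if "j < n" for j
    using that cell_subset_closure_iff by blast
  have cases: "\<gamma> j = \<beta> j \<or> (\<beta> j \<in> E \<and> \<gamma> j \<notin> E \<and> (\<gamma> j = {\<psi> (\<beta> j) (-1)} \<or> \<gamma> j = {\<psi> (\<beta> j) 1}))"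
    if j: "j < n" for j
    using word_letter[OF \<beta>(1) j]
  proof (cases rule: letter_cases)
    case (1 v)
    then have "G closure_of \<beta> j = {v}"
      using closedin_finite[of "{v}"] by (simp add: closure_of_eq topspace_eq)
    then show ?thesis using cl[OF j] letter_nonempty[OF word_letter[OF \<gamma>(1) j]] 1 by auto
  next
    case 2
    then have sub: "\<gamma> j \<subseteq> \<beta> j \<union> {\<psi> (\<beta> j) (-1), \<psi> (\<beta> j) 1}"
      using cl[OF j] closure_of_edge param_image_closed by simp
    from word_letter[OF \<gamma>(1) j] show ?thesis
    proof (cases rule: letter_cases)
      case (1 v)
      then have "v \<notin> \<beta> j" using 2 vertex_not_in_edge by blast
      then show ?thesis using 1 2 sub vertex_letter_not_edge by auto
    next
      case e: 2
      obtain y where "y \<in> \<gamma> j" using edge_nonempty[OF e] by blast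
      then have "y \<in> \<beta> j" using sub ends_in_V[OF 2] e vertex_not_in_edge by blast
      then show ?thesis using \<open>y \<in> \<gamma> j\<close> e 2 edge_unique by blast
    qed
  qed
  let ?J = "\<lambda>\<sigma>. {j. j < n \<and> \<sigma> j \<in> E}"
  have "\<beta> j \<in> E" if "j < n" "\<gamma> j \<in> E" for j using cases[OF that(1)] that(2) by metis
  then have "?J \<gamma> \<subseteq> ?J \<beta>" by blast
  \<comment> \<open>Edge letters can only disappear in a face, and exactly one does.\<close>
  then have "card (?J \<beta> - ?J \<gamma>) = card (?J \<beta>) - card (?J \<gamma>)" by (simp add: card_Diff_subset)
  also have "\<dots> = 1" using \<beta>(1) \<gamma>(1) by (simp add: words_def)
  finally obtain k where k: "?J \<beta> - ?J \<gamma> = {k}" by (auto simp: card_1_singleton_iff)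
  then have kn: "k < n" "\<beta> k \<in> E" "\<gamma> k \<notin> E" by auto
  then obtain v where v: "\<gamma> k = {v}" "v = \<psi> (\<beta> k) (-1) \<or> v = \<psi> (\<beta> k) 1"
    using cases[of k] by metis
  have "\<gamma> = \<beta>(k := {v})"
  proof (rule extensionalityI[of _ "{..<n}"])
    show "\<gamma> \<in> extensional {..<n}" using \<gamma> by (simp add: words_def)
    show "\<beta>(k := {v}) \<in> extensional {..<n}" using \<beta> kn by (auto simp: words_def extensional_def)
    show "\<gamma> j = (\<beta>(k := {v})) j" if j: "j \<in> {..<n}" for j
    proof (cases "j = k")
      case False
      then have "j \<notin> ?J \<beta> - ?J \<gamma>" using k by simp
      then have "\<beta> j \<in> E \<longrightarrow> \<gamma> j \<in> E" using j by simp
      then show ?thesis using cases[of j] j False by auto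
    qed (simp add: v)
  qed
  then show ?thesis using that[OF \<beta> kn(1,2) v(2)] \<gamma> by simp
qed

text \<open>
  If the edge is not a loop, the vertex \<open>v\<close> is reached at one end of the interval only, so the
  characteristic map is injective over the face. The preimage of the face is a ball because it is
  homeomorphic to the face, which has a characteristic map of its own.
\<close>

lemma regular_face_word:
  assumes \<beta>: "\<beta> \<in> words n (Suc i)" and k: "k < n" "\<beta> k \<in> E"
    and ends: "{\<psi> (\<beta> k) (-1), \<psi> (\<beta> k) 1} = {v, w}" "v \<noteq> w"
    and \<gamma>: "\<beta>(k := {v}) \<in> words n i"
  shows "regular_face (dconf_sink G V E n) (dconf_sink_cells V E n) i
    (cell n (\<beta>(k := {v}))) (cell n \<beta>)"
proof -
  let ?\<gamma> = "\<beta>(k := {v})" and ?Y = "dconf_sink G V E n" and ?K = "dconf_sink_cells V E n"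
  obtain b where b: "bij_betw b {j. j < n \<and> \<beta> j \<in> E} {..<Suc i}" using edge_numbering[OF \<beta>] .
  obtain b' where b': "bij_betw b' {j. j < n \<and> ?\<gamma> j \<in> E} {..<i}" using edge_numbering[OF \<gamma>] .
  let ?\<Phi> = "char_map n (Suc i) b \<beta>"
  have vV: "v \<in> V" using ends ends_in_V[OF k(2)] by (metis insertI1 insert_iff singletonD)
  have "?\<gamma> j \<subseteq> G closure_of \<beta> j" if "j < n" for j
  proof (cases "j = k")
    case True
    then show ?thesis using ends closure_of_edge[OF k(2)] param_image_closed[OF k(2)] by auto
  next
    case False
    then show ?thesis using closure_of_subset[OF letter_subset[OF word_letter[OF \<beta> that]]] by simp
  qed
  then have "face ?Y ?K i (cell n ?\<gamma>) (cell n \<beta>)"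
    using \<beta> \<gamma> cell_subset_closure_iff[OF \<beta> \<gamma>] by (auto simp: face_def dconf_sink_cells_eq)
  moreover have "characteristic_map ?Y ?K (Suc i) (cell n \<beta>) ?\<Phi>"
    by (rule characteristic_map_char_map[OF \<beta> b])
  moreover have hom: "homeomorphic_map (subtopology (closed_disc (Suc i)) (?\<Phi> -` cell n ?\<gamma>))
    (subtopology ?Y (cell n ?\<gamma>)) ?\<Phi>"
  proof (rule homeomorphic_map_char_map_subcell[OF \<beta> b])
    fix j assume j: "j < n" "\<beta> j \<in> E"
    show "?\<gamma> j \<subseteq> \<psi> (\<beta> j) ` {-1..1} \<and> inj_on (\<psi> (\<beta> j)) {s \<in> {-1..1}. \<psi> (\<beta> j) s \<in> ?\<gamma> j}"
    proof (cases "j = k")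
      case True
      have "s = -1 \<or> s = 1" if "s \<in> {-1..1}" "\<psi> (\<beta> k) s = v" for s
        using param_in_V_iff[OF k(2) that(1)] vV that(2) by simp
      moreover have "\<psi> (\<beta> k) (-1) \<noteq> \<psi> (\<beta> k) 1" using ends by auto
      ultimately have "inj_on (\<psi> (\<beta> k)) {s \<in> {-1..1}. \<psi> (\<beta> k) s = v}"
        by (intro inj_onI) (metis (mono_tags, lifting) mem_Collect_eq)
      moreover have "v \<in> \<psi> (\<beta> k) ` {-1..1}" using ends param_image_closed[OF k(2)] by auto
      ultimately show ?thesis using True by simp
    next
      case False
      have "{s \<in> {-1..1}. \<psi> (\<beta> j) s \<in> \<beta> j} \<subseteq> {-1<..<1}" using param_in_edge_iff[OF j(2)] by blast
      then show ?thesis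
        using False param_image_closed[OF j(2)] inj_param[OF j(2)] by (auto intro: inj_on_subset)
    qed
  next
    fix j assume "j < n" "\<beta> j \<notin> E"
    then show "?\<gamma> j = \<beta> j" using k(2) by auto
  qed
  moreover have "subtopology (closed_disc (Suc i)) (?\<Phi> -` cell n ?\<gamma>) homeomorphic_space open_disc i"
  proof -
    have "homeomorphic_map (open_disc i) (subtopology ?Y (cell n ?\<gamma>)) (char_map n i b' ?\<gamma>)"
      using characteristic_map_char_map[OF \<gamma> b'] unfolding characteristic_map_def by blast
    then show ?thesis
      using hom by (meson homeomorphic_map_imp_homeomorphic_space homeomorphic_space_sym homeomorphic_space_trans)
  qed
  ultimately show ?thesis unfolding regular_face_def Let_def by blast
qed

end

section \<open>Deforming configurations into the cellular model\<close>

lemma sgn_diff_mono: "a \<le> b \<Longrightarrow> sgn (a - c) \<le> sgn (b - c)" for a b c :: real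
  by (simp add: sgn_real_def)

context parametrized_graph
begin

text \<open>
  The coordinate of a point on the open edge \<open>e\<close>; its value is meaningless elsewhere.
\<close>

definition coord :: "'a set \<Rightarrow> 'a \<Rightarrow> real" where
  "coord e = the_inv_into {-1<..<1} (\<psi> e)"

lemma coord_param: "\<lbrakk>e \<in> E; s \<in> {-1<..<1}\<rbrakk> \<Longrightarrow> coord e (\<psi> e s) = s"
  unfolding coord_def by (rule the_inv_into_f_f[OF inj_param])

lemma coord:
  assumes "e \<in> E" "y \<in> e"
  shows "coord e y \<in> {-1<..<1}" "\<psi> e (coord e y) = y"
proof -
  have "y \<in> \<psi> e ` {-1<..<1}" using assms(2) unfolding param_image[OF assms(1)] .
  then obtain s where "s \<in> {-1<..<1}" "y = \<psi> e s" by (rule imageE)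
  then show "coord e y \<in> {-1<..<1}" "\<psi> e (coord e y) = y" using coord_param[OF assms(1)] by simp_all
qed

lemma continuous_map_coord:
  assumes e: "e \<in> E" shows "continuous_map (subtopology G e) euclideanreal (coord e)"
  unfolding continuous_map_closedin
proof (intro conjI allI impI)
  fix C :: "real set" assume "closedin euclideanreal C"
  then have "closed ({-1..1} \<inter> C)" by (simp add: closed_Int)
  then have "closedin G (\<psi> e ` ({-1..1} \<inter> C))" using closedin_param_image[OF e] by simp
  moreover have "{y \<in> topspace (subtopology G e). coord e y \<in> C} = e \<inter> \<psi> e ` ({-1..1} \<inter> C)"
  proof (intro equalityI subsetI)
    fix y assume "y \<in> {y \<in> topspace (subtopology G e). coord e y \<in> C}"
    then have y: "y \<in> e" "coord e y \<in> C" by simp_all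
    then have "coord e y \<in> {-1..1} \<inter> C" using coord(1)[OF e y(1)] by simp
    then have "\<psi> e (coord e y) \<in> \<psi> e ` ({-1..1} \<inter> C)" by (rule imageI)
    then show "y \<in> e \<inter> \<psi> e ` ({-1..1} \<inter> C)" using y coord(2)[OF e y(1)] by simp
  next
    fix y assume y: "y \<in> e \<inter> \<psi> e ` ({-1..1} \<inter> C)"
    then obtain s where s: "s \<in> {-1..1}" "s \<in> C" "y = \<psi> e s" by blast
    then have "s \<in> {-1<..<1}" using y param_in_edge_iff[OF e s(1)] by simp
    then have "coord e y = s" using s coord_param[OF e] by simp
    then show "y \<in> {y \<in> topspace (subtopology G e). coord e y \<in> C}"
      using s y e topspace_eq by auto
  qed
  ultimately show "closedin (subtopology G e) {y \<in> topspace (subtopology G e). coord e y \<in> C}"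
    by (simp add: closedin_subtopology_Int_closed)
qed simp

text \<open>
  The weight \<open>1 - s\<^sup>2\<close> vanishes at both ends of the edge and is extended by \<open>0\<close>, so it is continuous on
  the whole graph. In a sum over all particles, those outside the edge contribute nothing and those
  entering it contribute continuously.
\<close>

definition weight :: "'a set \<Rightarrow> 'a \<Rightarrow> real" where
  "weight e y = (if y \<in> e then 1 - (coord e y)\<^sup>2 else 0)"

lemma weight_param:
  assumes "e \<in> E" "s \<in> {-1..1}" shows "weight e (\<psi> e s) = 1 - s\<^sup>2"
proof (cases "s \<in> {-1<..<1}")
  case True
  then show ?thesis using param_in_edge_iff[OF assms] coord_param[OF assms(1)] by (simp add: weight_def)
next
  case False
  then have "s = -1 \<or> s = 1" using assms by auto
  then have "s\<^sup>2 = 1" by auto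
  moreover have "\<psi> e s \<notin> e" using False param_in_edge_iff[OF assms] by blast
  ultimately show ?thesis by (simp add: weight_def)
qed

lemma weight_pos: "\<lbrakk>e \<in> E; y \<in> e\<rbrakk> \<Longrightarrow> weight e y > 0"
  using coord(1)[of e y] by (simp add: weight_def abs_square_less_1 abs_less_iff)

lemma weight_nonneg: "e \<in> E \<Longrightarrow> weight e y \<ge> 0"
  using weight_pos[of e y] by (cases "y \<in> e") (simp_all add: weight_def)

lemma continuous_map_weight:
  assumes e: "e \<in> E" shows "continuous_map G euclideanreal (weight e)"
  unfolding continuous_map_closedin
proof (intro conjI allI impI)
  fix C :: "real set" assume C: "closedin euclideanreal C"
  let ?S = "{s \<in> {-1..1}. 1 - s\<^sup>2 \<in> C}"
  have "closed ({-1..1} \<inter> (\<lambda>s::real. 1 - s\<^sup>2) -` C)"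
    using C by (intro continuous_closed_preimage continuous_intros) simp_all
  then have "closed ?S" by (simp add: Int_def vimage_def)
  then have "closedin G (\<psi> e ` ?S)" by (rule closedin_param_image[OF e]) auto
  moreover have "closedin G (if 0 \<in> C then topspace G - e else {})"
    using openin_edge[OF e] by (simp add: closedin_diff)
  ultimately have "closedin G (\<psi> e ` ?S \<union> (if 0 \<in> C then topspace G - e else {}))"
    by (rule closedin_Un)
  moreover have "{y \<in> topspace G. weight e y \<in> C} = \<psi> e ` ?S \<union> (if 0 \<in> C then topspace G - e else {})"
  proof (intro equalityI subsetI)
    fix y assume "y \<in> {y \<in> topspace G. weight e y \<in> C}"
    then have y: "y \<in> topspace G" "weight e y \<in> C" by simp_all
    show "y \<in> \<psi> e ` ?S \<union> (if 0 \<in> C then topspace G - e else {})"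
    proof (cases "y \<in> e")
      case True
      have "coord e y \<in> {-1..1}" using coord(1)[OF e True] by simp
      then have "coord e y \<in> ?S" using y(2) True by (simp add: weight_def)
      then have "\<psi> e (coord e y) \<in> \<psi> e ` ?S" by (rule imageI)
      then show ?thesis using coord(2)[OF e True] by simp
    next
      case False
      then show ?thesis using y by (simp add: weight_def)
    qed
  next
    fix y assume "y \<in> \<psi> e ` ?S \<union> (if 0 \<in> C then topspace G - e else {})"
    then consider "y \<in> \<psi> e ` ?S" | "0 \<in> C" "y \<in> topspace G - e" by (auto split: if_splits)
    then show "y \<in> {y \<in> topspace G. weight e y \<in> C}"
    proof cases
      case 1
      then obtain s where "s \<in> {-1..1}" "1 - s\<^sup>2 \<in> C" "y = \<psi> e s" by auto
      then show ?thesis using weight_param[OF e] param_in_topspace[OF e] by simp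
    next
      case 2
      then show ?thesis by (simp add: weight_def)
    qed
  qed
  ultimately show "closedin G {y \<in> topspace G. weight e y \<in> C}" by simp
qed simp

text \<open>
  The sum is the total weight of the particles to the left of particle \<open>j\<close> on the edge \<open>e\<close> minus the total
  weight of those to its right; it tells on which side of the weighted median the particle is. The
  summand \<open>coord e (x j)\<close> drives a particle that is close to an end of the edge into that end.
\<close>

definition displacement :: "nat \<Rightarrow> (nat \<Rightarrow> 'a) \<Rightarrow> 'a set \<Rightarrow> nat \<Rightarrow> real" where
  "displacement n x e j =
     coord e (x j) + (\<Sum>l<n. weight e (x l) * sgn (coord e (x j) - coord e (x l)))"

text \<open>
  Only a particle whose displacement is smaller than its own weight in absolute value stays inside
  the edge.
\<close>

definition target :: "nat \<Rightarrow> (nat \<Rightarrow> 'a) \<Rightarrow> 'a set \<Rightarrow> nat \<Rightarrow> real" where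
  "target n x e j = max (-1) (min 1 (displacement n x e j / weight e (x j)))"

text \<open>
  The straight-line homotopy, in the parameter of the edge, from the given position to the target.
\<close>

definition push :: "nat \<Rightarrow> real \<Rightarrow> (nat \<Rightarrow> 'a) \<Rightarrow> nat \<Rightarrow> 'a" where
  "push n t x = (\<lambda>j\<in>{..<n}. if x j \<in> V then x j else
     let e = letter (x j) in \<psi> e ((1 - t) * coord e (x j) + t * target n x e j))"

lemma target_bounds: "target n x e j \<in> {-1..1}"
  by (simp add: target_def)

text \<open>
  Passing from a particle to one further right, the particle left behind joins the left side and the
  new one leaves the right side, so the displacement grows by at least both weights; every other particle
  contributes a nonnegative amount.
\<close>

lemma displacement_gap:
  assumes e: "e \<in> E" and jk: "j < n" "k < n" and x: "x j \<in> e" "x k \<in> e"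
    and less: "coord e (x j) < coord e (x k)"
  shows "displacement n x e k - displacement n x e j > weight e (x j) + weight e (x k)"
proof -
  let ?c = "\<lambda>l. coord e (x l)" and ?w = "\<lambda>l. weight e (x l)"
  let ?d = "\<lambda>l. ?w l * (sgn (?c k - ?c l) - sgn (?c j - ?c l))"
  have "(\<Sum>l\<in>{j, k}. ?d l) \<le> (\<Sum>l<n. ?d l)"
    using jk less sgn_diff_mono[of "?c j" "?c k"] weight_nonneg[OF e]
    by (intro sum_mono2) (auto intro!: mult_nonneg_nonneg)
  moreover have "(\<Sum>l\<in>{j, k}. ?d l) = ?w j + ?w k"
    using less by (subst sum.insert) (auto simp: sgn_real_def)
  moreover have "displacement n x e k - displacement n x e j = (?c k - ?c j) + (\<Sum>l<n. ?d l)"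
    by (simp add: displacement_def sum_subtractf right_diff_distrib)
  ultimately show ?thesis using less by simp
qed

text \<open>
  Of two particles on an edge, the left one reaches the left end or the right one reaches the right end.
  This makes the targets monotone and leaves at most one of them inside the edge.
\<close>

lemma target_dichotomy:
  assumes e: "e \<in> E" and jk: "j < n" "k < n" and x: "x j \<in> e" "x k \<in> e"
    and less: "coord e (x j) < coord e (x k)"
  shows "target n x e j = -1 \<or> target n x e k = 1"
proof (rule disjCI)
  assume "target n x e k \<noteq> 1"
  then have "displacement n x e k < weight e (x k)"
    using weight_pos[OF e x(2)] by (auto simp: target_def max_def min_def field_simps split: if_splits)
  then have "displacement n x e j < - weight e (x j)"
    using displacement_gap[of e j n k x, OF assms] by linarith
  then show "target n x e j = -1"
    using weight_pos[OF e x(1)] by (auto simp: target_def max_def min_def field_simps split: if_splits)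
qed

text \<open>
  Close to \<open>-1\<close> every particle further left has a weight of at most twice the distance \<open>1 + s\<close> to the
  end, so the whole sum is at most \<open>2 * n * (1 + s)\<close> and cannot outweigh the term \<open>s\<close>. The bound is the same
  for all configurations, so \<open>push\<close> moves a particle near a vertex only towards that vertex; this is what
  continuity at the vertices rests on.
\<close>

lemma target_near_left_end:
  assumes e: "e \<in> E" and j: "x j \<in> e" and near: "(2 * real n + 3) * (1 + coord e (x j)) \<le> 1"
  shows "target n x e j = -1"
proof -
  let ?s = "coord e (x j)"
  have s: "?s \<in> {-1<..<1}" by (rule coord(1)[OF e j])
  have w: "1 - c\<^sup>2 \<le> 2 * (1 + c)" for c :: real
  proof -
    have "0 \<le> (1 + c)\<^sup>2" by simp
    then show ?thesis by (simp add: power2_eq_square algebra_simps)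
  qed
  have "weight e (x l) * sgn (?s - coord e (x l)) \<le> 2 * (1 + ?s)" for l
  proof (cases "x l \<in> e \<and> coord e (x l) < ?s")
    case True
    then have "weight e (x l) \<le> 2 * (1 + coord e (x l))" using w by (simp add: weight_def)
    then show ?thesis using True by simp
  next
    case False
    then have "weight e (x l) * sgn (?s - coord e (x l)) \<le> 0"
      using weight_nonneg[OF e, of "x l"] by (auto simp: weight_def sgn_real_def)
    then show ?thesis using s by simp
  qed
  then have "(\<Sum>l<n. weight e (x l) * sgn (?s - coord e (x l))) \<le> (\<Sum>l<n. 2 * (1 + ?s))"
    by (rule sum_mono)
  then have "displacement n x e j \<le> ?s + real n * (2 * (1 + ?s))"
    by (simp add: displacement_def)
  also have "\<dots> \<le> - (2 * (1 + ?s))" using near by (simp add: algebra_simps)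
  also have "\<dots> \<le> - weight e (x j)" using j w[of ?s] by (simp add: weight_def)
  finally show ?thesis
    using weight_pos[OF e j] by (auto simp: target_def max_def min_def field_simps split: if_splits)
qed

lemma target_near_right_end:
  assumes e: "e \<in> E" and j: "x j \<in> e" and near: "(2 * real n + 3) * (1 - coord e (x j)) \<le> 1"
  shows "target n x e j = 1"
proof -
  let ?s = "coord e (x j)"
  have s: "?s \<in> {-1<..<1}" by (rule coord(1)[OF e j])
  have w: "1 - c\<^sup>2 \<le> 2 * (1 - c)" for c :: real
  proof -
    have "0 \<le> (1 - c)\<^sup>2" by simp
    then show ?thesis by (simp add: power2_eq_square algebra_simps)
  qed
  have "- (2 * (1 - ?s)) \<le> weight e (x l) * sgn (?s - coord e (x l))" for l
  proof (cases "x l \<in> e \<and> ?s < coord e (x l)")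
    case True
    then have "weight e (x l) \<le> 2 * (1 - coord e (x l))" using w by (simp add: weight_def)
    then show ?thesis using True by simp
  next
    case False
    then have "0 \<le> weight e (x l) * sgn (?s - coord e (x l))"
      using weight_nonneg[OF e, of "x l"] by (auto simp: weight_def sgn_real_def)
    then show ?thesis using s by simp
  qed
  then have "(\<Sum>l<n. - (2 * (1 - ?s))) \<le> (\<Sum>l<n. weight e (x l) * sgn (?s - coord e (x l)))"
    by (rule sum_mono)
  then have "- (real n * (2 * (1 - ?s))) \<le> (\<Sum>l<n. weight e (x l) * sgn (?s - coord e (x l)))"
    by (simp add: algebra_simps)
  then have "?s - real n * (2 * (1 - ?s)) \<le> displacement n x e j"
    by (simp add: displacement_def)
  moreover have "2 * (1 - ?s) \<le> ?s - real n * (2 * (1 - ?s))" using near by (simp add: algebra_simps)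
  moreover have "weight e (x j) \<le> 2 * (1 - ?s)" using j w[of ?s] by (simp add: weight_def)
  ultimately have "weight e (x j) \<le> displacement n x e j" by linarith
  then show ?thesis
    using weight_pos[OF e j] by (auto simp: target_def max_def min_def field_simps split: if_splits)
qed

text \<open>
  The neighbourhood \<open>W\<close> is a small star around \<open>v\<close>: the complement of the other vertices and of the
  parts of all closed edges that are not close to an end at \<open>v\<close>. It is chosen so small that the way from
  any of its points to \<open>v\<close> along the edge stays inside \<open>U\<close>.
\<close>

lemma star_neighbourhood:
  assumes v: "v \<in> V" and U: "openin G U" "v \<in> U" and d0: "d0 > 0"
  obtains W where "openin G W" "v \<in> W"
    "\<And>w. \<lbrakk>w \<in> W; w \<in> V\<rbrakk> \<Longrightarrow> w = v"
    "\<And>e y. \<lbrakk>e \<in> E; y \<in> e; y \<in> W\<rbrakk> \<Longrightarrow>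
       (coord e y < -1 + d0 \<and> (\<forall>p\<in>{-1..coord e y}. \<psi> e p \<in> U)) \<or>
       (coord e y > 1 - d0 \<and> (\<forall>p\<in>{coord e y..1}. \<psi> e p \<in> U))"
proof -
  have "\<exists>d>0. d \<le> d0 \<and> (\<psi> e (-1) = v \<longrightarrow> (\<forall>p\<in>{-1..1}. p < -1 + d \<longrightarrow> \<psi> e p \<in> U)) \<and>
      (\<psi> e 1 = v \<longrightarrow> (\<forall>p\<in>{-1..1}. p > 1 - d \<longrightarrow> \<psi> e p \<in> U))" if e: "e \<in> E" for e
  proof -
    have "openin (top_of_set {-1..1}) {s \<in> topspace (top_of_set {-1..1}). \<psi> e s \<in> U}"
      by (rule openin_continuous_map_preimage[OF continuous_param[OF e] U(1)])
    then obtain T where T: "open T" "{s \<in> {-1..1}. \<psi> e s \<in> U} = {-1..1} \<inter> T"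
      unfolding openin_open by auto
    have ball: "\<exists>d>0. \<forall>p. \<bar>p - a\<bar> < d \<longrightarrow> p \<in> T" if "a \<in> T" for a
      using T(1) that unfolding open_dist dist_real_def by blast
    have "\<exists>d>0. \<psi> e a = v \<longrightarrow> (\<forall>p\<in>{-1..1}. \<bar>p - a\<bar> < d \<longrightarrow> \<psi> e p \<in> U)" if a: "a \<in> {-1..1}" for a
    proof (cases "\<psi> e a = v")
      case True
      then have "a \<in> {s \<in> {-1..1}. \<psi> e s \<in> U}" using a U(2) by simp
      then have "a \<in> T" unfolding T(2) by simp
      then obtain d where d: "d > 0" "\<And>p. \<bar>p - a\<bar> < d \<Longrightarrow> p \<in> T" using ball by metis
      have "\<psi> e p \<in> U" if "p \<in> {-1..1}" "\<bar>p - a\<bar> < d" for p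
      proof -
        have "p \<in> {-1..1} \<inter> T" using that d(2) by simp
        then show ?thesis unfolding T(2)[symmetric] by simp
      qed
      then show ?thesis using d(1) by (intro exI[of _ d]) simp
    qed (auto intro: exI[of _ 1])
    from this[of "-1"] this[of 1] obtain d1 d2 where d: "d1 > 0" "d2 > 0"
      "\<psi> e (-1) = v \<longrightarrow> (\<forall>p\<in>{-1..1}. \<bar>p - (-1)\<bar> < d1 \<longrightarrow> \<psi> e p \<in> U)"
      "\<psi> e 1 = v \<longrightarrow> (\<forall>p\<in>{-1..1}. \<bar>p - 1\<bar> < d2 \<longrightarrow> \<psi> e p \<in> U)" by auto
    show ?thesis
    proof (intro exI[of _ "min d0 (min d1 d2)"] conjI impI ballI)
      fix p :: real assume p: "\<psi> e (-1) = v" "p \<in> {-1..1}" "p < -1 + min d0 (min d1 d2)"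
      then have "\<bar>p - (-1)\<bar> < d1" by simp
      then show "\<psi> e p \<in> U" using d(3) p by blast
    next
      fix p :: real assume p: "\<psi> e 1 = v" "p \<in> {-1..1}" "p > 1 - min d0 (min d1 d2)"
      then have "\<bar>p - 1\<bar> < d2" by simp
      then show "\<psi> e p \<in> U" using d(4) p by blast
    qed (use d d0 in auto)
  qed
  then have "\<forall>e. \<exists>d. e \<in> E \<longrightarrow> d > 0 \<and> d \<le> d0 \<and>
      (\<psi> e (-1) = v \<longrightarrow> (\<forall>p\<in>{-1..1}. p < -1 + d \<longrightarrow> \<psi> e p \<in> U)) \<and>
      (\<psi> e 1 = v \<longrightarrow> (\<forall>p\<in>{-1..1}. p > 1 - d \<longrightarrow> \<psi> e p \<in> U))" by blast
  from choice[OF this] obtain d where d0: "\<forall>e. e \<in> E \<longrightarrow> d e > 0 \<and> d e \<le> d0 \<and>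
      (\<psi> e (-1) = v \<longrightarrow> (\<forall>p\<in>{-1..1}. p < -1 + d e \<longrightarrow> \<psi> e p \<in> U)) \<and>
      (\<psi> e 1 = v \<longrightarrow> (\<forall>p\<in>{-1..1}. p > 1 - d e \<longrightarrow> \<psi> e p \<in> U))" ..
  have d: "\<And>e. e \<in> E \<Longrightarrow> d e > 0" "\<And>e. e \<in> E \<Longrightarrow> d e \<le> d0"
    "\<And>e p. \<lbrakk>e \<in> E; \<psi> e (-1) = v; p \<in> {-1..1}; p < -1 + d e\<rbrakk> \<Longrightarrow> \<psi> e p \<in> U"
    "\<And>e p. \<lbrakk>e \<in> E; \<psi> e 1 = v; p \<in> {-1..1}; p > 1 - d e\<rbrakk> \<Longrightarrow> \<psi> e p \<in> U"
    using d0 by blast+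
  define C where "C e = {-1..1} \<inter> (if \<psi> e (-1) = v then {-1 + d e..} else UNIV) \<inter>
    (if \<psi> e 1 = v then {..1 - d e} else UNIV)" for e
  define W where "W = topspace G - ((V - {v}) \<union> (\<Union>e\<in>E. \<psi> e ` C e))"
  have "closedin G (\<psi> e ` C e)" if "e \<in> E" for e
    by (rule closedin_param_image[OF that]) (auto simp: C_def intro!: closed_Int)
  then have "closedin G (\<Union>e\<in>E. \<psi> e ` C e)"
    using finite_E by (intro closedin_Union) auto
  moreover have "closedin G (V - {v})"
    using finite_V topspace_eq by (intro closedin_finite) auto
  ultimately have "openin G W" unfolding W_def by (intro openin_diff closedin_Un openin_topspace)
  moreover have "v \<in> W"
  proof -
    have "v \<notin> \<psi> e ` C e" if e: "e \<in> E" for e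
    proof
      assume "v \<in> \<psi> e ` C e"
      then obtain s where s: "s \<in> C e" "v = \<psi> e s" by (rule imageE)
      then have "s \<in> {-1..1}" by (simp add: C_def)
      then have "s = -1 \<or> s = 1" using param_in_V_iff[OF e] v s(2) by simp
      then show False using s d(1)[OF e] by (auto simp: C_def)
    qed
    then show ?thesis using v topspace_eq by (auto simp: W_def)
  qed
  moreover have "w = v" if "w \<in> W" "w \<in> V" for w using that by (auto simp: W_def)
  moreover have "(coord e y < -1 + d0 \<and> (\<forall>p\<in>{-1..coord e y}. \<psi> e p \<in> U)) \<or>
       (coord e y > 1 - d0 \<and> (\<forall>p\<in>{coord e y..1}. \<psi> e p \<in> U))"
    if e: "e \<in> E" and y: "y \<in> e" "y \<in> W" for e y
  proof -
    have c: "coord e y \<in> {-1<..<1}" by (rule coord(1)[OF e y(1)])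
    have "coord e y \<notin> C e"
    proof
      assume "coord e y \<in> C e"
      then have "\<psi> e (coord e y) \<in> \<psi> e ` C e" by (rule imageI)
      then show False using y(2) e unfolding coord(2)[OF e y(1)] W_def by blast
    qed
    then consider "\<psi> e (-1) = v" "coord e y < -1 + d e" | "\<psi> e 1 = v" "coord e y > 1 - d e"
      using c by (auto simp: C_def split: if_splits)
    then show ?thesis
    proof cases
      case 1
      then have "\<forall>p\<in>{-1..coord e y}. \<psi> e p \<in> U" using d(3)[OF e 1(1)] c by simp
      then show ?thesis using 1 d(2)[OF e] by simp
    next
      case 2
      then have "\<forall>p\<in>{coord e y..1}. \<psi> e p \<in> U" using d(4)[OF e 2(1)] c by simp
      then show ?thesis using 2 d(2)[OF e] by simp
    qed
  qed
  ultimately show ?thesis using that by metis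
qed

lemma topspace_conf_sink:
  "x \<in> topspace (conf_sink G V n) \<longleftrightarrow> x \<in> extensional {..<n} \<and> (\<forall>j<n. x j \<in> topspace G) \<and>
     (\<forall>j<n. \<forall>k<n. j \<noteq> k \<longrightarrow> x j = x k \<longrightarrow> x j \<in> V)"
  unfolding conf_sink_def by (auto simp: PiE_iff)

lemma conf_sink_collision:
  assumes "x \<in> topspace (conf_sink G V n)" "j < n" "k < n" "j \<noteq> k" "x j = x k"
  shows "x j \<in> V"
proof -
  have "\<forall>j<n. \<forall>k<n. j \<noteq> k \<longrightarrow> x j = x k \<longrightarrow> x j \<in> V"
    using assms(1) unfolding topspace_conf_sink by (rule conjunct2[OF conjunct2])
  then show ?thesis using assms(2-5) by blast
qed

lemma in_edge_or_vertex:
  assumes "y \<in> topspace G"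
  obtains "y \<in> V" | e where "e \<in> E" "y \<in> e" "y \<notin> V" "letter y = e"
  using assms vertex_not_in_edge letter_eq unfolding topspace_eq letters_def by blast

lemma push_vertex: "\<lbrakk>j < n; x j \<in> V\<rbrakk> \<Longrightarrow> push n t x j = x j"
  by (simp add: push_def)

lemma push_edge:
  assumes "j < n" "e \<in> E" "x j \<in> e"
  shows "push n t x j = \<psi> e ((1 - t) * coord e (x j) + t * target n x e j)"
proof -
  have "x j \<notin> V" using assms vertex_not_in_edge by blast
  moreover have "letter (x j) = e" using assms by (intro letter_eq) (simp_all add: letters_def)
  ultimately show ?thesis using assms(1) by (simp add: push_def)
qed

lemma push_position:
  assumes "e \<in> E" "x j \<in> e" "t \<in> {0..1}"
  shows "(1 - t) * coord e (x j) + t * target n x e j \<in> {-1..1}"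
proof -
  have "coord e (x j) \<in> {-1..1}" using coord(1)[OF assms(1,2)] by simp
  then have "(1 - t) *\<^sub>R coord e (x j) + t *\<^sub>R target n x e j \<in> {-1..1}"
    using target_bounds assms(3) by (intro convexD[OF convex_real_interval(5)]) auto
  then show ?thesis by simp
qed

text \<open>
  The sign jumps only if the particles \<open>j\<close> and \<open>l\<close> pass each other. On an open edge they cannot, since
  collisions are confined to vertices, and where particle \<open>l\<close> leaves the edge its weight vanishes.
\<close>

lemma continuous_map_displacement:
  assumes e: "e \<in> E" and j: "j < n"
  shows "continuous_map (subtopology (conf_sink G V n) {x. x j \<in> e}) euclideanreal
    (\<lambda>x. displacement n x e j)"
proof -
  let ?X = "conf_sink G V n" and ?X' = "subtopology (conf_sink G V n) {x. x j \<in> e}"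
  have proj: "continuous_map ?X G (\<lambda>x. x l)" if "l < n" for l
    unfolding conf_sink_def using that
    by (intro continuous_map_from_subtopology continuous_map_product_projection) simp
  have c: "continuous_map (subtopology ?X S) euclideanreal (\<lambda>x. coord e (x l))"
    if l: "l < n" and S: "\<And>x. x \<in> S \<Longrightarrow> x l \<in> e" for l S
  proof -
    have "continuous_map (subtopology ?X S) (subtopology G e) (\<lambda>x. x l)"
      using proj[OF l] S by (auto simp: continuous_map_in_subtopology continuous_map_from_subtopology)
    from continuous_map_compose[OF this continuous_map_coord[OF e]] show ?thesis by (simp add: o_def)
  qed
  have "continuous_map ?X' euclideanreal (\<lambda>x. weight e (x l) * sgn (coord e (x j) - coord e (x l)))"
    if l: "l < n" for l
  proof (cases "l = j")
    case False
    have w: "continuous_map ?X' euclideanreal (\<lambda>x. weight e (x l))"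
      using continuous_map_compose[OF proj[OF l] continuous_map_weight[OF e]]
      by (simp add: o_def continuous_map_from_subtopology)
    show ?thesis
    proof (rule continuous_map_vanishing_product[OF w, where C = 1])
      let ?X'' = "subtopology ?X' {x. weight e (x l) \<noteq> 0}"
      have X'': "?X'' = subtopology ?X {x. x j \<in> e \<and> x l \<in> e}"
      proof -
        have "weight e (x l) \<noteq> 0 \<longleftrightarrow> x l \<in> e" for x :: "nat \<Rightarrow> 'a"
          using weight_pos[OF e, of "x l"] by (auto simp: weight_def)
        then show ?thesis by (simp add: subtopology_subtopology Int_def)
      qed
      have cj: "continuous_map ?X'' euclideanreal (\<lambda>x. coord e (x j))"
        and cl: "continuous_map ?X'' euclideanreal (\<lambda>x. coord e (x l))"
        unfolding X'' by (rule c; use j l in simp)+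
      have ne: "coord e (x j) - coord e (x l) \<noteq> 0" if x: "x \<in> topspace ?X''" for x
      proof
        assume eq: "coord e (x j) - coord e (x l) = 0"
        have xe: "x j \<in> e" "x l \<in> e" and xX: "x \<in> topspace ?X" using x unfolding X'' by simp_all
        have "\<psi> e (coord e (x j)) = \<psi> e (coord e (x l))" using eq by simp
        then have "x j = x l" unfolding coord(2)[OF e xe(1)] coord(2)[OF e xe(2)] .
        then have "x j \<in> V" using xX False j l using conf_sink_collision by metis
        then show False using vertex_not_in_edge[OF _ e] xe by blast
      qed
      have "continuous_map ?X'' euclideanreal (\<lambda>x. weight e (x l) *
        ((coord e (x j) - coord e (x l)) / \<bar>coord e (x j) - coord e (x l)\<bar>))"
        using ne by (intro continuous_intros continuous_map_from_subtopology[OF w] cj cl) simp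
      moreover have "sgn r = r / \<bar>r\<bar>" for r :: real by (simp add: sgn_real_def)
      ultimately show "continuous_map ?X'' euclideanreal
        (\<lambda>x. weight e (x l) * sgn (coord e (x j) - coord e (x l)))" by simp
      show "\<bar>weight e (x l) * sgn (coord e (x j) - coord e (x l))\<bar> \<le> 1 * \<bar>weight e (x l)\<bar>" for x
        by (simp add: abs_mult sgn_real_def)
    qed
  qed simp
  moreover have "continuous_map ?X' euclideanreal (\<lambda>x. coord e (x j))" by (rule c[OF j]) simp
  ultimately show ?thesis
    unfolding displacement_def by (intro continuous_map_add continuous_map_sum) simp_all
qed

lemma continuous_map_target:
  assumes e: "e \<in> E" and j: "j < n"
  shows "continuous_map (subtopology (conf_sink G V n) {x. x j \<in> e}) euclideanreal (\<lambda>x. target n x e j)"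
proof -
  have proj: "continuous_map (conf_sink G V n) G (\<lambda>x. x j)"
    unfolding conf_sink_def using j
    by (intro continuous_map_from_subtopology continuous_map_product_projection) simp
  have w: "continuous_map (subtopology (conf_sink G V n) {x. x j \<in> e}) euclideanreal (\<lambda>x. weight e (x j))"
    using continuous_map_compose[OF proj continuous_map_weight[OF e]]
    by (simp add: o_def continuous_map_from_subtopology)
  have ne: "weight e (x j) \<noteq> 0" if "x \<in> topspace (subtopology (conf_sink G V n) {x. x j \<in> e})" for x
    using that weight_pos[OF e, of "x j"] by simp
  show ?thesis unfolding target_def
    by (intro continuous_intros continuous_map_displacement[OF e j] w ne) simp_all
qed

text \<open>
  Away from the vertices the position is given by a continuous formula on the open set of configurations
  with particle \<open>j\<close> on the edge. At a configuration with particle \<open>j\<close> at a vertex, the particle stays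
  near the vertex because nearby particles are only pushed towards it. The argument is local, so it also covers
  loops, where the two ends of the interval are the same vertex.
\<close>

lemma continuous_map_push_coordinate:
  assumes j: "j < n"
  shows "continuous_map (prod_topology (top_of_set {0..1}) (conf_sink G V n)) G
    (\<lambda>z. push n (fst z) (snd z) j)"
proof -
  let ?X = "conf_sink G V n"
  let ?P = "prod_topology (top_of_set {0..1::real}) ?X"
  let ?f = "\<lambda>z. push n (fst z) (snd z) j"
  have topP: "fst z \<in> {0..1}" "snd z \<in> topspace ?X" "snd z j \<in> topspace G" if "z \<in> topspace ?P" for z
    using that j unfolding topspace_prod_topology mem_Times_iff topspace_conf_sink by simp_all
  have proj: "continuous_map ?X G (\<lambda>x. x j)"
    unfolding conf_sink_def using j
    by (intro continuous_map_from_subtopology continuous_map_product_projection) simp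
  have proj': "continuous_map ?P G (\<lambda>z. snd z j)"
    using continuous_map_compose[OF continuous_map_snd proj] by (simp add: o_def)
  have edge: "continuous_map (subtopology ?P {z. snd z j \<in> e}) G ?f" if e: "e \<in> E" for e
  proof -
    let ?Q = "subtopology ?P {z. snd z j \<in> e}"
    have s: "continuous_map ?Q (subtopology ?X {x. x j \<in> e}) snd"
      by (auto simp: continuous_map_in_subtopology intro!: continuous_map_from_subtopology continuous_map_snd)
    have t: "continuous_map ?Q euclideanreal fst"
      using continuous_map_from_subtopology[OF continuous_map_fst, of "top_of_set {0..1::real}" ?X]
      by (simp add: continuous_map_in_subtopology)
    have c: "continuous_map ?Q euclideanreal (\<lambda>z. coord e (snd z j))"
    proof -
      have "continuous_map ?Q (subtopology G e) (\<lambda>z. snd z j)"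
        using proj' by (auto simp: continuous_map_in_subtopology continuous_map_from_subtopology)
      from continuous_map_compose[OF this continuous_map_coord[OF e]] show ?thesis by (simp add: o_def)
    qed
    have q: "continuous_map ?Q euclideanreal (\<lambda>z. target n (snd z) e j)"
      using continuous_map_compose[OF s continuous_map_target[OF e j]] by (simp add: o_def)
    let ?r = "\<lambda>z. (1 - fst z) * coord e (snd z j) + fst z * target n (snd z) e j"
    have "continuous_map ?Q euclideanreal ?r" by (intro continuous_intros t c q) simp
    moreover have "?r z \<in> {-1..1}" if "z \<in> topspace ?Q" for z
      using that topP(1)[of z] by (intro push_position[OF e]) simp_all
    ultimately have "continuous_map ?Q (top_of_set {-1..1}) ?r"
      by (simp add: continuous_map_in_subtopology image_subset_iff)
    from continuous_map_compose[OF this continuous_param[OF e]]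
    have "continuous_map ?Q G (\<lambda>z. \<psi> e (?r z))" by (simp add: o_def)
    then show ?thesis
      by (rule continuous_map_eq) (simp add: push_edge[OF j e])
  qed
  have topf: "?f z \<in> topspace G" if z: "z \<in> topspace ?P" for z
    using topP(3)[OF z]
  proof (cases rule: in_edge_or_vertex)
    case 1
    then show ?thesis using push_vertex[of j n "snd z" "fst z", OF j] topspace_eq by simp
  next
    case (2 e)
    then show ?thesis
      using push_edge[of j n e "snd z" "fst z", OF j 2(1,2)] push_position[of e "snd z" j "fst z" n, OF 2(1,2) topP(1)[OF z]]
        param_in_topspace[OF 2(1)] by simp
  qed
  show ?thesis
    unfolding continuous_map_def
  proof (intro conjI allI impI)
    show "?f \<in> topspace ?P \<rightarrow> topspace G" using topf by blast
    fix U assume U: "openin G U"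
    show "openin ?P {z \<in> topspace ?P. ?f z \<in> U}"
    proof (subst openin_subopen, intro ballI)
      fix z assume "z \<in> {z \<in> topspace ?P. ?f z \<in> U}"
      then have z: "z \<in> topspace ?P" "?f z \<in> U" by simp_all
      from topP(3)[OF z(1)]
      show "\<exists>T. openin ?P T \<and> z \<in> T \<and> T \<subseteq> {z \<in> topspace ?P. ?f z \<in> U}"
      proof (cases rule: in_edge_or_vertex)
        case v: 1
        let ?v = "snd z j"
        have "?v \<in> U" using z(2) push_vertex[of j n "snd z" "fst z", OF j v] by simp
        \<comment> \<open>Within this distance of an end, the target of a particle is that end.\<close>
        have d0: "1 / (2 * real n + 3) > 0" by simp
        show ?thesis
        proof (rule star_neighbourhood[OF v U \<open>?v \<in> U\<close> d0])
          fix W assume W: "openin G W" "?v \<in> W" "\<And>w. \<lbrakk>w \<in> W; w \<in> V\<rbrakk> \<Longrightarrow> w = ?v"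
            "\<And>e y. \<lbrakk>e \<in> E; y \<in> e; y \<in> W\<rbrakk> \<Longrightarrow>
               (coord e y < -1 + 1 / (2 * real n + 3) \<and> (\<forall>p\<in>{-1..coord e y}. \<psi> e p \<in> U)) \<or>
               (coord e y > 1 - 1 / (2 * real n + 3) \<and> (\<forall>p\<in>{coord e y..1}. \<psi> e p \<in> U))"
          let ?T = "{z \<in> topspace ?P. snd z j \<in> W}"
          have "openin ?P ?T" by (rule openin_continuous_map_preimage[OF proj' W(1)])
          moreover have "z \<in> ?T" using z W(2) by simp
          moreover have "?f z' \<in> U" if z': "z' \<in> ?T" for z'
          proof -
            have z'P: "z' \<in> topspace ?P" and z'W: "snd z' j \<in> W" using z' by simp_all
            from topP(3)[OF z'P] show ?thesis
            proof (cases rule: in_edge_or_vertex)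
              case 1
              then have "snd z' j = ?v" using W(3) z'W by blast
              then show ?thesis using push_vertex[of j n "snd z'" "fst z'", OF j 1] \<open>?v \<in> U\<close> by simp
            next
              case (2 e)
              let ?s = "coord e (snd z' j)" and ?t = "fst z'"
              have t: "0 \<le> ?t" "?t \<le> 1" using topP(1)[OF z'P] by simp_all
              have f: "?f z' = \<psi> e ((1 - ?t) * ?s + ?t * target n (snd z') e j)"
                by (rule push_edge[of j n e "snd z'" "fst z'", OF j 2(1,2)])
              have s: "?s \<in> {-1<..<1}" by (rule coord(1)[OF 2(1,2)])
              from W(4)[OF 2(1,2) z'W] show ?thesis
              proof
                assume A: "?s < -1 + 1 / (2 * real n + 3) \<and> (\<forall>p\<in>{-1..?s}. \<psi> e p \<in> U)"
                then have "(2 * real n + 3) * (1 + ?s) \<le> (2 * real n + 3) * (1 / (2 * real n + 3))"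
                  by (intro mult_left_mono) simp_all
                then have "target n (snd z') e j = -1"
                  by (intro target_near_left_end[of e "snd z'" j n, OF 2(1,2)]) simp
                moreover have "(1 - ?t) * ?s + ?t * (-1) \<in> {-1..?s}"
                proof -
                  have "0 \<le> ?t * (1 + ?s)" "0 \<le> (1 - ?t) * (1 + ?s)"
                    using t s by (intro mult_nonneg_nonneg; simp)+
                  then show ?thesis by (simp add: algebra_simps)
                qed
                ultimately show ?thesis using A f by simp
              next
                assume A: "?s > 1 - 1 / (2 * real n + 3) \<and> (\<forall>p\<in>{?s..1}. \<psi> e p \<in> U)"
                then have "(2 * real n + 3) * (1 - ?s) \<le> (2 * real n + 3) * (1 / (2 * real n + 3))"
                  by (intro mult_left_mono) simp_all
                then have "target n (snd z') e j = 1"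
                  by (intro target_near_right_end[of e "snd z'" j n, OF 2(1,2)]) simp
                moreover have "(1 - ?t) * ?s + ?t * 1 \<in> {?s..1}"
                proof -
                  have "0 \<le> ?t * (1 - ?s)" "0 \<le> (1 - ?t) * (1 - ?s)"
                    using t s by (intro mult_nonneg_nonneg; simp)+
                  then show ?thesis by (simp add: algebra_simps)
                qed
                ultimately show ?thesis using A f by simp
              qed
            qed
          qed
          ultimately show ?thesis by blast
        qed
      next
        case (2 e)
        let ?O = "{z \<in> topspace ?P. snd z j \<in> e}"
        have O: "openin ?P ?O" by (rule openin_continuous_map_preimage[OF proj' openin_edge[OF 2(1)]])
        have "subtopology ?P {z. snd z j \<in> e} = subtopology ?P ?O"
          using subtopology_restrict[of ?P "{z. snd z j \<in> e}"] by (simp add: Int_def)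
        then have "openin (subtopology ?P ?O) {z \<in> topspace (subtopology ?P ?O). ?f z \<in> U}"
          using openin_continuous_map_preimage[OF edge[OF 2(1)] U] by simp
        then have "openin ?P {z \<in> topspace (subtopology ?P ?O). ?f z \<in> U}"
          by (rule openin_trans_full[OF _ O])
        moreover have "{z \<in> topspace (subtopology ?P ?O). ?f z \<in> U} = {z \<in> ?O. ?f z \<in> U}" by auto
        ultimately have "openin ?P {z \<in> ?O. ?f z \<in> U}" by simp
        then show ?thesis using z 2(2) by (intro exI[of _ "{z \<in> ?O. ?f z \<in> U}"] conjI subsetI) simp_all
      qed
    qed
  qed
qed

lemma push_in_topspace:
  assumes x: "x \<in> topspace (conf_sink G V n)" and t: "t \<in> {0..1}" and j: "j < n"
  shows "push n t x j \<in> topspace G"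
proof -
  have "(t, x) \<in> topspace (prod_topology (top_of_set {0..1}) (conf_sink G V n))"
    using x t by simp
  then have "push n (fst (t, x)) (snd (t, x)) j \<in> topspace G"
    using continuous_map_push_coordinate[OF j] unfolding continuous_map_def by blast
  then show ?thesis by simp
qed

lemma push_in_edge:
  assumes x: "x \<in> topspace (conf_sink G V n)" and t: "t \<in> {0..1}" and j: "j < n"
    and e: "e \<in> E" and p: "push n t x j \<in> e"
  shows "x j \<in> e" "(1 - t) * coord e (x j) + t * target n x e j \<in> {-1<..<1}"
proof -
  have "x j \<in> topspace G" using x j by (simp add: topspace_conf_sink)
  then have "x j \<in> e \<and> (1 - t) * coord e (x j) + t * target n x e j \<in> {-1<..<1}"
  proof (cases rule: in_edge_or_vertex)
    case 1
    then show ?thesis using p push_vertex[of j n x t, OF j 1] vertex_not_in_edge[OF 1 e] by simp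
  next
    case (2 e')
    let ?r = "(1 - t) * coord e' (x j) + t * target n x e' j"
    have r: "?r \<in> {-1..1}" by (rule push_position[of e' x j t n, OF 2(1,2) t])
    have pr: "push n t x j = \<psi> e' ?r" by (rule push_edge[of j n e' x t, OF j 2(1,2)])
    have "\<psi> e' ?r \<notin> V" using p pr vertex_not_in_edge[OF _ e] by metis
    then have r': "?r \<in> {-1<..<1}" using param_in_V_iff[OF 2(1) r] r by auto
    then have "\<psi> e' ?r \<in> e'" using param_in_edge_iff[OF 2(1) r] by simp
    then have "e' = e" using edge_unique[OF 2(1) e] p pr by simp
    then show ?thesis using 2 r' by simp
  qed
  then show "x j \<in> e" "(1 - t) * coord e (x j) + t * target n x e j \<in> {-1<..<1}" by simp_all
qed

lemma push_order:
  assumes e: "e \<in> E" and jk: "j < n" "k < n" and x: "x j \<in> e" "x k \<in> e"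
    and less: "coord e (x j) < coord e (x k)" and t: "t \<in> {0..1}"
    and inner: "(1 - t) * coord e (x j) + t * target n x e j \<in> {-1<..<1}"
      "(1 - t) * coord e (x k) + t * target n x e k \<in> {-1<..<1}"
  shows "t < 1" "(1 - t) * coord e (x j) + t * target n x e j < (1 - t) * coord e (x k) + t * target n x e k"
proof -
  have d: "target n x e j = -1 \<or> target n x e k = 1" by (rule target_dichotomy[of e j n k x, OF e jk x less])
  have "t \<noteq> 1" using d inner by auto
  then show t1: "t < 1" using t by simp
  have "target n x e j \<le> target n x e k"
    using d target_bounds[of n x e j] target_bounds[of n x e k] by auto
  then have "t * target n x e j \<le> t * target n x e k" using t by (simp add: mult_left_mono)
  moreover have "(1 - t) * coord e (x j) < (1 - t) * coord e (x k)"
    using t1 less by (simp add: mult_strict_left_mono)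
  ultimately show "(1 - t) * coord e (x j) + t * target n x e j < (1 - t) * coord e (x k) + t * target n x e k"
    by linarith
qed

text \<open>
  Two particles on one edge keep their order strictly before time \<open>1\<close>, and at time \<open>1\<close> at most one
  of them is still on the edge.
\<close>

lemma push_distinct:
  assumes x: "x \<in> topspace (conf_sink G V n)" and t: "t \<in> {0..1}" and jk: "j < n" "k < n" "j \<noteq> k"
    and e: "e \<in> E" and p: "push n t x j \<in> e" "push n t x k \<in> e"
  shows "t < 1" "push n t x j \<noteq> push n t x k"
proof -
  note J = push_in_edge[OF x t jk(1) e p(1)] and K = push_in_edge[OF x t jk(2) e p(2)]
  let ?r = "\<lambda>l. (1 - t) * coord e (x l) + t * target n x e l"
  have "x j \<noteq> x k"
    using x jk J(1) vertex_not_in_edge[OF _ e] using conf_sink_collision by metis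
  then have "coord e (x j) \<noteq> coord e (x k)" using coord(2)[OF e J(1)] coord(2)[OF e K(1)] by metis
  then consider "coord e (x j) < coord e (x k)" | "coord e (x k) < coord e (x j)" by linarith
  then have "t < 1 \<and> ?r j \<noteq> ?r k"
  proof cases
    case 1
    then show ?thesis using push_order[of e j n k x t, OF e jk(1,2) J(1) K(1) 1 t J(2) K(2)] by simp
  next
    case 2
    then show ?thesis using push_order[of e k n j x t, OF e jk(2,1) K(1) J(1) 2 t K(2) J(2)] by simp
  qed
  moreover have "push n t x j = \<psi> e (?r j)" "push n t x k = \<psi> e (?r k)"
    using push_edge[of j n e x t, OF jk(1) e J(1)] push_edge[of k n e x t, OF jk(2) e K(1)] by simp_all
  ultimately show "t < 1" "push n t x j \<noteq> push n t x k"
    using inj_onD[OF inj_param[OF e] _ J(2) K(2)] by auto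
qed

lemma push_extensional: "push n t x \<in> extensional {..<n}"
  by (simp add: push_def)

lemma push_conf_sink:
  assumes x: "x \<in> topspace (conf_sink G V n)" and t: "t \<in> {0..1}"
  shows "push n t x \<in> topspace (conf_sink G V n)"
proof -
  have "push n t x j \<in> V" if jk: "j < n" "k < n" "j \<noteq> k" and eq: "push n t x j = push n t x k" for j k
    using push_in_topspace[OF x t jk(1)]
  proof (cases rule: in_edge_or_vertex)
    case (2 e)
    then show ?thesis using push_distinct(2)[OF x t jk 2(1)] eq by simp
  qed
  then show ?thesis unfolding topspace_conf_sink
    using push_extensional push_in_topspace[OF x t] by blast
qed

lemma push_1_separated:
  assumes x: "x \<in> topspace (conf_sink G V n)" shows "push n 1 x \<in> separated n"
proof -
  have "j = k" if "j < n" "k < n" "e \<in> E" "push n 1 x j \<in> e" "push n 1 x k \<in> e" for j k e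
    using push_distinct(1)[OF x _ that(1,2) _ that(3-5)] by fastforce
  then show ?thesis unfolding separated_def mem_Collect_eq
    using push_extensional push_in_topspace[OF x] by simp
qed

lemma separated_subset_conf_sink: "separated n \<subseteq> topspace (conf_sink G V n)"
proof
  fix x assume x: "x \<in> separated n"
  then have top: "x j \<in> topspace G" if "j < n" for j using that by (simp add: separated_def)
  have "x j \<in> V" if "j < n" "k < n" "j \<noteq> k" "x j = x k" for j k
    using top[OF that(1)]
  proof (cases rule: in_edge_or_vertex)
    case (2 e)
    then show ?thesis using separatedD[OF x that(1,2) 2(1)] that(3,4) by simp
  qed
  then show "x \<in> topspace (conf_sink G V n)"
    unfolding topspace_conf_sink using x top by (simp add: separated_def)
qed

lemma push_separated:
  assumes x: "x \<in> separated n" and t: "t \<in> {0..1}"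
  shows "push n t x \<in> separated n"
proof -
  have xc: "x \<in> topspace (conf_sink G V n)" using x separated_subset_conf_sink by blast
  have "j = k" if "j < n" "k < n" "e \<in> E" "push n t x j \<in> e" "push n t x k \<in> e" for j k e
    using separatedD[OF x that(1-3)] push_in_edge(1)[OF xc t _ that(3)] that by blast
  then show ?thesis unfolding separated_def mem_Collect_eq
    using push_extensional push_in_topspace[OF xc t] by simp
qed

lemma push_0:
  assumes x: "x \<in> topspace (conf_sink G V n)" shows "push n 0 x = x"
proof (rule extensionalityI[OF push_extensional])
  show "x \<in> extensional {..<n}" using x by (simp add: topspace_conf_sink)
  fix j assume "j \<in> {..<n}"
  then have j: "j < n" by simp
  then have "x j \<in> topspace G" using x by (simp add: topspace_conf_sink)
  then show "push n 0 x j = x j"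
  proof (cases rule: in_edge_or_vertex)
    case 1
    then show ?thesis by (rule push_vertex[OF j])
  next
    case (2 e)
    then show ?thesis using push_edge[of j n e x 0, OF j 2(1,2)] coord(2)[OF 2(1,2)] by simp
  qed
qed

lemma continuous_map_push:
  "continuous_map (prod_topology (top_of_set {0..1}) (conf_sink G V n)) (conf_sink G V n)
     (\<lambda>z. push n (fst z) (snd z))"
proof -
  let ?P = "prod_topology (top_of_set {0..1::real}) (conf_sink G V n)"
  have "continuous_map ?P (product_topology (\<lambda>_. G) {..<n}) (\<lambda>z. push n (fst z) (snd z))"
    unfolding continuous_map_componentwise
    using continuous_map_push_coordinate push_extensional by auto
  moreover have "push n (fst z) (snd z) \<in> topspace (conf_sink G V n)" if "z \<in> topspace ?P" for z
    using that by (intro push_conf_sink) auto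
  ultimately show ?thesis
    unfolding conf_sink_def by (simp add: continuous_map_in_subtopology image_subset_iff)
qed

lemma dconf_sink_subtopology:
  "dconf_sink G V E n = subtopology (conf_sink G V n) (separated n)"
proof -
  have "separated n \<subseteq> {x. \<forall>i<n. \<forall>j<n. i \<noteq> j \<longrightarrow> x i \<noteq> x j \<or> x i = x j \<and> x i \<in> V}"
    using separated_subset_conf_sink[of n] unfolding conf_sink_def by auto
  then show ?thesis
    unfolding dconf_sink_eq conf_sink_def by (simp add: subtopology_subtopology inf.absorb2)
qed

text \<open>
  The homotopy \<open>push\<close> starts at the identity, ends in the cellular model and never leaves the
  cellular model once inside, because a particle on an open edge has always been on that edge. So
  \<open>push n 1\<close> is a homotopy inverse of the inclusion, although it moves points of the cellular model.
\<close>

theorem dconf_sink_homotopy_equivalent: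
  "dconf_sink G V E n homotopy_equivalent_space conf_sink G V n"
proof -
  let ?C = "conf_sink G V n" and ?D = "dconf_sink G V E n" and ?I = "top_of_set {0..1::real}"
  let ?h = "\<lambda>z. push n (fst z) (snd z)"
  have topD: "topspace ?D = separated n" by (rule topspace_dconf_sink)
  have incl: "continuous_map ?D ?C id"
    unfolding dconf_sink_subtopology by (rule continuous_map_from_subtopology[OF continuous_map_id])
  have retr: "continuous_map ?C ?D (push n 1)"
  proof -
    have "continuous_map ?C (prod_topology ?I ?C) (\<lambda>x. (1, x))"
      by (intro continuous_map_pairedI) (simp_all add: continuous_map_id[unfolded id_def])
    from continuous_map_compose[OF this continuous_map_push]
    have "continuous_map ?C ?C (push n 1)" by (simp add: o_def)
    then show ?thesis
      unfolding dconf_sink_subtopology continuous_map_in_subtopology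
      using push_1_separated by blast
  qed
  have hD: "continuous_map (prod_topology ?I ?D) ?D ?h"
  proof -
    have "continuous_map (prod_topology ?I ?D) ?C ?h"
      unfolding dconf_sink_subtopology prod_topology_subtopology(2)
      by (rule continuous_map_from_subtopology[OF continuous_map_push])
    moreover have "?h ` topspace (prod_topology ?I ?D) \<subseteq> separated n"
      unfolding topspace_prod_topology topD using push_separated by auto
    ultimately show ?thesis
      by (subst (2) dconf_sink_subtopology) (simp only: continuous_map_in_subtopology image_subset_iff_funcset)
  qed
  have "homotopic_with (\<lambda>_. True) ?D ?D id (push n 1 \<circ> id)"
    by (subst homotopic_with)
       (use hD push_0 subsetD[OF separated_subset_conf_sink] in \<open>auto simp: topD intro!: exI[of _ ?h]\<close>)
  moreover have "homotopic_with (\<lambda>_. True) ?C ?C id (id \<circ> push n 1)"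
    by (subst homotopic_with) (use continuous_map_push push_0 in \<open>auto intro!: exI[of _ ?h]\<close>)
  ultimately show ?thesis
    unfolding homotopy_equivalent_space_def using incl retr homotopic_with_sym by blast
qed

end

section \<open>From finite CW graphs to parametrised graphs\<close>

lemma cw_complexD:
  assumes "cw_complex Y K"
  shows "Hausdorff_space Y"
    and "(\<Union>k. \<Union>(K k)) = topspace Y"
    and "\<lbrakk>\<sigma> \<in> K k; \<tau> \<in> K l; (k, \<sigma>) \<noteq> (l, \<tau>)\<rbrakk> \<Longrightarrow> \<sigma> \<inter> \<tau> = {}"
    and "\<sigma> \<in> K k \<Longrightarrow> \<exists>\<Phi>. characteristic_map Y K k \<sigma> \<Phi>"
    and "\<sigma> \<in> K k \<Longrightarrow> finite {\<tau> \<in> (\<Union>l. K l). \<tau> \<inter> Y closure_of \<sigma> \<noteq> {}}"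
    and "\<lbrakk>A \<subseteq> topspace Y; \<And>k \<sigma>. \<sigma> \<in> K k \<Longrightarrow> closedin Y (A \<inter> Y closure_of \<sigma>)\<rbrakk> \<Longrightarrow> closedin Y A"
proof -
  note c = assms[unfolded cw_complex_def]
  show "Hausdorff_space Y" by (rule conjunct1[OF c])
  show "(\<Union>k. \<Union>(K k)) = topspace Y" by (rule conjunct1[OF conjunct2[OF c]])
  note c2 = conjunct2[OF conjunct2[OF c]]
  show "\<sigma> \<inter> \<tau> = {}" if "\<sigma> \<in> K k" "\<tau> \<in> K l" "(k, \<sigma>) \<noteq> (l, \<tau>)"
    by (rule conjunct1[OF c2, rule_format, OF that])
  show "\<exists>\<Phi>. characteristic_map Y K k \<sigma> \<Phi>" if "\<sigma> \<in> K k"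
    by (rule conjunct1[OF conjunct2[OF c2], rule_format, OF that])
  note c4 = conjunct2[OF conjunct2[OF c2]]
  show "finite {\<tau> \<in> (\<Union>l. K l). \<tau> \<inter> Y closure_of \<sigma> \<noteq> {}}" if "\<sigma> \<in> K k"
    by (rule conjunct1[OF c4, rule_format, OF that])
  show "closedin Y A" if "A \<subseteq> topspace Y" "\<And>k \<sigma>. \<sigma> \<in> K k \<Longrightarrow> closedin Y (A \<inter> Y closure_of \<sigma>)"
    using conjunct2[OF c4, rule_format, OF that(1)] that(2) by simp
qed

text \<open>
  Choose one point in each cell. Every set of chosen points is closed, since it meets each closed cell in
  a finite set. Hence the chosen points have no limit point, and in a compact space there are only
  finitely many of them.
\<close>

lemma finite_cells_of_compact_cw_complex:
  assumes cw: "cw_complex Y K" and compact: "compact_space Y"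
  shows "finite (\<Union>k. K k)"
proof -
  let ?C = "\<Union>k. K k"
  have sub: "\<sigma> \<subseteq> topspace Y" if "\<sigma> \<in> ?C" for \<sigma>
    using that unfolding cw_complexD(2)[OF cw, symmetric] by fast
  have disj: "\<sigma> \<inter> \<tau> = {}" if \<sigma>: "\<sigma> \<in> ?C" and \<tau>: "\<tau> \<in> ?C" and ne: "\<sigma> \<noteq> \<tau>" for \<sigma> \<tau>
  proof -
    from \<sigma> obtain k where "\<sigma> \<in> K k" by blast
    moreover from \<tau> obtain l where "\<tau> \<in> K l" by blast
    ultimately show ?thesis using cw_complexD(3)[OF cw] ne by simp
  qed
  have ne: "\<sigma> \<noteq> {}" if \<sigma>: "\<sigma> \<in> ?C" for \<sigma>
  proof -
    obtain k where "\<sigma> \<in> K k" using \<sigma> by (elim UN_E)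
    then obtain \<Phi> where "characteristic_map Y K k \<sigma> \<Phi>" using cw_complexD(4)[OF cw] by blast
    then have "homeomorphic_map (open_disc k) (subtopology Y \<sigma>) \<Phi>"
      unfolding characteristic_map_def by (elim conjE)
    then have "\<Phi> ` topspace (open_disc k) = topspace Y \<inter> \<sigma>"
      using homeomorphic_imp_surjective_map by fastforce
    moreover have "(\<lambda>_. 0) \<in> topspace (open_disc k)" by (simp add: topspace_open_disc)
    ultimately show ?thesis by blast
  qed
  define pt where "pt \<sigma> = (SOME x. x \<in> \<sigma>)" for \<sigma> :: "'a set"
  have pt: "pt \<sigma> \<in> \<sigma>" if "\<sigma> \<in> ?C" for \<sigma>
    using ne[OF that] unfolding pt_def by (simp add: some_in_eq)
  have inj: "inj_on pt ?C"
    using pt disj by (intro inj_onI) (metis disjoint_iff)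
  have closed: "closedin Y T" if T: "T \<subseteq> pt ` ?C" for T
  proof -
    have TY: "T \<subseteq> topspace Y"
    proof
      fix x assume "x \<in> T"
      then have "x \<in> pt ` ?C" using T by blast
        then obtain \<tau> where \<tau>: "x = pt \<tau>" "\<tau> \<in> ?C" by (rule imageE)
      then show "x \<in> topspace Y" using subsetD[OF sub pt] \<tau> by simp
    qed
    have "closedin Y (T \<inter> Y closure_of \<sigma>)" if \<sigma>: "\<sigma> \<in> K k" for k \<sigma>
    proof -
      let ?F = "{\<tau> \<in> ?C. \<tau> \<inter> Y closure_of \<sigma> \<noteq> {}}"
      have "finite ?F" by (rule cw_complexD(5)[OF cw \<sigma>])
      moreover have "T \<inter> Y closure_of \<sigma> \<subseteq> pt ` ?F"
      proof
        fix x assume x: "x \<in> T \<inter> Y closure_of \<sigma>"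
        then have "x \<in> pt ` ?C" using T by blast
        then obtain \<tau> where \<tau>: "x = pt \<tau>" "\<tau> \<in> ?C" by (rule imageE)
        then have "x \<in> \<tau> \<inter> Y closure_of \<sigma>" using pt[OF \<tau>(2)] x by simp
        then have "\<tau> \<in> ?F" using \<tau>(2) by blast
        then show "x \<in> pt ` ?F" using \<tau>(1) by (rule rev_image_eqI)
      qed
      ultimately have "finite (T \<inter> Y closure_of \<sigma>)" by (meson finite_imageI finite_subset)
      moreover have "t1_space Y" by (rule Hausdorff_imp_t1_space[OF cw_complexD(1)[OF cw]])
      ultimately show ?thesis using TY t1_space_closedin_finite by blast
    qed
    then show ?thesis by (rule cw_complexD(6)[OF cw TY])
  qed
  have "Y derived_set_of (pt ` ?C) = {}"
  proof (rule equals0I)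
    fix x assume x: "x \<in> Y derived_set_of (pt ` ?C)"
    let ?U = "topspace Y - (pt ` ?C - {x})"
    have "openin Y ?U" using closed[of "pt ` ?C - {x}"] by blast
    moreover have "x \<in> ?U" using x by (simp add: in_derived_set_of)
    ultimately have "\<exists>y. y \<noteq> x \<and> y \<in> pt ` ?C \<and> y \<in> ?U" using x unfolding in_derived_set_of by metis
    then show False by blast
  qed
  moreover have "pt ` ?C \<subseteq> topspace Y" by (intro image_subsetI subsetD[OF sub pt])
  ultimately have "finite (pt ` ?C)"
    using compact_space_imp_Bolzano_Weierstrass[OF compact] by blast
  then show ?thesis using inj by (rule finite_imageD)
qed

text \<open>
  The parametrisation of an edge is its characteristic map composed with the inclusion of the interval as
  the one-dimensional disc.
\<close>

lemma parametrized_graph_of_cw_graph: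
  assumes "cw_graph G V E"
  obtains \<psi> where "parametrized_graph G V E \<psi>"
proof -
  let ?K = "graph_cells V E"
  have cw: "cw_complex G ?K" and compact: "compact_space G" using assms by (simp_all add: cw_graph_def)
  have K: "?K 0 = (\<lambda>v. {v}) ` V" "?K 1 = E" "?K (Suc 0) = E" "\<And>k. k > 1 \<Longrightarrow> ?K k = {}"
    by (simp_all add: graph_cells_def)
  have fin: "finite (\<Union>k. ?K k)" by (rule finite_cells_of_compact_cw_complex[OF cw compact])
  have finE: "finite E" using K(2) by (intro finite_subset[OF _ fin]) blast
  have "finite ((\<lambda>v. {v}) ` V)" using K(1) by (intro finite_subset[OF _ fin]) blast
  then have finV: "finite V" by (rule finite_imageD) (simp add: inj_on_def)
  have top: "topspace G = V \<union> \<Union>E"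
  proof -
    have "(\<Union>k. \<Union>(?K k)) = V \<union> \<Union>E"
    proof (intro equalityI subsetI)
      fix x assume "x \<in> (\<Union>k. \<Union>(?K k))"
      then show "x \<in> V \<union> \<Union>E" by (auto simp: graph_cells_def split: if_splits)
    next
      fix x assume "x \<in> V \<union> \<Union>E"
      then have "x \<in> \<Union>(?K 0) \<or> x \<in> \<Union>(?K 1)" using K by auto
      then show "x \<in> (\<Union>k. \<Union>(?K k))" by blast
    qed
    then show ?thesis using cw_complexD(2)[OF cw] by simp
  qed
  note disj = cw_complexD(3)[OF cw]
  let ?\<iota> = "\<lambda>s i. if i = (0::nat) then (s::real) else 0"
  have "\<exists>f. continuous_map (top_of_set {-1..1::real}) G f \<and> inj_on f {-1<..<1} \<and> f ` {-1<..<1} = e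
      \<and> f (-1) \<in> V \<and> f 1 \<in> V" if e: "e \<in> E" for e
  proof -
    have "e \<in> ?K 1" using e K by simp
    then obtain \<Phi> where \<Phi>: "characteristic_map G ?K 1 e \<Phi>" using cw_complexD(4)[OF cw] by blast
    have cont: "continuous_map (closed_disc 1) G \<Phi>"
      and hom: "homeomorphic_map (open_disc 1) (subtopology G e) \<Phi>"
      and bd: "\<Phi> ` (topspace (closed_disc 1) - topspace (open_disc 1)) \<subseteq> (\<Union>j<1. \<Union>(?K j))"
      using \<Phi> by (simp_all add: characteristic_map_def)
    have in_closed: "?\<iota> s \<in> topspace (closed_disc 1)" if "s \<in> {-1..1}" for s
      using that by (simp add: topspace_closed_disc abs_square_le_1 abs_le_iff)
    have open_eq: "topspace (open_disc 1) = ?\<iota> ` {-1<..<1}"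
    proof (intro equalityI subsetI)
      fix x assume x: "x \<in> topspace (open_disc 1)"
      then have "x = ?\<iota> (x 0)" by (auto simp: topspace_open_disc)
      moreover have "x 0 \<in> {-1<..<1}" using x by (simp add: topspace_open_disc abs_square_less_1 abs_less_iff)
      ultimately show "x \<in> ?\<iota> ` {-1<..<1}" by (rule image_eqI)
    next
      fix x assume "x \<in> ?\<iota> ` {-1<..<1}"
      then show "x \<in> topspace (open_disc 1)"
        by (auto simp: topspace_open_disc abs_square_less_1 abs_less_iff)
    qed
    have c\<iota>: "continuous_map (top_of_set {-1..1}) (closed_disc 1) ?\<iota>"
    proof -
      have "continuous_map (top_of_set {-1..1}) (powertop_real UNIV) ?\<iota>"
        by (auto simp: continuous_map_componentwise_UNIV)
      then show ?thesis using in_closed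
        by (simp add: closed_disc_def Euclidean_space_def continuous_map_in_subtopology
            topspace_closed_disc image_subset_iff)
    qed
    have e_top: "topspace G \<inter> e = e" using e top by auto
    have cont': "continuous_map (top_of_set {-1..1}) G (\<Phi> \<circ> ?\<iota>)" by (rule continuous_map_compose[OF c\<iota> cont])
    have inj': "inj_on (\<Phi> \<circ> ?\<iota>) {-1<..<1}"
    proof (rule comp_inj_on)
      show "inj_on ?\<iota> {-1<..<1}" by (rule inj_onI) (auto dest: fun_cong[of _ _ 0])
      show "inj_on \<Phi> (?\<iota> ` {-1<..<1})"
        using homeomorphic_imp_injective_map[OF hom] unfolding open_eq .
    qed
    have img: "(\<Phi> \<circ> ?\<iota>) ` {-1<..<1} = e"
      using homeomorphic_imp_surjective_map[OF hom] e_top unfolding open_eq by (simp add: image_comp)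
    have "(\<Phi> \<circ> ?\<iota>) s \<in> V" if s: "s = -1 \<or> s = 1" for s
    proof -
      have "?\<iota> s \<in> topspace (closed_disc 1)" using s by (intro in_closed) auto
      moreover have "?\<iota> s \<notin> topspace (open_disc 1)" using s by (auto simp: topspace_open_disc)
      ultimately have "\<Phi> (?\<iota> s) \<in> (\<Union>j<1. \<Union>(?K j))" using bd by blast
      then obtain j where "j < 1" "\<Phi> (?\<iota> s) \<in> \<Union>(?K j)" by (elim UN_E) simp
      then have "\<Phi> (?\<iota> s) \<in> \<Union>(?K 0)" by simp
      then have "\<Phi> (?\<iota> s) \<in> V" unfolding K(1) by blast
      then show ?thesis by simp
    qed
    note ends = this
    show ?thesis
      using cont' inj' img ends[of "-1"] ends[of 1] by (intro exI[of _ "\<Phi> \<circ> ?\<iota>"] conjI) simp_all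
  qed
  then have "\<forall>e. \<exists>f. e \<in> E \<longrightarrow> continuous_map (top_of_set {-1..1::real}) G f \<and> inj_on f {-1<..<1} \<and>
      f ` {-1<..<1} = e \<and> f (-1) \<in> V \<and> f 1 \<in> V" by blast
  from choice[OF this] obtain \<psi> where \<psi>: "\<forall>e. e \<in> E \<longrightarrow> continuous_map (top_of_set {-1..1::real}) G (\<psi> e) \<and>
      inj_on (\<psi> e) {-1<..<1} \<and> \<psi> e ` {-1<..<1} = e \<and> \<psi> e (-1) \<in> V \<and> \<psi> e 1 \<in> V" ..
  have "parametrized_graph G V E \<psi>"
  proof
    show "Hausdorff_space G" by (rule cw_complexD(1)[OF cw])
    show "e \<inter> V = {}" if "e \<in> E" for e
    proof -
      have "e \<inter> {v} = {}" if "v \<in> V" for v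
        using disj[of e 1 "{v}" 0] \<open>e \<in> E\<close> that K by auto
      then show ?thesis by blast
    qed
    show "e \<inter> e' = {}" if "e \<in> E" "e' \<in> E" "e \<noteq> e'" for e e'
      using disj[of e 1 e' 1] that K by simp
  qed (use top finV finE \<psi> in simp_all)
  then show ?thesis by (rule that)
qed

section \<open>A rooted spanning tree\<close>

context parametrized_graph
begin

text \<open>
  The closed edges with ends in \<open>R\<close> and those with ends outside \<open>R\<close> would otherwise separate the
  graph into two closed parts.
\<close>

lemma adjacency_closed_eq_V:
  assumes conn: "connected_space G" and R: "R \<subseteq> V" "R \<noteq> {}"
    and adj: "\<And>e. e \<in> E \<Longrightarrow> \<psi> e (-1) \<in> R \<longleftrightarrow> \<psi> e 1 \<in> R"
  shows "R = V"
proof -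
  let ?A = "R \<union> (\<Union>e\<in>{e \<in> E. \<psi> e 1 \<in> R}. \<psi> e ` {-1..1})"
  let ?B = "(V - R) \<union> (\<Union>e\<in>{e \<in> E. \<psi> e 1 \<notin> R}. \<psi> e ` {-1..1})"
  have cl: "closedin G (\<Union>e\<in>{e \<in> E. P e}. \<psi> e ` {-1..1})" for P
    using finite_E by (intro closedin_Union) (auto intro!: closedin_param_image)
  have cA: "closedin G ?A"
  proof (rule closedin_Un[OF _ cl])
    show "closedin G R"
      using finite_subset[OF R(1) finite_V] R(1) by (intro closedin_finite) (simp_all add: topspace_eq le_supI1)
  qed
  have cB: "closedin G ?B"
    using finite_V topspace_eq by (intro closedin_Un[OF _ cl] closedin_finite) auto
  have un: "?A \<union> ?B = topspace G"
  proof (intro equalityI subsetI)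
    fix x assume "x \<in> ?A \<union> ?B"
    then consider "x \<in> V" | e where "e \<in> E" "x \<in> \<psi> e ` {-1..1}" using R(1) by blast
    then show "x \<in> topspace G"
    proof cases
      case (2 e)
      then show ?thesis using param_in_topspace by blast
    qed (simp add: topspace_eq)
  next
    fix x assume "x \<in> topspace G"
    then consider "x \<in> V" | e where "e \<in> E" "x \<in> e" unfolding topspace_eq by blast
    then show "x \<in> ?A \<union> ?B"
    proof cases
      case (2 e)
      then have "x \<in> \<psi> e ` {-1..1}" using param_image_closed by simp
      then show ?thesis using 2(1) by blast
    qed blast
  qed
  have dj: "?A \<inter> ?B = {}"
  proof (rule equals0I)
    fix x assume x: "x \<in> ?A \<inter> ?B"
    have ends: "x = \<psi> e (-1) \<or> x = \<psi> e 1" if "e \<in> E" "x \<in> \<psi> e ` {-1..1}" "x \<in> V" for e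
      using that(2) vertex_not_in_edge[OF that(3,1)] unfolding param_image_closed[OF that(1)] by blast
    have vA: "x \<in> R" if xV: "x \<in> V"
    proof (cases "x \<in> R")
      case False
      then obtain e where "e \<in> E" "\<psi> e 1 \<in> R" "x \<in> \<psi> e ` {-1..1}" using x by blast
      then show ?thesis using ends[of e] adj[of e] xV by metis
    qed
    have vB: "x \<notin> R" if xV: "x \<in> V"
    proof (cases "x \<in> V - R")
      case False
      then obtain e where "e \<in> E" "\<psi> e 1 \<notin> R" "x \<in> \<psi> e ` {-1..1}" using x by blast
      then show ?thesis using ends[of e] adj[of e] xV by metis
    qed simp
    show False
    proof (cases "x \<in> V")
      case True
      then show ?thesis using vA vB by blast
    next
      case False
      then obtain e e' where e: "e \<in> E" "\<psi> e 1 \<in> R" "x \<in> \<psi> e ` {-1..1}"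
        and e': "e' \<in> E" "\<psi> e' 1 \<notin> R" "x \<in> \<psi> e' ` {-1..1}" using x R(1) by blast
      have "x \<in> e" using e(3) False ends_in_V[OF e(1)] unfolding param_image_closed[OF e(1)] by blast
      moreover have "x \<in> e'"
        using e'(3) False ends_in_V[OF e'(1)] unfolding param_image_closed[OF e'(1)] by blast
      ultimately have "e = e'" using edge_unique e(1) e'(1) by blast
      then show False using e e' by simp
    qed
  qed
  have "?A \<noteq> {}" using R(2) by blast
  have "?B = {}"
  proof (rule ccontr)
    assume "?B \<noteq> {}"
    with \<open>?A \<noteq> {}\<close> have "\<exists>A B. closedin G A \<and> closedin G B \<and> A \<union> B = topspace G \<and> A \<inter> B = {} \<and> A \<noteq> {} \<and> B \<noteq> {}"
      by (intro exI[of _ ?A] exI[of _ ?B] conjI cA cB un dj)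
    then show False using conn unfolding connected_space_closedin_eq by (rule notE[rotated])
  qed
  then show ?thesis using R(1) by blast
qed

primrec vertex_ball :: "'a \<Rightarrow> nat \<Rightarrow> 'a set" where
  "vertex_ball r 0 = {r}"
| "vertex_ball r (Suc k) = vertex_ball r k \<union>
     {v. \<exists>e\<in>E. \<exists>w\<in>vertex_ball r k. {\<psi> e (-1), \<psi> e 1} = {v, w}}"

text \<open>
  Breadth-first search: the depth of a vertex is its distance from the root, and \<open>up v\<close> is any edge
  to a vertex \<open>par v\<close> closer to the root. If two vertices shared this edge, each would be closer
  to the root than the other.
\<close>

lemma rooted_spanning_tree:
  assumes conn: "connected_space G" and r: "r \<in> V"
  obtains up par depth where
    "\<And>v. v \<in> V - {r} \<Longrightarrow> up v \<in> E"
    "\<And>v. v \<in> V - {r} \<Longrightarrow> {\<psi> (up v) (-1), \<psi> (up v) 1} = {v, par v}"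
    "\<And>v. v \<in> V - {r} \<Longrightarrow> depth (par v) < (depth v :: nat)"
    "inj_on up (V - {r})"
proof -
  let ?B = "vertex_ball r"
  have sub: "?B k \<subseteq> V" for k
  proof (induction k)
    case (Suc k)
    have "v \<in> V" if "e \<in> E" "{\<psi> e (-1), \<psi> e 1} = {v, w}" for v w e
    proof -
      have "v \<in> {\<psi> e (-1), \<psi> e 1}" unfolding that(2) by simp
      then show ?thesis using ends_in_V[OF that(1)] by blast
    qed
    then show ?case using Suc by auto
  qed (use r in simp)
  have step: "v \<in> ?B (Suc k)" if "e \<in> E" "w \<in> ?B k" "{\<psi> e (-1), \<psi> e 1} = {v, w}" for v w e k
    unfolding vertex_ball.simps using that by (intro UnI2 CollectI bexI)
  have "(\<Union>k. ?B k) = V"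
  proof (rule adjacency_closed_eq_V[OF conn])
    show "(\<Union>k. ?B k) \<subseteq> V" using sub by blast
    have "r \<in> ?B 0" by simp
    then show "(\<Union>k. ?B k) \<noteq> {}" by blast
    fix e assume e: "e \<in> E"
    show "\<psi> e (-1) \<in> (\<Union>k. ?B k) \<longleftrightarrow> \<psi> e 1 \<in> (\<Union>k. ?B k)"
    proof
      assume "\<psi> e (-1) \<in> (\<Union>k. ?B k)"
      then obtain k where "\<psi> e (-1) \<in> ?B k" by blast
      from step[OF e this, of "\<psi> e 1"] show "\<psi> e 1 \<in> (\<Union>k. ?B k)" by blast
    next
      assume "\<psi> e 1 \<in> (\<Union>k. ?B k)"
      then obtain k where "\<psi> e 1 \<in> ?B k" by blast
      from step[OF e this, of "\<psi> e (-1)"] show "\<psi> e (-1) \<in> (\<Union>k. ?B k)" by blast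
    qed
  qed
  then have ex: "\<exists>k. v \<in> ?B k" if "v \<in> V" for v using that by blast
  define depth where "depth v = (LEAST k. v \<in> ?B k)" for v
  have "\<exists>e w. e \<in> E \<and> {\<psi> e (-1), \<psi> e 1} = {v, w} \<and> depth w < depth v" if v: "v \<in> V - {r}" for v
  proof -
    have in_ball: "v \<in> ?B (depth v)" unfolding depth_def using v by (intro LeastI_ex[OF ex]) simp
    then obtain k where k: "depth v = Suc k" using v by (cases "depth v") auto
    then have "v \<notin> ?B k" unfolding depth_def by (intro not_less_Least) simp
    then obtain e w where e: "e \<in> E" "w \<in> ?B k" "{\<psi> e (-1), \<psi> e 1} = {v, w}"
      using in_ball unfolding k by auto
    have "depth w \<le> k" unfolding depth_def using e(2) by (rule Least_le)
    then have "depth w < depth v" using k by simp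
    then show ?thesis using e by metis
  qed
  then have "\<forall>v. \<exists>ew. v \<in> V - {r} \<longrightarrow> fst ew \<in> E \<and> {\<psi> (fst ew) (-1), \<psi> (fst ew) 1} = {v, snd ew} \<and>
      depth (snd ew) < depth v" by (metis fst_conv snd_conv)
  from choice[OF this] obtain f where f: "\<forall>v. v \<in> V - {r} \<longrightarrow> fst (f v) \<in> E \<and>
    {\<psi> (fst (f v)) (-1), \<psi> (fst (f v)) 1} = {v, snd (f v)} \<and> depth (snd (f v)) < depth v" ..
  have "inj_on (fst \<circ> f) (V - {r})"
  proof (rule inj_onI, rule ccontr)
    fix v w assume v: "v \<in> V - {r}" and w: "w \<in> V - {r}" and eq: "(fst \<circ> f) v = (fst \<circ> f) w"
      and "v \<noteq> w"
    have "{v, snd (f v)} = {w, snd (f w)}" using f v w eq by (metis comp_apply)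
    then have "snd (f v) = w" "snd (f w) = v" using \<open>v \<noteq> w\<close> by (auto simp: doubleton_eq_iff)
    then have "depth w < depth v" "depth v < depth w" using f v w by metis+
    then show False by simp
  qed
  then show ?thesis using that[of "fst \<circ> f" "snd \<circ> f" depth] f by simp
qed

end

section \<open>The discrete vector field\<close>

text \<open>
  The tree is given by the edge \<open>up v\<close> from each vertex \<open>v\<close> to its parent. The injective \<open>rank\<close> is an
  arbitrary linear order of the vertices.
\<close>

locale rooted_graph = parametrized_graph G V E \<psi>
  for G :: "'a topology" and V :: "'a set" and E :: "'a set set" and \<psi> :: "'a set \<Rightarrow> real \<Rightarrow> 'a" +
  fixes r :: 'a and up :: "'a \<Rightarrow> 'a set" and par :: "'a \<Rightarrow> 'a"
    and depth :: "'a \<Rightarrow> nat" and rank :: "'a \<Rightarrow> nat"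
  assumes root: "r \<in> V"
    and up_edge: "v \<in> V - {r} \<Longrightarrow> up v \<in> E"
    and up_ends: "v \<in> V - {r} \<Longrightarrow> {\<psi> (up v) (-1), \<psi> (up v) 1} = {v, par v}"
    and depth_par: "v \<in> V - {r} \<Longrightarrow> depth (par v) < depth v"
    and inj_up: "inj_on up (V - {r})"
    and inj_rank: "inj_on rank V"
begin

lemma up_inject: "\<lbrakk>v \<in> V - {r}; w \<in> V - {r}; up v = up w\<rbrakk> \<Longrightarrow> v = w"
  using inj_up by (auto dest: inj_onD)

lemma up_neq_vertex: "\<lbrakk>v \<in> V - {r}; w \<in> V\<rbrakk> \<Longrightarrow> up v \<noteq> {w}"
  using up_edge vertex_letter_not_edge by metis

definition letter_class :: "'a \<Rightarrow> 'a set set" where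
  "letter_class v = {{v}, up v}"

lemma letter_class_disjoint:
  assumes "v \<in> V - {r}" "w \<in> V - {r}" "v \<noteq> w" shows "letter_class v \<inter> letter_class w = {}"
proof -
  have "up v \<noteq> up w" "up v \<noteq> {w}" "up w \<noteq> {v}" using assms up_inject up_neq_vertex by blast+
  then show ?thesis using assms(3) by (auto simp: letter_class_def)
qed

definition places :: "nat \<Rightarrow> (nat \<Rightarrow> 'a set) \<Rightarrow> 'a \<Rightarrow> nat set" where
  "places n \<sigma> v = {j. j < n \<and> \<sigma> j \<in> letter_class v}"

text \<open>
  The class of \<open>v\<close> is inactive if it is not used at all, or if its first occurrence is \<open>v\<close> and
  \<open>up v\<close> occurs later.
\<close>

definition active :: "nat \<Rightarrow> (nat \<Rightarrow> 'a set) \<Rightarrow> 'a \<Rightarrow> bool" where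
  "active n \<sigma> v \<longleftrightarrow> v \<in> V - {r} \<and> places n \<sigma> v \<noteq> {} \<and>
     (\<sigma> (Min (places n \<sigma> v)) = up v \<or> (\<forall>j<n. \<sigma> j \<noteq> up v))"

text \<open>
  The active vertex of least rank. Unless some vertex is active this is an arbitrary value, which is why
  activity appears as a separate condition in \<open>redundant\<close>.
\<close>

definition pivot :: "nat \<Rightarrow> (nat \<Rightarrow> 'a set) \<Rightarrow> 'a" where
  "pivot n \<sigma> = (THE v. active n \<sigma> v \<and> (\<forall>w. active n \<sigma> w \<longrightarrow> rank v \<le> rank w))"

definition pivot_place :: "nat \<Rightarrow> (nat \<Rightarrow> 'a set) \<Rightarrow> nat" where
  "pivot_place n \<sigma> = Min (places n \<sigma> (pivot n \<sigma>))"

definition redundant :: "nat \<Rightarrow> (nat \<Rightarrow> 'a set) \<Rightarrow> bool" where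
  "redundant n \<sigma> \<longleftrightarrow> (\<exists>v. active n \<sigma> v) \<and> \<sigma> (pivot_place n \<sigma>) = {pivot n \<sigma>}"

definition lift :: "nat \<Rightarrow> (nat \<Rightarrow> 'a set) \<Rightarrow> nat \<Rightarrow> 'a set" where
  "lift n \<sigma> = \<sigma>(pivot_place n \<sigma> := up (pivot n \<sigma>))"

lemma Min_places:
  assumes "places n \<sigma> v \<noteq> {}"
  shows "Min (places n \<sigma> v) < n" "\<sigma> (Min (places n \<sigma> v)) \<in> letter_class v"
proof -
  have "finite (places n \<sigma> v)" by (simp add: places_def)
  then have "Min (places n \<sigma> v) \<in> places n \<sigma> v" using assms by (rule Min_in)
  then show "Min (places n \<sigma> v) < n" "\<sigma> (Min (places n \<sigma> v)) \<in> letter_class v"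
    by (simp_all add: places_def)
qed

lemma pivot_eqI:
  assumes "active n \<sigma> v" "\<And>w. active n \<sigma> w \<Longrightarrow> rank v \<le> rank w"
  shows "pivot n \<sigma> = v"
  unfolding pivot_def
proof (rule the_equality)
  fix u assume u: "active n \<sigma> u \<and> (\<forall>w. active n \<sigma> w \<longrightarrow> rank u \<le> rank w)"
  then have "rank u = rank v" using assms by (intro antisym) blast+
  moreover have "u \<in> V" "v \<in> V" using u assms(1) by (simp_all add: active_def)
  ultimately show "u = v" using inj_rank by (auto dest: inj_onD)
qed (use assms in blast)

lemma pivot:
  assumes "active n \<sigma> u"
  shows "active n \<sigma> (pivot n \<sigma>)" "active n \<sigma> w \<Longrightarrow> rank (pivot n \<sigma>) \<le> rank w"
proof -
  obtain v where v: "active n \<sigma> v" "\<And>w. active n \<sigma> w \<Longrightarrow> rank v \<le> rank w"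
    using ex_has_least_nat[of "active n \<sigma>" u rank] assms by blast
  then have "pivot n \<sigma> = v" by (rule pivot_eqI)
  then show "active n \<sigma> (pivot n \<sigma>)" "active n \<sigma> w \<Longrightarrow> rank (pivot n \<sigma>) \<le> rank w"
    using v by simp_all
qed

lemma active_vertex: "active n \<sigma> v \<Longrightarrow> v \<in> V - {r}"
  by (simp add: active_def)

lemma places_toggle:
  assumes "v \<in> V - {r}" "\<sigma> k \<in> letter_class v" "a \<in> letter_class v" "w \<in> V - {r}"
  shows "places n (\<sigma>(k := a)) w = places n \<sigma> w"
proof -
  have "a \<in> letter_class w \<longleftrightarrow> \<sigma> k \<in> letter_class w"
    using assms letter_class_disjoint[OF assms(1,4)] by (cases "w = v") auto
  then show ?thesis by (auto simp: places_def)
qed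

text \<open>
  Classes do not interact: a change within the class of \<open>v\<close> is invisible to the other classes. This
  makes the matching an involution and is also what controls the cellular paths.
\<close>

lemma active_toggle:
  assumes "v \<in> V - {r}" "\<sigma> k \<in> letter_class v" "a \<in> letter_class v" "w \<noteq> v"
  shows "active n (\<sigma>(k := a)) w \<longleftrightarrow> active n \<sigma> w"
proof (cases "w \<in> V - {r}")
  case True
  have "a \<noteq> up w" "\<sigma> k \<noteq> up w"
    using assms letter_class_disjoint[OF assms(1) True] by (auto simp: letter_class_def)
  then have eq: "(\<sigma>(k := a)) j = up w \<longleftrightarrow> \<sigma> j = up w" for j by auto
  show ?thesis unfolding active_def places_toggle[of v \<sigma> k a w, OF assms(1-3) True] eq ..
next
  case False
  then show ?thesis unfolding active_def by blast
qed

lemma redundant_pivot: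
  assumes "redundant n \<sigma>"
  shows "active n \<sigma> (pivot n \<sigma>)" "pivot n \<sigma> \<in> V - {r}" "pivot_place n \<sigma> < n"
    "\<sigma> (pivot_place n \<sigma>) = {pivot n \<sigma>}" "\<forall>j<n. \<sigma> j \<noteq> up (pivot n \<sigma>)"
proof -
  show act: "active n \<sigma> (pivot n \<sigma>)" using assms pivot(1) unfolding redundant_def by blast
  show v: "pivot n \<sigma> \<in> V - {r}" by (rule active_vertex[OF act])
  show "pivot_place n \<sigma> < n"
    unfolding pivot_place_def using act by (intro Min_places) (simp add: active_def)
  show eq: "\<sigma> (pivot_place n \<sigma>) = {pivot n \<sigma>}" using assms by (simp add: redundant_def)
  have "up (pivot n \<sigma>) \<noteq> {pivot n \<sigma>}" using v up_neq_vertex by blast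
  then show "\<forall>j<n. \<sigma> j \<noteq> up (pivot n \<sigma>)"
    using act eq unfolding active_def pivot_place_def by metis
qed

text \<open>
  After the switch the class of the pivot is active for the other reason, namely that its first
  occurrence is now the edge.
\<close>

lemma lift_active:
  assumes "redundant n \<sigma>" shows "active n (lift n \<sigma>) w \<longleftrightarrow> active n \<sigma> w"
proof -
  note R = redundant_pivot[OF assms]
  let ?v = "pivot n \<sigma>"
  have cl: "\<sigma> (pivot_place n \<sigma>) \<in> letter_class ?v" "up ?v \<in> letter_class ?v"
    unfolding R(4) by (simp_all add: letter_class_def)
  show ?thesis
  proof (cases "w = ?v")
    case True
    have pl: "places n (lift n \<sigma>) ?v = places n \<sigma> ?v"
      unfolding lift_def by (rule places_toggle[of ?v \<sigma> "pivot_place n \<sigma>", OF R(2) cl R(2)])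
    have "lift n \<sigma> (Min (places n (lift n \<sigma>) ?v)) = up ?v"
      unfolding pl by (simp add: lift_def pivot_place_def)
    then have "active n (lift n \<sigma>) ?v" using R(1) pl by (simp add: active_def)
    then show ?thesis using True R(1) by simp
  next
    case False
    then show ?thesis
      unfolding lift_def by (rule active_toggle[of ?v \<sigma> "pivot_place n \<sigma>", OF R(2) cl])
  qed
qed

lemma lift_pivot:
  assumes "redundant n \<sigma>"
  shows "pivot n (lift n \<sigma>) = pivot n \<sigma>" "pivot_place n (lift n \<sigma>) = pivot_place n \<sigma>"
    "lift n \<sigma> (pivot_place n \<sigma>) = up (pivot n \<sigma>)"
proof -
  note R = redundant_pivot[OF assms]
  show piv: "pivot n (lift n \<sigma>) = pivot n \<sigma>" unfolding pivot_def lift_active[OF assms] ..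
  have cl: "\<sigma> (pivot_place n \<sigma>) \<in> letter_class (pivot n \<sigma>)" "up (pivot n \<sigma>) \<in> letter_class (pivot n \<sigma>)"
    unfolding R(4) by (simp_all add: letter_class_def)
  show "pivot_place n (lift n \<sigma>) = pivot_place n \<sigma>"
    unfolding pivot_place_def[of n "lift n \<sigma>"] piv
    unfolding lift_def places_toggle[of "pivot n \<sigma>" \<sigma> "pivot_place n \<sigma>", OF R(2) cl R(2)]
    by (simp add: pivot_place_def)
  show "lift n \<sigma> (pivot_place n \<sigma>) = up (pivot n \<sigma>)" by (simp add: lift_def)
qed

lemma lift_not_redundant:
  assumes "redundant n \<sigma>" shows "\<not> redundant n (lift n \<sigma>)"
  using lift_pivot[OF assms] redundant_pivot(2)[OF assms] up_neq_vertex by (auto simp: redundant_def)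

lemma lift_inverse:
  assumes "redundant n \<sigma>"
  shows "(lift n \<sigma>)(pivot_place n (lift n \<sigma>) := {pivot n (lift n \<sigma>)}) = \<sigma>"
  unfolding lift_pivot[OF assms] using redundant_pivot(4)[OF assms]
  by (simp add: lift_def fun_upd_idem)

lemma lift_inject:
  assumes "redundant n \<sigma>" "redundant n \<tau>" "lift n \<sigma> = lift n \<tau>" shows "\<sigma> = \<tau>"
  using lift_inverse[OF assms(1)] lift_inverse[OF assms(2)] assms(3) by metis

lemma word_extensional: "\<sigma> \<in> words n i \<Longrightarrow> \<sigma> \<in> extensional {..<n}"
  by (simp add: words_def)

lemma word_card: "\<sigma> \<in> words n i \<Longrightarrow> card {j. j < n \<and> \<sigma> j \<in> E} = i"
  by (simp add: words_def)

lemma lift_word: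
  assumes w: "\<sigma> \<in> words n i" and red: "redundant n \<sigma>" shows "lift n \<sigma> \<in> words n (Suc i)"
proof (rule wordsI)
  note R = redundant_pivot[OF red]
  let ?j = "pivot_place n \<sigma>" and ?u = "up (pivot n \<sigma>)"
  have uE: "?u \<in> E" by (rule up_edge[OF R(2)])
  have nE: "\<sigma> ?j \<notin> E" using R(2,4) vertex_letter_not_edge by simp
  show "lift n \<sigma> \<in> extensional {..<n}"
    using word_extensional[OF w] R(3) by (auto simp: lift_def extensional_def)
  show "lift n \<sigma> j \<in> letters" if "j < n" for j
    using word_letter[OF w that] uE by (simp add: lift_def letters_def)
  show "lift n \<sigma> j \<noteq> lift n \<sigma> k" if "j < n" "k < n" "j \<noteq> k" "lift n \<sigma> j \<in> E" for j k
  proof -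
    have u: "\<sigma> j \<noteq> ?u" "\<sigma> k \<noteq> ?u" using R(5) that(1,2) by blast+
    show ?thesis
    proof (cases "j = ?j \<or> k = ?j")
      case True
      then show ?thesis using u u[symmetric] that(3) by (elim disjE) (simp_all add: lift_def)
    next
      case False
      then have eq: "lift n \<sigma> j = \<sigma> j" "lift n \<sigma> k = \<sigma> k" by (simp_all add: lift_def)
      then have "\<sigma> j \<in> E" using that(4) by simp
      then show ?thesis
        using word_edges_distinct[OF w that(1,2)] that(3) unfolding eq by metis
    qed
  qed
  have "{j. j < n \<and> lift n \<sigma> j \<in> E} = insert ?j {j. j < n \<and> \<sigma> j \<in> E}"
    using uE R(3) by (auto simp: lift_def)
  then show "card {j. j < n \<and> lift n \<sigma> j \<in> E} = Suc i" using nE word_card[OF w] by simp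
qed

lemma lift_regular_face:
  assumes w: "\<sigma> \<in> words n i" and red: "redundant n \<sigma>"
  shows "regular_face (dconf_sink G V E n) (dconf_sink_cells V E n) i (cell n \<sigma>) (cell n (lift n \<sigma>))"
proof -
  note R = redundant_pivot[OF red]
  have restore: "(lift n \<sigma>)(pivot_place n \<sigma> := {pivot n \<sigma>}) = \<sigma>"
    using lift_inverse[OF red] unfolding lift_pivot[OF red] .
  have "pivot n \<sigma> \<noteq> par (pivot n \<sigma>)" using depth_par[OF R(2)] by auto
  moreover have "{\<psi> (lift n \<sigma> (pivot_place n \<sigma>)) (-1), \<psi> (lift n \<sigma> (pivot_place n \<sigma>)) 1} =
      {pivot n \<sigma>, par (pivot n \<sigma>)}"
    unfolding lift_pivot(3)[OF red] by (rule up_ends[OF R(2)])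
  moreover have "lift n \<sigma> (pivot_place n \<sigma>) \<in> E"
    unfolding lift_pivot(3)[OF red] by (rule up_edge[OF R(2)])
  moreover have "(lift n \<sigma>)(pivot_place n \<sigma> := {pivot n \<sigma>}) \<in> words n i" unfolding restore by (rule w)
  ultimately have "regular_face (dconf_sink G V E n) (dconf_sink_cells V E n) i
      (cell n ((lift n \<sigma>)(pivot_place n \<sigma> := {pivot n \<sigma>}))) (cell n (lift n \<sigma>))"
    using regular_face_word[OF lift_word[OF w red] R(3)] by metis
  then show ?thesis unfolding restore .
qed

text \<open>
  If a word has an active class and is not redundant, the first occurrence of the pivot class is
  \<open>up v\<close>. Switching it back to \<open>v\<close> gives a redundant word, since \<open>up v\<close> occurs only once. So a word that is
  neither redundant nor a lift has no active class.
\<close>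

lemma redundant_or_lift:
  assumes w: "\<sigma> \<in> words n i" and act: "active n \<sigma> u" and not_red: "\<not> redundant n \<sigma>"
  obtains \<tau> l where "\<tau> \<in> words n l" "redundant n \<tau>" "lift n \<tau> = \<sigma>"
proof -
  let ?v = "pivot n \<sigma>" and ?j = "pivot_place n \<sigma>"
  let ?\<tau> = "\<sigma>(?j := {?v})"
  have av: "active n \<sigma> ?v" by (rule pivot(1)[OF act])
  have v: "?v \<in> V - {r}" by (rule active_vertex[OF av])
  have ne: "places n \<sigma> ?v \<noteq> {}" using av by (simp add: active_def)
  have j: "?j < n" "\<sigma> ?j \<in> letter_class ?v" unfolding pivot_place_def by (rule Min_places[OF ne])+
  have \<sigma>j: "\<sigma> ?j = up ?v" using j(2) not_red act by (auto simp: letter_class_def redundant_def)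
  have cl: "{?v} \<in> letter_class ?v" by (simp add: letter_class_def)
  have pl: "places n ?\<tau> w = places n \<sigma> w" if "w \<in> V - {r}" for w
    by (rule places_toggle[of ?v \<sigma> ?j, OF v j(2) cl that])
  have other: "k = ?j" if "k < n" "\<sigma> k = up ?v" for k
    using word_edges_distinct[OF w j(1) that(1)] \<sigma>j that(2) up_edge[OF v] by simp
  have upv: "up ?v \<noteq> {?v}" using up_neq_vertex[OF v] v by blast
  have none: "\<forall>k<n. ?\<tau> k \<noteq> up ?v" using other upv by auto
  have act_eq: "active n ?\<tau> w \<longleftrightarrow> active n \<sigma> w" for w
  proof (cases "w = ?v")
    case True
    have "active n ?\<tau> ?v" unfolding active_def pl[OF v] using v ne none by blast
    then show ?thesis using True av by simp
  next
    case False
    then show ?thesis by (rule active_toggle[of ?v \<sigma> ?j, OF v j(2) cl])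
  qed
  have piv: "pivot n ?\<tau> = ?v"
  proof (rule pivot_eqI)
    show "active n ?\<tau> ?v" unfolding act_eq by (rule av)
    show "rank ?v \<le> rank w" if "active n ?\<tau> w" for w
      using that unfolding act_eq by (rule pivot(2)[OF act])
  qed
  have plc: "pivot_place n ?\<tau> = ?j"
    unfolding pivot_place_def[of n ?\<tau>] piv pl[OF v] by (simp add: pivot_place_def)
  have red: "redundant n ?\<tau>" unfolding redundant_def piv plc act_eq using act by auto
  have lift: "lift n ?\<tau> = \<sigma>" unfolding lift_def piv plc using \<sigma>j by (simp add: fun_upd_idem)
  have "?\<tau> \<in> words n (card {k. k < n \<and> ?\<tau> k \<in> E})"
  proof (rule wordsI)
    show "?\<tau> \<in> extensional {..<n}" using word_extensional[OF w] j(1) by (auto simp: extensional_def)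
    show "?\<tau> k \<in> letters" if "k < n" for k using word_letter[OF w that] v by (simp add: letters_def)
    have nE: "{?v} \<notin> E" using v vertex_letter_not_edge by blast
    show "?\<tau> k \<noteq> ?\<tau> l" if "k < n" "l < n" "k \<noteq> l" "?\<tau> k \<in> E" for k l
    proof
      assume eq: "?\<tau> k = ?\<tau> l"
      have "?\<tau> l \<in> E" using that(4) unfolding eq .
      then have "l \<noteq> ?j" using nE by auto
      then have l: "?\<tau> l = \<sigma> l" by simp
      have "k \<noteq> ?j" using that(4) nE by auto
      then have k: "?\<tau> k = \<sigma> k" by simp
      have "\<sigma> k \<in> E" using that(4) unfolding k .
      moreover have "\<sigma> l = \<sigma> k" using eq unfolding k l by (rule sym)
      ultimately have "k = l" by (rule word_edges_distinct[OF w that(1,2)])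
      then show False using that(3) by contradiction
    qed
  qed simp
  then show ?thesis using red lift by (rule that)
qed

subsection \<open>Acyclicity\<close>

text \<open>
  A tree edge has the depth of its end that is farther from the root; every other edge is deeper than
  all vertices. The order is made so that replacing an edge by an end lowers the depth, except when
  \<open>up v\<close> is replaced by \<open>v\<close>.
\<close>

definition letter_depth :: "'a set \<Rightarrow> nat" where
  "letter_depth a = (if a \<in> E then
     (if a \<in> up ` (V - {r}) then depth (the_inv_into (V - {r}) up a) else Suc (Max (depth ` V)))
     else depth (the_elem a))"

lemma letter_depth_vertex: "v \<in> V \<Longrightarrow> letter_depth {v} = depth v"
  by (simp add: letter_depth_def vertex_letter_not_edge)

lemma letter_depth_up: "v \<in> V - {r} \<Longrightarrow> letter_depth (up v) = depth v"
  by (simp add: letter_depth_def up_edge the_inv_into_f_f[OF inj_up])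

lemma letter_depth_end:
  assumes e: "e \<in> E" and u: "u = \<psi> e (-1) \<or> u = \<psi> e 1"
  shows "letter_depth {u} < letter_depth e \<or> (u \<in> V - {r} \<and> e = up u)"
proof (cases "e \<in> up ` (V - {r})")
  case True
  then obtain w where w: "w \<in> V - {r}" "e = up w" by blast
  have "u \<in> {w, par w}" using u up_ends[OF w(1)] w(2) by auto
  then consider "u = w" | "u = par w" by blast
  then show ?thesis
  proof cases
    case 2
    have "u \<in> V" using u ends_in_V[OF e] by blast
    then show ?thesis using depth_par[OF w(1)] 2 w by (simp add: letter_depth_vertex letter_depth_up)
  qed (use w in simp)
next
  case False
  have "u \<in> V" using u ends_in_V[OF e] by blast
  then have "depth u \<le> Max (depth ` V)" using finite_V by simp
  then show ?thesis using False e \<open>u \<in> V\<close> by (simp add: letter_depth_vertex) (simp add: letter_depth_def)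
qed

definition total_depth :: "nat \<Rightarrow> (nat \<Rightarrow> 'a set) \<Rightarrow> nat" where
  "total_depth n \<sigma> = (\<Sum>j<n. letter_depth (\<sigma> j))"

lemma total_depth_update:
  assumes "k < n"
  shows "total_depth n (\<sigma>(k := a)) + letter_depth (\<sigma> k) = total_depth n \<sigma> + letter_depth a"
proof -
  have "total_depth n \<tau> = letter_depth (\<tau> k) + (\<Sum>j\<in>{..<n} - {k}. letter_depth (\<tau> j))" for \<tau>
    unfolding total_depth_def using assms by (intro sum.remove) simp_all
  moreover have "(\<Sum>j\<in>{..<n} - {k}. letter_depth ((\<sigma>(k := a)) j)) = (\<Sum>j\<in>{..<n} - {k}. letter_depth (\<sigma> j))"
    by (rule sum.cong) simp_all
  ultimately show ?thesis by simp
qed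

text \<open>
  Switching \<open>v\<close> to \<open>up v\<close> preserves the total depth, and passing to a face lowers it unless the face
  replaces some \<open>up u\<close> by \<open>u\<close>. If \<open>u = v\<close> the path stays where it was. Otherwise the class of \<open>v\<close>
  remains active in \<open>\<tau>\<close> with \<open>up v\<close> as its first occurrence. As \<open>\<tau>\<close> is redundant its pivot is not \<open>v\<close>,
  so a class of smaller rank has become active.
\<close>

lemma path_step_decreases:
  assumes w: "\<sigma> \<in> words n i" and red: "redundant n \<sigma>"
    and k: "k < n" "lift n \<sigma> k \<in> E" and u: "u = \<psi> (lift n \<sigma> k) (-1) \<or> u = \<psi> (lift n \<sigma> k) 1"
    and \<tau>: "\<tau> = (lift n \<sigma>)(k := {u})" and red': "redundant n \<tau>"
  shows "\<tau> = \<sigma> \<or> total_depth n \<tau> < total_depth n \<sigma> \<or>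
    (total_depth n \<tau> = total_depth n \<sigma> \<and> rank (pivot n \<tau>) < rank (pivot n \<sigma>))"
proof -
  note R = redundant_pivot[OF red] and R' = redundant_pivot[OF red']
  let ?v = "pivot n \<sigma>" and ?j = "pivot_place n \<sigma>" and ?\<beta> = "lift n \<sigma>"
  have \<beta>: "?\<beta> \<in> words n (Suc i)" by (rule lift_word[OF w red])
  have \<beta>j: "?\<beta> ?j = up ?v" by (rule lift_pivot(3)[OF red])
  have total: "total_depth n ?\<beta> = total_depth n \<sigma>"
    using total_depth_update[OF R(3), of \<sigma> "up ?v"] R(2,4)
    by (simp add: lift_def letter_depth_vertex letter_depth_up)
  have upd: "total_depth n \<tau> + letter_depth (?\<beta> k) = total_depth n \<sigma> + letter_depth {u}"
    using total_depth_update[OF k(1), of ?\<beta> "{u}"] unfolding \<tau> total .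
  from letter_depth_end[OF k(2) u] show ?thesis
  proof
    assume "letter_depth {u} < letter_depth (?\<beta> k)"
    then show ?thesis using upd by simp
  next
    assume A: "u \<in> V - {r} \<and> ?\<beta> k = up u"
    then have eq: "total_depth n \<tau> = total_depth n \<sigma>"
      using upd by (simp add: letter_depth_vertex letter_depth_up)
    show ?thesis
    proof (cases "u = ?v")
      case True
      have "k = ?j" using word_edges_distinct[OF \<beta> k(1) R(3) k(2)] A True \<beta>j by simp
      then have "\<tau> = \<sigma>" using lift_inverse[OF red] True unfolding \<tau> lift_pivot[OF red] by simp
      then show ?thesis ..
    next
      case False
      let ?p = "pivot n \<tau>"
      have cl: "?\<beta> k \<in> letter_class u" "{u} \<in> letter_class u" using A by (simp_all add: letter_class_def)
      have uV: "u \<in> V - {r}" using A ..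
      have act: "active n \<tau> x \<longleftrightarrow> active n \<sigma> x" if "x \<noteq> u" for x
        unfolding \<tau> active_toggle[of u ?\<beta> k "{u}" x, OF uV cl that] by (rule lift_active[OF red])
      have av: "active n \<tau> ?v" using act[of ?v] False R(1) by simp
      have pv: "rank ?p \<le> rank ?v" by (rule pivot(2)[OF av av])
      have "k \<noteq> ?j" using A \<beta>j up_inject[OF uV R(2)] False by auto
      then have \<tau>j: "\<tau> ?j = up ?v" using \<beta>j by (simp add: \<tau>)
      have "?p \<noteq> ?v" using R'(5) \<tau>j R(3) by metis
      moreover have "?p \<in> V" "?v \<in> V" using R'(2) R(2) by simp_all
      ultimately have "rank ?p \<noteq> rank ?v" using inj_rank by (auto dest: inj_onD)
      then show ?thesis using eq pv by simp
    qed
  qed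
qed

definition word :: "nat \<Rightarrow> nat \<Rightarrow> (nat \<Rightarrow> 'a) set \<Rightarrow> nat \<Rightarrow> 'a set" where
  "word n i = the_inv_into (words n i) (cell n)"

lemma word_cell: "\<sigma> \<in> words n i \<Longrightarrow> word n i (cell n \<sigma>) = \<sigma>"
  unfolding word_def by (rule the_inv_into_f_f) (auto intro!: inj_onI dest: cell_inject)

definition pairing :: "nat \<Rightarrow> nat \<Rightarrow> (nat \<Rightarrow> 'a) set \<rightharpoonup> (nat \<Rightarrow> 'a) set" where
  "pairing n i c = (if c \<in> cell n ` {\<sigma> \<in> words n i. redundant n \<sigma>}
     then Some (cell n (lift n (word n i c))) else None)"

lemma pairing_cell:
  "\<lbrakk>\<sigma> \<in> words n i; redundant n \<sigma>\<rbrakk> \<Longrightarrow> pairing n i (cell n \<sigma>) = Some (cell n (lift n \<sigma>))"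
  by (simp add: pairing_def word_cell)

lemma pairing_SomeE:
  assumes "pairing n i c = Some d"
  obtains \<sigma> where "\<sigma> \<in> words n i" "redundant n \<sigma>" "c = cell n \<sigma>" "d = cell n (lift n \<sigma>)"
proof -
  have "c \<in> cell n ` {\<sigma> \<in> words n i. redundant n \<sigma>}" using assms by (auto simp: pairing_def split: if_splits)
  then obtain \<sigma> where \<sigma>: "\<sigma> \<in> words n i" "redundant n \<sigma>" "c = cell n \<sigma>" by auto
  then have "d = cell n (lift n \<sigma>)" using assms pairing_cell by simp
  then show ?thesis using \<sigma> that by blast
qed

lemma discrete_vector_field:
  "discrete_vector_field (dconf_sink G V E n) (dconf_sink_cells V E n) (pairing n)"
  unfolding discrete_vector_field_def
proof (intro allI conjI)
  fix i
  show "dom (pairing n i) \<subseteq> dconf_sink_cells V E n i"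
    unfolding dconf_sink_cells_eq by (auto elim: pairing_SomeE)
  show "ran (pairing n i) \<subseteq> dconf_sink_cells V E n (Suc i)"
    unfolding dconf_sink_cells_eq using lift_word by (auto simp: ran_def elim!: pairing_SomeE)
  show "inj_on (pairing n i) (dom (pairing n i))"
  proof (rule inj_onI)
    fix c d assume "c \<in> dom (pairing n i)" "d \<in> dom (pairing n i)" and eq: "pairing n i c = pairing n i d"
    then obtain x where x: "pairing n i c = Some x" "pairing n i d = Some x" by auto
    obtain \<sigma> where \<sigma>: "\<sigma> \<in> words n i" "redundant n \<sigma>" "c = cell n \<sigma>" "x = cell n (lift n \<sigma>)"
      by (rule pairing_SomeE[OF x(1)])
    obtain \<tau> where \<tau>: "\<tau> \<in> words n i" "redundant n \<tau>" "d = cell n \<tau>" "x = cell n (lift n \<tau>)"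
      by (rule pairing_SomeE[OF x(2)])
    have "lift n \<sigma> = lift n \<tau>"
      using cell_inject[OF lift_word[OF \<sigma>(1,2)] lift_word[OF \<tau>(1,2)]] \<sigma>(4) \<tau>(4) by simp
    then show "c = d" using lift_inject \<sigma> \<tau> by metis
  qed
  show "ran (pairing n i) \<inter> dom (pairing n (Suc i)) = {}"
  proof (rule equals0I)
    fix d assume "d \<in> ran (pairing n i) \<inter> dom (pairing n (Suc i))"
    then obtain c x where c: "pairing n i c = Some d" and x: "pairing n (Suc i) d = Some x"
      by (auto simp: ran_def)
    obtain \<sigma> where \<sigma>: "\<sigma> \<in> words n i" "redundant n \<sigma>" "d = cell n (lift n \<sigma>)"
      by (rule pairing_SomeE[OF c])
    obtain \<tau> where \<tau>: "\<tau> \<in> words n (Suc i)" "redundant n \<tau>" "d = cell n \<tau>"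
      by (rule pairing_SomeE[OF x])
    have "\<tau> = lift n \<sigma>" using cell_inject[OF \<tau>(1) lift_word[OF \<sigma>(1,2)]] \<sigma>(3) \<tau>(3) by simp
    then show False using lift_not_redundant[OF \<sigma>(2)] \<tau>(2) by simp
  qed
  fix \<sigma> \<tau>
  show "pairing n i \<sigma> = Some \<tau> \<longrightarrow> regular_face (dconf_sink G V E n) (dconf_sink_cells V E n) i \<sigma> \<tau>"
    using lift_regular_face by (auto elim!: pairing_SomeE)
qed

definition potential :: "nat \<Rightarrow> nat \<Rightarrow> (nat \<Rightarrow> 'a) set \<Rightarrow> nat \<times> nat" where
  "potential n i c = (total_depth n (word n i c), rank (pivot n (word n i c)))"

lemma pairing_step_decreases:
  assumes step: "pairing n i c = Some s" and face: "face (dconf_sink G V E n) (dconf_sink_cells V E n) i d s"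
    and d: "d \<in> dom (pairing n i)"
  shows "d = c \<or> (potential n i d, potential n i c) \<in> less_than <*lex*> less_than"
proof -
  obtain \<sigma> where \<sigma>: "\<sigma> \<in> words n i" "redundant n \<sigma>" "c = cell n \<sigma>" "s = cell n (lift n \<sigma>)"
    by (rule pairing_SomeE[OF step])
  obtain \<beta> k u where \<beta>: "\<beta> \<in> words n (Suc i)" "s = cell n \<beta>" and k: "k < n" "\<beta> k \<in> E"
    and u: "u = \<psi> (\<beta> k) (-1) \<or> u = \<psi> (\<beta> k) 1"
    and \<tau>: "\<beta>(k := {u}) \<in> words n i" "d = cell n (\<beta>(k := {u}))"
    by (rule face_word[OF face])
  have lift: "\<beta> = lift n \<sigma>" using cell_inject[OF \<beta>(1) lift_word[OF \<sigma>(1,2)]] \<beta>(2) \<sigma>(4) by simp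
  obtain x where "pairing n i d = Some x" using d by blast
  then obtain \<tau>' where \<tau>': "\<tau>' \<in> words n i" "redundant n \<tau>'" "d = cell n \<tau>'" by (rule pairing_SomeE)
  have "\<tau>' = \<beta>(k := {u})" using cell_inject[OF \<tau>'(1) \<tau>(1)] \<tau>'(3) \<tau>(2) by simp
  then have red: "redundant n (\<beta>(k := {u}))" using \<tau>'(2) by simp
  have "\<beta>(k := {u}) = \<sigma> \<or> total_depth n (\<beta>(k := {u})) < total_depth n \<sigma> \<or>
    (total_depth n (\<beta>(k := {u})) = total_depth n \<sigma> \<and> rank (pivot n (\<beta>(k := {u}))) < rank (pivot n \<sigma>))"
    using path_step_decreases[OF \<sigma>(1,2) k(1), of u "\<beta>(k := {u})"] k(2) u red unfolding lift by simp
  then show ?thesis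
    unfolding potential_def \<tau>(2) \<sigma>(3) word_cell[OF \<tau>(1)] word_cell[OF \<sigma>(1)] by auto
qed

end

text \<open>
  A potential that strictly decreases at each change of value cannot return to its initial value.
\<close>

lemma closed_decreasing_list_constant:
  assumes r: "trans r" "irrefl r"
    and step: "\<And>j. Suc j < length xs \<Longrightarrow> xs ! Suc j = xs ! j \<or> (f (xs ! Suc j), f (xs ! j)) \<in> r"
    and closed: "hd xs = last xs" and x: "x \<in> set xs"
  shows "x = hd xs"
proof -
  have down: "xs ! k = xs ! j \<or> (f (xs ! k), f (xs ! j)) \<in> r" if "j \<le> k" "k < length xs" for j k
    using that
  proof (induction k rule: dec_induct)
    case (step k)
    have "xs ! k = xs ! j \<or> (f (xs ! k), f (xs ! j)) \<in> r" using step by simp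
    moreover have "xs ! Suc k = xs ! k \<or> (f (xs ! Suc k), f (xs ! k)) \<in> r" using assms(3) step by simp
    ultimately show ?case using transD[OF r(1)] by metis
  qed simp
  obtain j where j: "j < length xs" "x = xs ! j" using x by (auto simp: in_set_conv_nth)
  then have "xs \<noteq> []" by auto
  then have hd: "hd xs = xs ! 0" and last: "last xs = xs ! (length xs - 1)"
    by (simp_all add: hd_conv_nth last_conv_nth)
  have "x = hd xs \<or> (f x, f (hd xs)) \<in> r" using down[of 0 j] j hd by simp
  moreover have "hd xs = x \<or> (f (hd xs), f x) \<in> r"
    using down[of j "length xs - 1"] j last closed by auto
  ultimately show ?thesis using r transD[OF r(1)] unfolding irrefl_def by metis
qed

context rooted_graph
begin

text \<open>
  The estimate for a single step needs both cells to be redundant. On a closed path with at least one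
  step this holds for the last cell as well, because it equals the first one.
\<close>

lemma discrete_gradient_vector_field:
  "discrete_gradient_vector_field (dconf_sink G V E n) (dconf_sink_cells V E n) (pairing n)"
  unfolding discrete_gradient_vector_field_def
proof (intro conjI discrete_vector_field allI impI ballI)
  fix i \<alpha> \<beta>
  assume "cellular_path (dconf_sink G V E n) (dconf_sink_cells V E n) (pairing n) i \<alpha> \<and> hd \<alpha> = last \<alpha>"
    and \<beta>: "\<beta> \<in> set \<alpha>"
  then have path: "\<And>j. Suc j < length \<alpha> \<Longrightarrow> \<exists>\<sigma>. pairing n i (\<alpha> ! j) = Some \<sigma> \<and>
      face (dconf_sink G V E n) (dconf_sink_cells V E n) i (\<alpha> ! Suc j) \<sigma>"
    and closed: "hd \<alpha> = last \<alpha>" and ne: "\<alpha> \<noteq> []" by (simp_all add: cellular_path_def)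
  have dom: "\<alpha> ! Suc j \<in> dom (pairing n i)" if j: "Suc j < length \<alpha>" for j
  proof (cases "Suc (Suc j) < length \<alpha>")
    case True
    then show ?thesis using path[of "Suc j"] by blast
  next
    case False
    then have "\<alpha> ! Suc j = last \<alpha>" using j ne by (simp add: last_conv_nth Suc_lessI flip: closed)
        (metis Suc_lessI diff_Suc_1 last_conv_nth closed ne)
    also have "\<dots> = \<alpha> ! 0" using closed ne by (simp add: hd_conv_nth)
    finally show ?thesis using path[of 0] j by auto
  qed
  show "\<beta> = hd \<alpha>"
  proof (rule closed_decreasing_list_constant[OF _ _ _ closed \<beta>])
    show "trans (less_than <*lex*> less_than)" by (intro trans_lex_prod trans_less_than)
    show "irrefl (less_than <*lex*> less_than)" by (auto simp: irrefl_def)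
    fix j assume j: "Suc j < length \<alpha>"
    then show "\<alpha> ! Suc j = \<alpha> ! j \<or>
      (potential n i (\<alpha> ! Suc j), potential n i (\<alpha> ! j)) \<in> less_than <*lex*> less_than"
      using path[OF j] dom[OF j] pairing_step_decreases by blast
  qed
qed

section \<open>Counting critical cells\<close>

text \<open>
  Words without an active class satisfy this condition: if \<open>v\<close> is used, the only way for its class to
  be inactive is that \<open>up v\<close> occurs too.
\<close>

definition spread_words :: "nat \<Rightarrow> nat \<Rightarrow> (nat \<Rightarrow> 'a set) set" where
  "spread_words n i = {\<sigma> \<in> words n i. \<forall>v\<in>V - {r}. \<forall>j<n. \<sigma> j = {v} \<longrightarrow> (\<exists>k<n. \<sigma> k = up v)}"

lemma critical_cells_subset:
  "critical_cells (dconf_sink_cells V E n) (pairing n) i \<subseteq> cell n ` spread_words n i"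
proof
  fix c assume "c \<in> critical_cells (dconf_sink_cells V E n) (pairing n) i"
  then have c: "c \<in> cell n ` words n i" and nd: "\<And>l. c \<notin> dom (pairing n l)" and nr: "\<And>l. c \<notin> ran (pairing n l)"
    by (simp_all add: critical_cells_def dconf_sink_cells_eq)
  obtain \<sigma> where \<sigma>: "\<sigma> \<in> words n i" "c = cell n \<sigma>" using c by blast
  have not_red: "\<not> redundant n \<sigma>" using pairing_cell[OF \<sigma>(1)] nd[of i] \<sigma>(2) by auto
  have no_act: "\<not> active n \<sigma> v" for v
  proof
    assume "active n \<sigma> v"
    then obtain \<tau> l where "\<tau> \<in> words n l" "redundant n \<tau>" "lift n \<tau> = \<sigma>"
      by (rule redundant_or_lift[OF \<sigma>(1) _ not_red])
    then have "pairing n l (cell n \<tau>) = Some c" using pairing_cell \<sigma>(2) by simp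
    then show False using nr[of l] by (auto simp: ran_def)
  qed
  have "\<exists>k<n. \<sigma> k = up v" if "v \<in> V - {r}" "j < n" "\<sigma> j = {v}" for v j
  proof -
    have "j \<in> places n \<sigma> v" using that by (simp add: places_def letter_class_def)
    then show ?thesis using no_act[of v] that(1) unfolding active_def by blast
  qed
  then have "\<sigma> \<in> spread_words n i" using \<sigma>(1) unfolding spread_words_def by blast
  then show "c \<in> cell n ` spread_words n i" using \<sigma>(2) by blast
qed

text \<open>
  The vertex letters available to a word in \<open>spread_words\<close> with edge letters \<open>\<tau>\<close> at the positions \<open>J\<close>.
\<close>

definition allowed_letters :: "nat set \<Rightarrow> (nat \<Rightarrow> 'a set) \<Rightarrow> 'a set set" where
  "allowed_letters J \<tau> = insert {r} ((\<lambda>v. {v}) ` {v \<in> V - {r}. up v \<in> \<tau> ` J})"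

lemma card_allowed_letters:
  assumes "finite J" shows "finite (allowed_letters J \<tau>)" "card (allowed_letters J \<tau>) \<le> card J + 1"
proof -
  let ?A = "{v \<in> V - {r}. up v \<in> \<tau> ` J}"
  have finA: "finite ?A" using finite_V by simp
  then show "finite (allowed_letters J \<tau>)" by (simp add: allowed_letters_def)
  have "card ?A \<le> card (\<tau> ` J)"
    using assms inj_on_subset[OF inj_up, of ?A] by (intro card_inj_on_le[of up]) auto
  also have "\<dots> \<le> card J" using assms by (rule card_image_le)
  finally have A: "card ?A \<le> card J" .
  have "card (allowed_letters J \<tau>) \<le> Suc (card ((\<lambda>v. {v}) ` ?A))"
    unfolding allowed_letters_def by (rule card_insert_le_m1) simp_all
  also have "\<dots> \<le> Suc (card ?A)" using card_image_le[OF finA] by simp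
  finally show "card (allowed_letters J \<tau>) \<le> card J + 1" using A by simp
qed

text \<open>
  A word is determined by the positions of its edge letters, these letters, and the vertex letters at the
  other positions. For the latter there are at most \<open>i + 1\<close> choices each, because \<open>up\<close> is injective and
  so \<open>i\<close> edges admit at most \<open>i\<close> vertices besides the root.
\<close>

lemma card_spread_words:
  "card (spread_words n i) \<le> n ^ i * card E ^ i * (i + 1) ^ n"
proof -
  let ?I = "{..<n}"
  let ?S = "\<lambda>J \<tau>. PiE ?I (\<lambda>j. if j \<in> J then {\<tau> j} else allowed_letters J \<tau>)"
  let ?Js = "{J. J \<subseteq> ?I \<and> card J = i}"
  have S: "finite (?S J \<tau>)" "card (?S J \<tau>) \<le> (i + 1) ^ n" if J: "J \<in> ?Js" for J \<tau>
  proof -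
    have finJ: "finite J" using J finite_subset[of J ?I] by simp
    have "card (allowed_letters J \<tau>) \<le> i + 1" using card_allowed_letters(2)[OF finJ] J by simp
    then have "(\<Prod>j\<in>?I. card (if j \<in> J then {\<tau> j} else allowed_letters J \<tau>)) \<le> (\<Prod>j\<in>?I. i + 1)"
      by (intro prod_mono) auto
    then show "card (?S J \<tau>) \<le> (i + 1) ^ n" by (simp add: card_PiE)
    show "finite (?S J \<tau>)" using card_allowed_letters(1)[OF finJ] by (intro finite_PiE) auto
  qed
  have T: "finite (PiE J (\<lambda>_. E))" "card (PiE J (\<lambda>_. E)) = card E ^ i" if J: "J \<in> ?Js" for J
  proof -
    have finJ: "finite J" using J finite_subset[of J ?I] by simp
    then show "finite (PiE J (\<lambda>_. E))" using finite_E by (intro finite_PiE) auto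
    show "card (PiE J (\<lambda>_. E)) = card E ^ i" using finJ J by (simp add: card_PiE)
  qed
  have finJs: "finite ?Js" by simp
  have cardJs: "card ?Js \<le> n ^ i"
  proof -
    have "card ?Js = n choose i" using n_subsets[of ?I i] by simp
    also have "\<dots> \<le> n ^ i" by (cases "i \<le> n") (simp_all add: binomial_le_pow binomial_eq_0)
    finally show ?thesis .
  qed
  have "spread_words n i \<subseteq> (\<Union>J\<in>?Js. \<Union>\<tau>\<in>PiE J (\<lambda>_. E). ?S J \<tau>)"
  proof
    fix \<sigma> assume \<sigma>: "\<sigma> \<in> spread_words n i"
    then have w: "\<sigma> \<in> words n i" by (simp add: spread_words_def)
    define J where "J = {j. j < n \<and> \<sigma> j \<in> E}"
    have J: "J \<in> ?Js" using word_card[OF w] by (auto simp: J_def)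
    define \<tau> where "\<tau> = restrict \<sigma> J"
    have \<tau>: "\<tau> \<in> PiE J (\<lambda>_. E)" by (simp add: \<tau>_def J_def PiE_iff)
    have img: "\<tau> ` J = \<sigma> ` J" by (simp add: \<tau>_def)
    have "\<sigma> j \<in> (if j \<in> J then {\<tau> j} else allowed_letters J \<tau>)" if j: "j < n" for j
    proof (cases "j \<in> J")
      case True
      then show ?thesis by (simp add: \<tau>_def)
    next
      case False
      then have "\<sigma> j \<notin> E" using j by (simp add: J_def)
      then obtain v where v: "v \<in> V" "\<sigma> j = {v}" using letter_cases[OF word_letter[OF w j]] by metis
      have "{v} \<in> allowed_letters J \<tau>"
      proof (cases "v = r")
        case vr: False
        then obtain k where k: "k < n" "\<sigma> k = up v" using \<sigma> v j unfolding spread_words_def by blast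
        have "up v \<in> E" using up_edge v(1) vr by blast
        then have "k \<in> J" using k by (simp add: J_def)
        then have "up v \<in> \<tau> ` J" unfolding img k(2)[symmetric] by (rule imageI)
        then show ?thesis using v(1) vr by (simp add: allowed_letters_def)
      qed (simp add: allowed_letters_def)
      then show ?thesis using False v by simp
    qed
    then have S\<sigma>: "\<sigma> \<in> ?S J \<tau>" using word_extensional[OF w] by (simp add: PiE_iff)
    show "\<sigma> \<in> (\<Union>J\<in>?Js. \<Union>\<tau>\<in>PiE J (\<lambda>_. E). ?S J \<tau>)"
      by (rule UN_I[OF J], rule UN_I[OF \<tau>], rule S\<sigma>)
  qed
  then have "card (spread_words n i) \<le> card (\<Union>J\<in>?Js. \<Union>\<tau>\<in>PiE J (\<lambda>_. E). ?S J \<tau>)"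
    using finJs S(1) T(1) by (intro card_mono finite_UN_I) auto
  also have "\<dots> \<le> (\<Sum>J\<in>?Js. card (\<Union>\<tau>\<in>PiE J (\<lambda>_. E). ?S J \<tau>))" by (rule card_UN_le[OF finJs])
  also have "\<dots> \<le> (\<Sum>J\<in>?Js. card E ^ i * (i + 1) ^ n)"
  proof (rule sum_mono)
    fix J assume J: "J \<in> ?Js"
    have "card (\<Union>\<tau>\<in>PiE J (\<lambda>_. E). ?S J \<tau>) \<le> (\<Sum>\<tau>\<in>PiE J (\<lambda>_. E). card (?S J \<tau>))"
      by (rule card_UN_le[OF T(1)[OF J]])
    also have "\<dots> \<le> (\<Sum>\<tau>\<in>PiE J (\<lambda>_. E). (i + 1) ^ n)" by (rule sum_mono[OF S(2)[OF J]])
    also have "\<dots> = card E ^ i * (i + 1) ^ n" using T(2)[OF J] by simp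
    finally show "card (\<Union>\<tau>\<in>PiE J (\<lambda>_. E). ?S J \<tau>) \<le> card E ^ i * (i + 1) ^ n" .
  qed
  also have "\<dots> = card ?Js * (card E ^ i * (i + 1) ^ n)" by simp
  also have "\<dots> \<le> n ^ i * (card E ^ i * (i + 1) ^ n)" by (rule mult_right_mono[OF cardJs]) simp
  finally show ?thesis by (simp add: mult.assoc)
qed

lemma critical_cells_bound:
  "finite (critical_cells (dconf_sink_cells V E n) (pairing n) i)"
  "card (critical_cells (dconf_sink_cells V E n) (pairing n) i) \<le> n ^ i * card E ^ i * (i + 1) ^ n"
proof -
  have fin: "finite (spread_words n i)"
    by (rule finite_subset[OF _ finite_words]) (auto simp: spread_words_def)
  show "finite (critical_cells (dconf_sink_cells V E n) (pairing n) i)"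
    by (rule finite_subset[OF critical_cells_subset finite_imageI[OF fin]])
  have "card (critical_cells (dconf_sink_cells V E n) (pairing n) i) \<le> card (cell n ` spread_words n i)"
    by (rule card_mono[OF finite_imageI[OF fin] critical_cells_subset])
  also have "\<dots> \<le> card (spread_words n i)" by (rule card_image_le[OF fin])
  also have "\<dots> \<le> n ^ i * card E ^ i * (i + 1) ^ n" by (rule card_spread_words)
  finally show "card (critical_cells (dconf_sink_cells V E n) (pairing n) i) \<le> n ^ i * card E ^ i * (i + 1) ^ n" .
qed

end

lemma (in parametrized_graph) rooted_graph_exists:
  assumes "connected_space G" "E \<noteq> {}"
  obtains r up par depth rank where "rooted_graph G V E \<psi> r up par depth rank"
proof -
  obtain e where "e \<in> E" using assms(2) by blast
  then have r: "\<psi> e 1 \<in> V" by (rule ends_in_V)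
  obtain rank :: "'a \<Rightarrow> nat" where rank: "inj_on rank V"
    using finite_imp_inj_to_nat_seg[OF finite_V] by blast
  show ?thesis
  proof (rule rooted_spanning_tree[OF assms(1) r])
    fix up par and depth :: "'a \<Rightarrow> nat"
    assume "\<And>v. v \<in> V - {\<psi> e 1} \<Longrightarrow> up v \<in> E"
      "\<And>v. v \<in> V - {\<psi> e 1} \<Longrightarrow> {\<psi> (up v) (-1), \<psi> (up v) 1} = {v, par v}"
      "\<And>v. v \<in> V - {\<psi> e 1} \<Longrightarrow> depth (par v) < depth v"
      "inj_on up (V - {\<psi> e 1})"
    then have "rooted_graph G V E \<psi> (\<psi> e 1) up par depth rank"
      using r rank by unfold_locales
    then show ?thesis by (rule that)
  qed
qed

theorem theorem3:
  fixes G :: "'a topology" and V :: "'a set" and E :: "'a set set"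
  assumes "cw_graph G V E"
  shows "\<exists>p :: nat \<Rightarrow> real poly.
           (\<forall>i. degree (p i) = i) \<and>
           (\<forall>n.
              cw_complex (dconf_sink G V E n) (dconf_sink_cells V E n) \<and>
              dconf_sink G V E n homotopy_equivalent_space conf_sink G V n \<and>
              (\<exists>X. discrete_gradient_vector_field (dconf_sink G V E n) (dconf_sink_cells V E n) X \<and>
                (\<forall>i. finite (critical_cells (dconf_sink_cells V E n) X i) \<and>
                     real (card (critical_cells (dconf_sink_cells V E n) X i))
                       \<le> poly (p i) (real n) * real (i + 1) ^ n)))"
proof -
  obtain \<psi> where "parametrized_graph G V E \<psi>" by (rule parametrized_graph_of_cw_graph[OF assms])
  then interpret parametrized_graph G V E \<psi> .
  have conn: "connected_space G" and E: "E \<noteq> {}" using assms by (simp_all add: cw_graph_def)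
  obtain r up par depth rank where "rooted_graph G V E \<psi> r up par depth rank"
    by (rule rooted_graph_exists[OF conn E])
  then interpret rooted_graph G V E \<psi> r up par depth rank .
  \<comment> \<open>The leading coefficient is nonzero because the graph has an edge, so the degree is exactly \<open>i\<close>.\<close>
  let ?p = "\<lambda>i. monom (real (card E) ^ i) i"
  have "card E \<noteq> 0" using E finite_E by simp
  then have "degree (?p i) = i" for i by (simp add: degree_monom_eq)
  moreover have "real (card (critical_cells (dconf_sink_cells V E n) (pairing n) i))
      \<le> poly (?p i) (real n) * real (i + 1) ^ n" for n i
  proof -
    have "real (card (critical_cells (dconf_sink_cells V E n) (pairing n) i))
        \<le> real (n ^ i * card E ^ i * (i + 1) ^ n)"
      using critical_cells_bound(2)[of n i] by (rule of_nat_mono)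
    then show ?thesis by (simp add: poly_monom mult_ac)
  qed
  ultimately show ?thesis
    using cw_complex_dconf_sink dconf_sink_homotopy_equivalent discrete_gradient_vector_field
      critical_cells_bound(1)
    by (intro exI[of _ ?p] conjI allI exI[of _ "pairing _"]) blast+
qed

end
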